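(* Let $G$ and $H$ be locally compact groups, let $\pi$ be a continuous unitary representation of $G$ with $\lambda_G\leq_e\pi$, and let $\sigma$ be a continuous unitary representation of $H$ with $\lambda_H\leq_e\sigma$. If $G^\pi\cong H^\sigma$ as semitopological semigroups, then $G\cong H$ (as topological groups). In particular, $G^{\mathcal{E}}\cong H^{\mathcal{E}}$ if and only if $G\cong H$.
   Context: For a continuous unitary representation $\pi$ of $G$ on $\mathcal{H}_\pi$, $F_\pi=\mathrm{span}\{\langle\pi(\cdot)\xi|\eta\rangle:\xi,\eta\in\mathcal{H}_\pi\}$; $\mathcal{E}(\pi)$ is the uniform closure of the algebra of functions generated by $F_\pi+\overline{F_\pi}$ (bar on the space: complex conjugates). $\rho\leq_e\pi$ (Eberlein containment) means $F_\rho\subset\mathcal{E}(\pi)$. $\lambda_G$ is the left regular representation on $L^2(G)$. $G^\pi$ is the weak* closure of $\pi(G)$ in $\mathcal{B}(\mathcal{H}_\pi)$, a compact semitopological semigroup under operator multiplication and the weak* topology. $G^{\mathcal{E}}=G^{\omega_G}$, where $\omega_G=\bigoplus_{u\in\mathrm{P}_1(G)}\pi_u$ is the universal representation ($\mathrm{P}_1(G)$ the continuous positive definite functions with $u(e)=1$, $\pi_u$ the associated cyclic representation). Isomorphism of semitopological semigroups means a semigroup isomorphism which is a homeomorphism. *)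

theory Defs
  imports "HOL-Analysis.Analysis" "HOL-Algebra.Coset" "HOL-Algebra.Module"
begin

section \<open>Semigroups and groups with a topology\<close>

record 'a top_monoid = "'a monoid" +
  topo :: "'a topology"

locale locally_compact_group = group G for G (structure) +
  assumes topspace_topo: "topspace (topo G) = carrier G"
    and continuous_mult:
      "continuous_map (prod_topology (topo G) (topo G)) (topo G) (\<lambda>(x, y). x \<otimes> y)"
    and continuous_inv: "continuous_map (topo G) (topo G) (\<lambda>x. inv x)"
    and Hausdorff: "Hausdorff_space (topo G)"
    and locally_compact: "locally_compact_space (topo G)"

text \<open>Only the multiplication and the topology enter here (the set \<^const>\<open>iso\<close> consists of the
  bijective multiplicative maps), so the notion serves both for topological groups and for
  semitopological semigroups.\<close>

definition top_isomorphic :: "('a, 'm) top_monoid_scheme \<Rightarrow> ('b, 'n) top_monoid_scheme \<Rightarrow> bool"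
  where "top_isomorphic S S' \<longleftrightarrow> (\<exists>\<phi>\<in>iso S S'. homeomorphic_map (topo S) (topo S') \<phi>)"


section \<open>Complex Hilbert spaces\<close>

definition complex_ring :: "complex ring"
  where "complex_ring = \<lparr>carrier = UNIV, mult = (*), one = 1, zero = 0, add = (+)\<rparr>"

text \<open>A module record carries the fields \<^const>\<open>mult\<close> and \<^const>\<open>one\<close> of a ring; they play no role
  for modules and are left undefined in the constructions below. The form \<open>ip\<close> is linear in its
  first argument.\<close>

record 'v ip_space = "(complex, 'v) module" +
  ip :: "'v \<Rightarrow> 'v \<Rightarrow> complex"

definition ip_norm :: "('v, 'm) ip_space_scheme \<Rightarrow> 'v \<Rightarrow> real"
  where "ip_norm V x = sqrt (Re (ip V x x))"

text \<open>The locale \<^locale>\<open>Metric_space\<close> requires symmetry and nonnegativity also off the carrier.\<close>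

definition ip_dist :: "('v, 'm) ip_space_scheme \<Rightarrow> 'v \<Rightarrow> 'v \<Rightarrow> real"
  where "ip_dist V x y =
    (if x \<in> carrier V \<and> y \<in> carrier V then ip_norm V (x \<ominus>\<^bsub>V\<^esub> y) else 0)"

locale complex_hilbert_space = module complex_ring V for V (structure) +
  assumes ip_add_left:
      "\<lbrakk>x \<in> carrier V; y \<in> carrier V; z \<in> carrier V\<rbrakk> \<Longrightarrow> ip V (x \<oplus> y) z = ip V x z + ip V y z"
    and ip_smult_left:
      "\<lbrakk>x \<in> carrier V; y \<in> carrier V\<rbrakk> \<Longrightarrow> ip V (c \<odot>\<^bsub>V\<^esub> x) y = c * ip V x y"
    and ip_commute: "\<lbrakk>x \<in> carrier V; y \<in> carrier V\<rbrakk> \<Longrightarrow> ip V y x = cnj (ip V x y)"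
    and ip_nonneg: "x \<in> carrier V \<Longrightarrow> ip V x x \<in> \<real>\<^sub>\<ge>\<^sub>0"
    and ip_definite: "\<lbrakk>x \<in> carrier V; ip V x x = 0\<rbrakk> \<Longrightarrow> x = \<zero>"
    and complete: "Metric_space.mcomplete (carrier V) (ip_dist V)"

text \<open>The quotient of a space with a positive semidefinite form by its null vectors, and the
  space of Cauchy sequences. The separation of the space of Cauchy sequences is the Hilbert
  space completion (of the separation) of \<open>V\<close>.\<close>

definition null_class :: "('v, 'm) ip_space_scheme \<Rightarrow> 'v \<Rightarrow> 'v set"
  where "null_class V x = {y \<in> carrier V. ip_norm V (x \<ominus>\<^bsub>V\<^esub> y) = 0}"

definition class_rep :: "'v set \<Rightarrow> 'v"
  where "class_rep A = (SOME x. x \<in> A)"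

definition separation :: "('v, 'm) ip_space_scheme \<Rightarrow> 'v set ip_space"
  where "separation V =
    \<lparr>carrier = null_class V ` carrier V,
     mult = undefined,
     one = undefined,
     zero = null_class V \<zero>\<^bsub>V\<^esub>,
     add = (\<lambda>A B. null_class V (class_rep A \<oplus>\<^bsub>V\<^esub> class_rep B)),
     smult = (\<lambda>c A. null_class V (c \<odot>\<^bsub>V\<^esub> class_rep A)),
     ip = (\<lambda>A B. ip V (class_rep A) (class_rep B))\<rparr>"

definition separation_map :: "('v, 'm) ip_space_scheme \<Rightarrow> ('v \<Rightarrow> 'v) \<Rightarrow> 'v set \<Rightarrow> 'v set"
  where "separation_map V T = (\<lambda>A\<in>carrier (separation V). null_class V (T (class_rep A)))"

definition cauchy_space :: "('v, 'm) ip_space_scheme \<Rightarrow> (nat \<Rightarrow> 'v) ip_space"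
  where "cauchy_space V =
    \<lparr>carrier = {X. range X \<subseteq> carrier V \<and>
        (\<forall>e>0. \<exists>N. \<forall>m\<ge>N. \<forall>n\<ge>N. ip_norm V (X m \<ominus>\<^bsub>V\<^esub> X n) < e)},
     mult = undefined,
     one = undefined,
     zero = (\<lambda>n. \<zero>\<^bsub>V\<^esub>),
     add = (\<lambda>X Y n. X n \<oplus>\<^bsub>V\<^esub> Y n),
     smult = (\<lambda>c X n. c \<odot>\<^bsub>V\<^esub> X n),
     ip = (\<lambda>X Y. lim (\<lambda>n. ip V (X n) (Y n)))\<rparr>"

definition direct_sum :: "'i set \<Rightarrow> ('i \<Rightarrow> ('v, 'm) ip_space_scheme) \<Rightarrow> ('i \<Rightarrow> 'v) ip_space"
  where "direct_sum I V =
    \<lparr>carrier = {\<xi> \<in> PiE I (\<lambda>i. carrier (V i)). (\<lambda>i. (ip_norm (V i) (\<xi> i))\<^sup>2) summable_on I},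
     mult = undefined,
     one = undefined,
     zero = (\<lambda>i\<in>I. \<zero>\<^bsub>V i\<^esub>),
     add = (\<lambda>\<xi> \<eta>. \<lambda>i\<in>I. \<xi> i \<oplus>\<^bsub>V i\<^esub> \<eta> i),
     smult = (\<lambda>c \<xi>. \<lambda>i\<in>I. c \<odot>\<^bsub>V i\<^esub> \<xi> i),
     ip = (\<lambda>\<xi> \<eta>. \<Sum>\<^sub>\<infinity>i\<in>I. ip (V i) (\<xi> i) (\<eta> i))\<rparr>"


section \<open>Bounded operators and the weak* topology\<close>

text \<open>Operators are extensional (undefined off the carrier), so that equality of functions is
  equality of operators.\<close>

definition bounded_operators :: "('v, 'm) ip_space_scheme \<Rightarrow> ('v \<Rightarrow> 'v) set"
  where "bounded_operators V = {T \<in> carrier V \<rightarrow>\<^sub>E carrier V.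
    (\<forall>x\<in>carrier V. \<forall>y\<in>carrier V. T (x \<oplus>\<^bsub>V\<^esub> y) = T x \<oplus>\<^bsub>V\<^esub> T y) \<and>
    (\<forall>c. \<forall>x\<in>carrier V. T (c \<odot>\<^bsub>V\<^esub> x) = c \<odot>\<^bsub>V\<^esub> T x) \<and>
    (\<exists>C. \<forall>x\<in>carrier V. ip_norm V (T x) \<le> C * ip_norm V x)}"

definition unitary_operators :: "('v, 'm) ip_space_scheme \<Rightarrow> ('v \<Rightarrow> 'v) set"
  where "unitary_operators V = {T \<in> bounded_operators V.
    T ` carrier V = carrier V \<and>
    (\<forall>x\<in>carrier V. \<forall>y\<in>carrier V. ip V (T x) (T y) = ip V x y)}"

text \<open>The predual of the bounded operators is the space of trace class operators; the functionals
  it induces are exactly the maps \<open>T \<mapsto> \<Sum>n. \<langle>T (\<xi> n) | \<eta> n\<rangle>\<close> with \<open>\<xi>\<close> and \<open>\<eta>\<close> square summable.\<close>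

definition square_summable_seqs :: "('v, 'm) ip_space_scheme \<Rightarrow> (nat \<Rightarrow> 'v) set"
  where "square_summable_seqs V =
    {\<xi>. range \<xi> \<subseteq> carrier V \<and> summable (\<lambda>n. (ip_norm V (\<xi> n))\<^sup>2)}"

definition weak_star_topology :: "('v, 'm) ip_space_scheme \<Rightarrow> ('v \<Rightarrow> 'v) topology"
  where "weak_star_topology V = topology_generated_by
    {{T \<in> bounded_operators V. (\<Sum>n. ip V (T (\<xi> n)) (\<eta> n)) \<in> U} | \<xi> \<eta> U.
      \<xi> \<in> square_summable_seqs V \<and> \<eta> \<in> square_summable_seqs V \<and> open U}"


section \<open>Unitary representations and their compactifications\<close>

definition continuous_unitary_rep ::
    "('a, 'm) top_monoid_scheme \<Rightarrow> ('v, 'n) ip_space_scheme \<Rightarrow> ('a \<Rightarrow> 'v \<Rightarrow> 'v) \<Rightarrow> bool"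
  where "continuous_unitary_rep G V \<pi> \<longleftrightarrow>
    complex_hilbert_space V \<and>
    (\<forall>s\<in>carrier G. \<pi> s \<in> unitary_operators V) \<and>
    (\<forall>s\<in>carrier G. \<forall>t\<in>carrier G. \<pi> (s \<otimes>\<^bsub>G\<^esub> t) = compose (carrier V) (\<pi> s) (\<pi> t)) \<and>
    (\<forall>\<xi>\<in>carrier V. continuous_map (topo G)
      (Metric_space.mtopology (carrier V) (ip_dist V)) (\<lambda>s. \<pi> s \<xi>))"

definition rep_compactification ::
    "('a, 'm) top_monoid_scheme \<Rightarrow> ('v, 'n) ip_space_scheme \<Rightarrow> ('a \<Rightarrow> 'v \<Rightarrow> 'v) \<Rightarrow>
      ('v \<Rightarrow> 'v) top_monoid"
  where "rep_compactification G V \<pi> =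
    (let C = weak_star_topology V closure_of (\<pi> ` carrier G) in
      \<lparr>carrier = C,
       mult = compose (carrier V),
       one = (\<lambda>x\<in>carrier V. x),
       topo = subtopology (weak_star_topology V) C\<rparr>)"

text \<open>Functions on \<open>G\<close> are extensional (undefined off the carrier).\<close>

definition coefficient_space ::
    "('a, 'm) top_monoid_scheme \<Rightarrow> ('v, 'n) ip_space_scheme \<Rightarrow> ('a \<Rightarrow> 'v \<Rightarrow> 'v) \<Rightarrow>
      ('a \<Rightarrow> complex) set"
  where "coefficient_space G V \<pi> =
    {\<lambda>s\<in>carrier G. \<Sum>i<n. c i * ip V (\<pi> s (\<xi> i)) (\<eta> i) | (n :: nat) c \<xi> \<eta>.
      (\<forall>i<n. \<xi> i \<in> carrier V \<and> \<eta> i \<in> carrier V)}"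

inductive_set generated_function_algebra :: "'a set \<Rightarrow> ('a \<Rightarrow> complex) set \<Rightarrow> ('a \<Rightarrow> complex) set"
  for S :: "'a set" and F :: "('a \<Rightarrow> complex) set"
  where
    gen: "f \<in> F \<Longrightarrow> f \<in> generated_function_algebra S F"
  | add: "\<lbrakk>f \<in> generated_function_algebra S F; g \<in> generated_function_algebra S F\<rbrakk>
      \<Longrightarrow> (\<lambda>s\<in>S. f s + g s) \<in> generated_function_algebra S F"
  | smult: "f \<in> generated_function_algebra S F
      \<Longrightarrow> (\<lambda>s\<in>S. c * f s) \<in> generated_function_algebra S F"
  | mult: "\<lbrakk>f \<in> generated_function_algebra S F; g \<in> generated_function_algebra S F\<rbrakk>
      \<Longrightarrow> (\<lambda>s\<in>S. f s * g s) \<in> generated_function_algebra S F"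

definition uniform_closure :: "'a set \<Rightarrow> ('a \<Rightarrow> complex) set \<Rightarrow> ('a \<Rightarrow> complex) set"
  where "uniform_closure S A =
    {f \<in> extensional S. \<forall>e>0. \<exists>h\<in>A. \<forall>s\<in>S. cmod (f s - h s) < e}"

definition eberlein_algebra ::
    "('a, 'm) top_monoid_scheme \<Rightarrow> ('v, 'n) ip_space_scheme \<Rightarrow> ('a \<Rightarrow> 'v \<Rightarrow> 'v) \<Rightarrow>
      ('a \<Rightarrow> complex) set"
  where "eberlein_algebra G V \<pi> = uniform_closure (carrier G)
    (generated_function_algebra (carrier G)
      {\<lambda>s\<in>carrier G. f s + cnj (g s) | f g.
        f \<in> coefficient_space G V \<pi> \<and> g \<in> coefficient_space G V \<pi>})"

definition eberlein_contained ::
    "('a, 'm) top_monoid_scheme \<Rightarrow> ('w, 'k) ip_space_scheme \<Rightarrow> ('a \<Rightarrow> 'w \<Rightarrow> 'w) \<Rightarrow>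
      ('v, 'n) ip_space_scheme \<Rightarrow> ('a \<Rightarrow> 'v \<Rightarrow> 'v) \<Rightarrow> bool"
  where "eberlein_contained G W \<rho> V \<pi> \<longleftrightarrow> coefficient_space G W \<rho> \<subseteq> eberlein_algebra G V \<pi>"


section \<open>Haar measure and the left regular representation\<close>

text \<open>A left Haar measure is a nonzero left invariant Radon measure on the Borel sets: finite on
  compact sets, outer regular on Borel sets and inner regular on open sets.\<close>

definition left_haar_measure :: "('a, 'm) top_monoid_scheme \<Rightarrow> 'a measure \<Rightarrow> bool"
  where "left_haar_measure G \<mu> \<longleftrightarrow>
    space \<mu> = carrier G \<and>
    sets \<mu> = sigma_sets (carrier G) {U. openin (topo G) U} \<and>
    emeasure \<mu> (carrier G) \<noteq> 0 \<and>
    (\<forall>K. compactin (topo G) K \<longrightarrow> emeasure \<mu> K < \<infinity>) \<and>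
    (\<forall>A\<in>sets \<mu>. emeasure \<mu> A = (INF U\<in>{U. openin (topo G) U \<and> A \<subseteq> U}. emeasure \<mu> U)) \<and>
    (\<forall>U. openin (topo G) U \<longrightarrow>
      emeasure \<mu> U = (SUP K\<in>{K. compactin (topo G) K \<and> K \<subseteq> U}. emeasure \<mu> K)) \<and>
    (\<forall>s\<in>carrier G. \<forall>A\<in>sets \<mu>. emeasure \<mu> (s <#\<^bsub>G\<^esub> A) = emeasure \<mu> A)"

definition square_integrable_space :: "'a measure \<Rightarrow> ('a \<Rightarrow> complex) ip_space"
  where "square_integrable_space \<mu> =
    \<lparr>carrier = {f \<in> borel_measurable \<mu>. integrable \<mu> (\<lambda>t. (cmod (f t))\<^sup>2)},
     mult = undefined,
     one = undefined,
     zero = (\<lambda>t. 0),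
     add = (\<lambda>f g t. f t + g t),
     smult = (\<lambda>c f t. c * f t),
     ip = (\<lambda>f g. \<integral>t. f t * cnj (g t) \<partial>\<mu>)\<rparr>"

definition L2_space :: "'a measure \<Rightarrow> ('a \<Rightarrow> complex) set ip_space"
  where "L2_space \<mu> = separation (square_integrable_space \<mu>)"

definition left_translate :: "('a, 'm) monoid_scheme \<Rightarrow> 'a \<Rightarrow> ('a \<Rightarrow> complex) \<Rightarrow> 'a \<Rightarrow> complex"
  where "left_translate G s f = (\<lambda>t. if t \<in> carrier G then f (inv\<^bsub>G\<^esub> s \<otimes>\<^bsub>G\<^esub> t) else 0)"

definition left_regular_rep ::
    "('a, 'm) monoid_scheme \<Rightarrow> 'a measure \<Rightarrow> 'a \<Rightarrow> ('a \<Rightarrow> complex) set \<Rightarrow> ('a \<Rightarrow> complex) set"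
  where "left_regular_rep G \<mu> s = separation_map (square_integrable_space \<mu>) (left_translate G s)"


section \<open>The universal representation\<close>

definition normalized_positive_definite :: "('a, 'm) top_monoid_scheme \<Rightarrow> ('a \<Rightarrow> complex) set"
  where "normalized_positive_definite G = {u \<in> extensional (carrier G).
    continuous_map (topo G) euclidean u \<and>
    (\<forall>(n :: nat) c s. (\<forall>i<n. s i \<in> carrier G) \<longrightarrow>
      (\<Sum>i<n. \<Sum>j<n. c i * cnj (c j) * u (inv\<^bsub>G\<^esub> (s j) \<otimes>\<^bsub>G\<^esub> s i)) \<in> \<real>\<^sub>\<ge>\<^sub>0) \<and>
    u \<one>\<^bsub>G\<^esub> = 1}"

text \<open>The GNS construction: the finitely supported functions on \<open>G\<close> with the form determined by
  \<open>\<langle>\<delta>\<^sub>s | \<delta>\<^sub>t\<rangle> = u (t\<^sup>-\<^sup>1 s)\<close>, on which \<open>G\<close> acts by left translation, separated and completed. The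
  class of \<open>\<delta>\<^sub>e\<close> is a cyclic vector with coefficient function \<open>u\<close>.\<close>

definition group_algebra_space ::
    "('a, 'm) monoid_scheme \<Rightarrow> ('a \<Rightarrow> complex) \<Rightarrow> ('a \<Rightarrow> complex) ip_space"
  where "group_algebra_space G u =
    \<lparr>carrier = {f. finite {s. f s \<noteq> 0} \<and> {s. f s \<noteq> 0} \<subseteq> carrier G},
     mult = undefined,
     one = undefined,
     zero = (\<lambda>s. 0),
     add = (\<lambda>f g s. f s + g s),
     smult = (\<lambda>c f s. c * f s),
     ip = (\<lambda>f g. \<Sum>s\<in>{s. f s \<noteq> 0}. \<Sum>t\<in>{t. g t \<noteq> 0}.
        f s * cnj (g t) * u (inv\<^bsub>G\<^esub> t \<otimes>\<^bsub>G\<^esub> s))\<rparr>"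

definition gns_space ::
    "('a, 'm) monoid_scheme \<Rightarrow> ('a \<Rightarrow> complex) \<Rightarrow> (nat \<Rightarrow> 'a \<Rightarrow> complex) set ip_space"
  where "gns_space G u = separation (cauchy_space (group_algebra_space G u))"

definition gns_rep ::
    "('a, 'm) monoid_scheme \<Rightarrow> ('a \<Rightarrow> complex) \<Rightarrow> 'a \<Rightarrow>
      (nat \<Rightarrow> 'a \<Rightarrow> complex) set \<Rightarrow> (nat \<Rightarrow> 'a \<Rightarrow> complex) set"
  where "gns_rep G u s = separation_map (cauchy_space (group_algebra_space G u))
    (\<lambda>X n. left_translate G s (X n))"

definition universal_space ::
    "('a, 'm) top_monoid_scheme \<Rightarrow>
      (('a \<Rightarrow> complex) \<Rightarrow> (nat \<Rightarrow> 'a \<Rightarrow> complex) set) ip_space"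
  where "universal_space G = direct_sum (normalized_positive_definite G) (gns_space G)"

definition universal_rep ::
    "('a, 'm) top_monoid_scheme \<Rightarrow> 'a \<Rightarrow>
      (('a \<Rightarrow> complex) \<Rightarrow> (nat \<Rightarrow> 'a \<Rightarrow> complex) set) \<Rightarrow>
      (('a \<Rightarrow> complex) \<Rightarrow> (nat \<Rightarrow> 'a \<Rightarrow> complex) set)"
  where "universal_rep G s =
    (\<lambda>\<xi>\<in>carrier (universal_space G). \<lambda>u\<in>normalized_positive_definite G. gns_rep G u s (\<xi> u))"

definition eberlein_compactification ::
    "('a, 'm) top_monoid_scheme \<Rightarrow>
      ((('a \<Rightarrow> complex) \<Rightarrow> (nat \<Rightarrow> 'a \<Rightarrow> complex) set) \<Rightarrow>
       (('a \<Rightarrow> complex) \<Rightarrow> (nat \<Rightarrow> 'a \<Rightarrow> complex) set)) top_monoid"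
  where "eberlein_compactification G =
    rep_compactification G (universal_space G) (universal_rep G)"

end

theory Submission
  imports Defs
begin

text \<open>
  Say that \<open>\<pi>\<close> separates if every neighbourhood of every \<open>s\<close> supports a function of the Eberlein
  algebra of \<open>\<pi>\<close> that does not vanish at \<open>s\<close> and has compact support. An approximation of such a
  function by a polynomial in coefficients extends to a weak* continuous function on all operators,
  so \<open>\<pi>\<close> embeds \<open>G\<close> homeomorphically onto an open subset of its compactification. A unit of the
  compactification is a unitary operator, hence multiplication by it is a homeomorphism and moves
  that open set to an open set meeting the dense set \<open>\<pi>(G)\<close>; thus \<open>\<pi>(G)\<close> is exactly the group of
  units, and an isomorphism of compactifications restricts to one of the groups.

  A representation that Eberlein contains the left regular one separates because of the coefficients
  \<open>t \<mapsto> \<mu> (t A \<inter> s A)\<close>. For the universal representation no Haar measure is given; here positive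
  definite functions \<open>s \<mapsto> I (h \<cdot> L\<^sub>s h)\<close> of small support are used, where \<open>I\<close> is an invariant functional
  on the nonnegative continuous functions with compact support, constructed after Weil.
\<close>

text \<open>The hypothesis places the coefficients of the left regular representation only in the
  uniform closure of an algebra, so on the compactification they are visible through approximations
  alone. Compact support makes up for this: where an approximant is large, only group elements from
  a compact set can be nearby, and the image of that set is closed, so that no point at infinity of
  the compactification comes near.

  The weak* closure consists of contractions, and two mutually inverse contractions are isometries
  adjoint to each other. This is what makes multiplication by a unit from the left weak* continuous.

  The argument is carried out for isometric actions with continuous coefficients, a form in which a
  given representation and the universal one can be treated alike; the latter is followed through
  group algebra, Cauchy sequences, separation and direct sum. Passing from isomorphic groups to
  isomorphic compactifications means transporting this construction: positive definite functions are
  pulled back, each stage carries an intertwining isometry, and conjugation by the final one is a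
  weak* homeomorphism.\<close>

lemma cring_complex_ring: "cring complex_ring"
proof (rule cringI)
  show "abelian_group complex_ring"
    by (rule abelian_groupI) (auto simp: complex_ring_def algebra_simps intro: exI[of _ "- _"] left_minus)
  show "comm_monoid complex_ring"
    by (rule comm_monoidI) (auto simp: complex_ring_def)
qed (auto simp: complex_ring_def algebra_simps)

lemma complex_ring_simps [simp]:
  "carrier complex_ring = UNIV" "mult complex_ring = (*)" "one complex_ring = 1"
  "zero complex_ring = 0" "add complex_ring = (+)"
  by (auto simp: complex_ring_def)

text \<open>The e/3 argument for uniform limits. One approximant for each \<open>e\<close> suffices,
  so partial sums of series, finite subsums over an arbitrary index set and single members of a
  Cauchy sequence can all be used.\<close>

lemma continuous_map_uniform_approx:
  fixes f :: "'a \<Rightarrow> 'b::metric_space"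
  assumes "\<And>e. e > 0 \<Longrightarrow> \<exists>g. continuous_map X euclidean g \<and> (\<forall>x\<in>topspace X. dist (f x) (g x) < e)"
  shows "continuous_map X euclidean f"
proof -
  have "\<exists>U. openin X U \<and> x \<in> U \<and> (\<forall>y\<in>U. dist (f x) (f y) < e)"
    if x: "x \<in> topspace X" and e: "e > 0" for x e
  proof -
    obtain g where g: "continuous_map X euclidean g" "\<And>y. y \<in> topspace X \<Longrightarrow> dist (f y) (g y) < e/3"
      using assms[of "e/3"] e by auto
    define U where "U = {y \<in> topspace X. g y \<in> ball (g x) (e/3)}"
    have "openin X U"
      unfolding U_def by (rule openin_continuous_map_preimage[OF g(1)]) auto
    moreover have "x \<in> U" using x e by (auto simp: U_def)
    moreover have "dist (f x) (f y) < e" if "y \<in> U" for y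
    proof -
      have "dist (f x) (f y) \<le> dist (f x) (g x) + dist (g x) (g y) + dist (f y) (g y)"
        by (smt (verit) dist_commute dist_triangle)
      then show ?thesis using g(2)[of x] g(2)[of y] x that unfolding U_def by auto
    qed
    ultimately show ?thesis by blast
  qed
  then show ?thesis
    unfolding mtopology_is_euclidean[symmetric] Met_TC.continuous_map_to_metric
    by (auto simp: mball_eq_ball)
qed

section \<open>Positive semidefinite forms\<close>

text \<open>Square integrable functions, finitely supported functions on the group and Cauchy
  sequences carry only semidefinite forms; definiteness is reached after
  \<open>separation\<close>.\<close>

locale semi_ip_space = module complex_ring V for V (structure) +
  assumes ip_add_left:
      "\<lbrakk>x \<in> carrier V; y \<in> carrier V; z \<in> carrier V\<rbrakk> \<Longrightarrow> ip V (x \<oplus> y) z = ip V x z + ip V y z"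
    and ip_smult_left:
      "\<lbrakk>x \<in> carrier V; y \<in> carrier V\<rbrakk> \<Longrightarrow> ip V (c \<odot>\<^bsub>V\<^esub> x) y = c * ip V x y"
    and ip_commute: "\<lbrakk>x \<in> carrier V; y \<in> carrier V\<rbrakk> \<Longrightarrow> ip V y x = cnj (ip V x y)"
    and ip_nonneg: "x \<in> carrier V \<Longrightarrow> ip V x x \<in> \<real>\<^sub>\<ge>\<^sub>0"

text \<open>Unitary actions live on these spaces: definiteness lets vectors, and hence operators, be
  recognized by their inner products.\<close>

locale definite_ip_space = semi_ip_space +
  assumes ip_definite: "\<lbrakk>x \<in> carrier V; ip V x x = 0\<rbrakk> \<Longrightarrow> x = \<zero>"

lemma (in complex_hilbert_space) definite_ip_space: "definite_ip_space V"
  by unfold_locales (auto simp: ip_add_left ip_smult_left ip_nonneg ip_definite intro: ip_commute)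

text \<open>The additive inverse of \<open>x\<close> is \<open>(- 1)\<close> times \<open>x\<close>,
  by distributivity and the rule for the scalar 0; the concrete spaces then have no subtraction to
  construct.\<close>

lemma semi_ip_spaceI:
  fixes V (structure)
  assumes add_closed: "\<And>x y. \<lbrakk>x \<in> carrier V; y \<in> carrier V\<rbrakk> \<Longrightarrow> x \<oplus> y \<in> carrier V"
    and zero: "\<zero> \<in> carrier V"
    and smult_closed: "\<And>c x. x \<in> carrier V \<Longrightarrow> c \<odot>\<^bsub>V\<^esub> x \<in> carrier V"
    and assoc: "\<And>x y z. \<lbrakk>x \<in> carrier V; y \<in> carrier V; z \<in> carrier V\<rbrakk> \<Longrightarrow> x \<oplus> y \<oplus> z = x \<oplus> (y \<oplus> z)"
    and comm: "\<And>x y. \<lbrakk>x \<in> carrier V; y \<in> carrier V\<rbrakk> \<Longrightarrow> x \<oplus> y = y \<oplus> x"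
    and l_zero: "\<And>x. x \<in> carrier V \<Longrightarrow> \<zero> \<oplus> x = x"
    and smult_l_distr: "\<And>a b x. x \<in> carrier V \<Longrightarrow> (a + b) \<odot>\<^bsub>V\<^esub> x = a \<odot>\<^bsub>V\<^esub> x \<oplus> b \<odot>\<^bsub>V\<^esub> x"
    and smult_r_distr: "\<And>a x y. \<lbrakk>x \<in> carrier V; y \<in> carrier V\<rbrakk> \<Longrightarrow> a \<odot>\<^bsub>V\<^esub> (x \<oplus> y) = a \<odot>\<^bsub>V\<^esub> x \<oplus> a \<odot>\<^bsub>V\<^esub> y"
    and smult_assoc: "\<And>a b x. x \<in> carrier V \<Longrightarrow> (a * b) \<odot>\<^bsub>V\<^esub> x = a \<odot>\<^bsub>V\<^esub> (b \<odot>\<^bsub>V\<^esub> x)"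
    and smult_one: "\<And>x. x \<in> carrier V \<Longrightarrow> 1 \<odot>\<^bsub>V\<^esub> x = x"
    and smult_zero: "\<And>x. x \<in> carrier V \<Longrightarrow> 0 \<odot>\<^bsub>V\<^esub> x = \<zero>"
    and ip_add_left:
      "\<And>x y z. \<lbrakk>x \<in> carrier V; y \<in> carrier V; z \<in> carrier V\<rbrakk> \<Longrightarrow> ip V (x \<oplus> y) z = ip V x z + ip V y z"
    and ip_smult_left:
      "\<And>c x y. \<lbrakk>x \<in> carrier V; y \<in> carrier V\<rbrakk> \<Longrightarrow> ip V (c \<odot>\<^bsub>V\<^esub> x) y = c * ip V x y"
    and ip_commute: "\<And>x y. \<lbrakk>x \<in> carrier V; y \<in> carrier V\<rbrakk> \<Longrightarrow> ip V y x = cnj (ip V x y)"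
    and ip_nonneg: "\<And>x. x \<in> carrier V \<Longrightarrow> ip V x x \<in> \<real>\<^sub>\<ge>\<^sub>0"
  shows "semi_ip_space V"
proof -
  have "\<exists>y\<in>carrier V. y \<oplus> x = \<zero>" if "x \<in> carrier V" for x
  proof
    show "(- 1) \<odot>\<^bsub>V\<^esub> x \<oplus> x = \<zero>"
      using smult_l_distr[OF that, of "-1" 1] that by (simp add: smult_one smult_zero)
  qed (simp add: that smult_closed)
  then have "abelian_group V"
    using assms(1-6) by (intro abelian_groupI) auto
  then have "module complex_ring V"
    using assms(3,7-11) by (intro moduleI cring_complex_ring) auto
  then show ?thesis
    using ip_add_left ip_smult_left ip_nonneg ip_commute
    unfolding semi_ip_space_def semi_ip_space_axioms_def by blast
qed

context semi_ip_space
begin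

lemma ip_add_right:
  "\<lbrakk>x \<in> carrier V; y \<in> carrier V; z \<in> carrier V\<rbrakk> \<Longrightarrow> ip V z (x \<oplus> y) = ip V z x + ip V z y"
  using ip_commute[of "x \<oplus> y" z] ip_commute[of x z] ip_commute[of y z] by (simp add: ip_add_left)

lemma ip_smult_right:
  "\<lbrakk>x \<in> carrier V; y \<in> carrier V\<rbrakk> \<Longrightarrow> ip V x (c \<odot>\<^bsub>V\<^esub> y) = cnj c * ip V x y"
  using ip_commute[of "c \<odot>\<^bsub>V\<^esub> y" x] ip_commute[of y x] by (simp add: ip_smult_left)

lemma ip_zero_left [simp]: "x \<in> carrier V \<Longrightarrow> ip V \<zero> x = 0"
  using ip_add_left[of \<zero> \<zero> x] by simp

lemma ip_zero_right [simp]: "x \<in> carrier V \<Longrightarrow> ip V x \<zero> = 0"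
  using ip_add_right[of \<zero> \<zero> x] by simp

lemma ip_minus_left:
  assumes "x \<in> carrier V" "y \<in> carrier V" "z \<in> carrier V"
  shows "ip V (x \<ominus> y) z = ip V x z - ip V y z"
proof -
  have "ip V (x \<ominus> y \<oplus> y) z = ip V (x \<ominus> y) z + ip V y z"
    using assms by (intro ip_add_left) auto
  moreover have "x \<ominus> y \<oplus> y = x"
    using assms by (simp add: a_minus_def a_assoc l_neg)
  ultimately show ?thesis by simp
qed

lemma ip_minus_right:
  "\<lbrakk>x \<in> carrier V; y \<in> carrier V; z \<in> carrier V\<rbrakk> \<Longrightarrow> ip V z (x \<ominus> y) = ip V z x - ip V z y"
  using ip_commute[of "x \<ominus> y" z] ip_commute[of x z] ip_commute[of y z] by (simp add: ip_minus_left)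

lemma ip_norm_nonneg: "x \<in> carrier V \<Longrightarrow> 0 \<le> ip_norm V x"
  using ip_nonneg[of x] by (auto simp: ip_norm_def complex_nonneg_Reals_iff)

lemma ip_self: "x \<in> carrier V \<Longrightarrow> ip V x x = of_real ((ip_norm V x)\<^sup>2)"
  using ip_nonneg[of x] by (auto simp: ip_norm_def complex_nonneg_Reals_iff complex_eq_iff)

lemma Re_ip_self: "x \<in> carrier V \<Longrightarrow> Re (ip V x x) = (ip_norm V x)\<^sup>2"
  by (simp add: ip_self)

lemma ip_norm_smult: "x \<in> carrier V \<Longrightarrow> ip_norm V (c \<odot>\<^bsub>V\<^esub> x) = cmod c * ip_norm V x"
proof -
  assume x: "x \<in> carrier V"
  have "ip V (c \<odot>\<^bsub>V\<^esub> x) (c \<odot>\<^bsub>V\<^esub> x) = (c * cnj c) * of_real ((ip_norm V x)\<^sup>2)"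
    using ip_self[OF x] x by (simp add: ip_smult_left ip_smult_right)
  also have "\<dots> = of_real ((cmod c * ip_norm V x)\<^sup>2)"
    by (simp add: power_mult_distrib flip: complex_norm_square)
  finally show ?thesis
    using ip_norm_nonneg[OF x] by (simp add: ip_norm_def[of V "c \<odot>\<^bsub>V\<^esub> x"])
qed

lemma ip_norm_zero [simp]: "ip_norm V \<zero> = 0"
  by (simp add: ip_norm_def)

lemma Cauchy_Schwarz:
  assumes x: "x \<in> carrier V" and y: "y \<in> carrier V"
  shows "cmod (ip V x y) \<le> ip_norm V x * ip_norm V y"
proof -
  define a b c where "a = (ip_norm V x)\<^sup>2" and "b = (ip_norm V y)\<^sup>2" and "c = ip V x y"
  have ab: "ip V x x = of_real a" "ip V y y = of_real b"
    using x y by (simp_all add: ip_self a_def b_def)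
  \<comment> \<open>The form is evaluated at \<open>x\<close> minus \<open>t * c\<close> times
    \<open>y\<close>. The factor \<open>c\<close> in the multiplier makes the cross terms real,
    leaving a real quadratic polynomial in \<open>t\<close>.\<close>
  have q: "0 \<le> a - 2 * t * (cmod c)\<^sup>2 + t\<^sup>2 * (cmod c)\<^sup>2 * b" for t :: real
  proof -
    let ?z = "x \<ominus> (of_real t * c) \<odot>\<^bsub>V\<^esub> y"
    have "ip V ?z ?z = of_real a - of_real t * cnj c * c - of_real t * c * cnj c
        + of_real (t\<^sup>2) * (c * cnj c) * of_real b"
      using x y ab by (simp add: ip_minus_left ip_minus_right ip_smult_left ip_smult_right
          ip_commute[of x y] c_def algebra_simps power2_eq_square)
    also have "\<dots> = of_real (a - 2 * t * (cmod c)\<^sup>2 + t\<^sup>2 * (cmod c)\<^sup>2 * b)"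
      by (simp add: algebra_simps flip: complex_norm_square)
    finally have "ip V ?z ?z = of_real (a - 2 * t * (cmod c)\<^sup>2 + t\<^sup>2 * (cmod c)\<^sup>2 * b)" .
    moreover have "ip V ?z ?z \<in> \<real>\<^sub>\<ge>\<^sub>0" using x y by (intro ip_nonneg) auto
    ultimately show ?thesis by (simp only: nonneg_Reals_of_real_iff)
  qed
  have ab: "0 \<le> a" "0 \<le> b" by (auto simp: a_def b_def)
  have "(cmod c)\<^sup>2 \<le> a * b"
  proof (cases "b = 0")
    case True
    have "(cmod c)\<^sup>2 = 0"
    proof (rule ccontr)
      assume "(cmod c)\<^sup>2 \<noteq> 0"
      then have "(cmod c)\<^sup>2 > 0" by simp
      \<comment> \<open>For \<open>b = 0\<close> the polynomial is affine in \<open>t\<close>; the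
        chosen \<open>t\<close> gives it the negative value \<open>- a - 2\<close>.\<close>
      then have "0 \<le> a - 2 * (a + 1)"
        using q[of "(a + 1) / (cmod c)\<^sup>2"] True by simp
      then show False using \<open>0 \<le> a\<close> by simp
    qed
    then show ?thesis using ab by simp
  next
    case False
    then have "b > 0" using ab by simp
    \<comment> \<open>The quadratic polynomial is minimal at \<open>t = 1 / b\<close>.\<close>
    then show ?thesis using q[of "1 / b"] by (simp add: field_simps power2_eq_square)
  qed
  then have "(cmod c)\<^sup>2 \<le> (ip_norm V x * ip_norm V y)\<^sup>2"
    by (simp add: a_def b_def power_mult_distrib)
  then show ?thesis
    unfolding c_def using ip_norm_nonneg x y by (meson mult_nonneg_nonneg power2_le_imp_le)
qed

lemma ip_norm_add:
  assumes x: "x \<in> carrier V" and y: "y \<in> carrier V"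
  shows "ip_norm V (x \<oplus> y) \<le> ip_norm V x + ip_norm V y"
proof -
  have "(ip_norm V (x \<oplus> y))\<^sup>2 = (ip_norm V x)\<^sup>2 + 2 * Re (ip V x y) + (ip_norm V y)\<^sup>2"
    using x y by (simp add: Re_ip_self[symmetric] ip_add_left ip_add_right ip_commute[of x y])
  also have "\<dots> \<le> (ip_norm V x)\<^sup>2 + 2 * (ip_norm V x * ip_norm V y) + (ip_norm V y)\<^sup>2"
    using Cauchy_Schwarz[OF x y] complex_Re_le_cmod[of "ip V x y"] by linarith
  also have "\<dots> = (ip_norm V x + ip_norm V y)\<^sup>2"
    by (simp add: power2_sum)
  finally show ?thesis
    using ip_norm_nonneg x y by (meson add_nonneg_nonneg power2_le_imp_le)
qed

lemma ip_norm_minus: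
  assumes "x \<in> carrier V" "y \<in> carrier V"
  shows "ip_norm V (x \<ominus> y) = sqrt (Re (ip V x x - ip V x y - ip V y x + ip V y y))"
  using assms by (simp add: ip_norm_def ip_minus_left ip_minus_right)

lemma ip_norm_minus_commute:
  assumes "x \<in> carrier V" "y \<in> carrier V"
  shows "ip_norm V (x \<ominus> y) = ip_norm V (y \<ominus> x)"
  using assms by (simp add: ip_norm_minus algebra_simps)

lemma ip_norm_triangle:
  assumes "x \<in> carrier V" "y \<in> carrier V"
  shows "\<bar>ip_norm V x - ip_norm V y\<bar> \<le> ip_norm V (x \<ominus> y)"
proof -
  have *: "ip_norm V a \<le> ip_norm V b + ip_norm V (a \<ominus> b)" if "a \<in> carrier V" "b \<in> carrier V" for a b
  proof -
    have "a = b \<oplus> (a \<ominus> b)" using that by (simp add: a_minus_def a_lcomm r_neg)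
    then show ?thesis using ip_norm_add[of b "a \<ominus> b"] that by simp
  qed
  show ?thesis
    using *[of x y] *[of y x] assms ip_norm_minus_commute[of x y] by linarith
qed

lemma add_minus_add:
  assumes "x \<in> carrier V" "y \<in> carrier V" "z \<in> carrier V" "w \<in> carrier V"
  shows "(x \<oplus> y) \<ominus> (z \<oplus> w) = (x \<ominus> z) \<oplus> (y \<ominus> w)"
  using assms by (simp add: a_minus_def minus_add a_ac)

lemma smult_minus_smult:
  assumes "x \<in> carrier V" "y \<in> carrier V"
  shows "(c \<odot>\<^bsub>V\<^esub> x) \<ominus> (c \<odot>\<^bsub>V\<^esub> y) = c \<odot>\<^bsub>V\<^esub> (x \<ominus> y)"
  using assms by (simp add: a_minus_def smult_r_distr smult_r_minus)

text \<open>Telescoping into \<langle>x - x', y\<rangle> + \<langle>x', y - y'\<rangle>, then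
  Cauchy-Schwarz. This is the estimate behind the convergence of inner products along Cauchy
  sequences.\<close>

lemma ip_dist_le:
  assumes "x \<in> carrier V" "y \<in> carrier V" "x' \<in> carrier V" "y' \<in> carrier V"
  shows "cmod (ip V x y - ip V x' y') \<le> ip_norm V (x \<ominus> x') * ip_norm V y + ip_norm V x' * ip_norm V (y \<ominus> y')"
proof -
  have "ip V x y - ip V x' y' = ip V (x \<ominus> x') y + ip V x' (y \<ominus> y')"
    using assms by (simp add: ip_minus_left ip_minus_right)
  then show ?thesis
    using Cauchy_Schwarz[of "x \<ominus> x'" y] Cauchy_Schwarz[of x' "y \<ominus> y'"] assms
    by (smt (verit, ccfv_SIG) norm_triangle_ineq minus_closed)
qed

text \<open>By Cauchy-Schwarz a null vector is orthogonal to everything, so null classes can be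
  handled through inner products alone.\<close>

lemma ip_norm_eq_0_iff:
  assumes "x \<in> carrier V"
  shows "ip_norm V x = 0 \<longleftrightarrow> (\<forall>z\<in>carrier V. ip V x z = 0)"
proof
  assume "ip_norm V x = 0"
  then show "\<forall>z\<in>carrier V. ip V x z = 0" using Cauchy_Schwarz[OF assms] by auto
qed (use assms in \<open>auto simp: ip_norm_def\<close>)

lemma ip_norm_minus_eq_0_iff:
  assumes "x \<in> carrier V" "y \<in> carrier V"
  shows "ip_norm V (x \<ominus> y) = 0 \<longleftrightarrow> (\<forall>z\<in>carrier V. ip V x z = ip V y z)"
  using assms by (simp add: ip_norm_eq_0_iff ip_minus_left)

end

lemma (in definite_ip_space) eq_iff_ip:
  assumes "x \<in> carrier V" "y \<in> carrier V"
  shows "x = y \<longleftrightarrow> (\<forall>z\<in>carrier V. ip V x z = ip V y z)"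
proof
  assume *: "\<forall>z\<in>carrier V. ip V x z = ip V y z"
  then have "ip V (x \<ominus> y) (x \<ominus> y) = 0" using assms by (simp add: ip_minus_left)
  then have "x \<ominus> y = \<zero>" using assms by (intro ip_definite) auto
  moreover have "x = (x \<ominus> y) \<oplus> y" using assms by (simp add: a_minus_def a_assoc l_neg)
  ultimately show "x = y" using assms by simp
qed auto

section \<open>Separation\<close>

context semi_ip_space
begin

lemma in_null_class_iff:
  assumes "x \<in> carrier V"
  shows "y \<in> null_class V x \<longleftrightarrow> y \<in> carrier V \<and> (\<forall>z\<in>carrier V. ip V x z = ip V y z)"
  using assms by (auto simp: null_class_def ip_norm_minus_eq_0_iff)

lemma null_class_eq_iff:
  assumes "x \<in> carrier V" "y \<in> carrier V"
  shows "null_class V x = null_class V y \<longleftrightarrow> (\<forall>z\<in>carrier V. ip V x z = ip V y z)"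
proof
  assume "null_class V x = null_class V y"
  then have "y \<in> null_class V x" using assms by (simp add: in_null_class_iff)
  then show "\<forall>z\<in>carrier V. ip V x z = ip V y z" using assms by (simp add: in_null_class_iff)
next
  assume "\<forall>z\<in>carrier V. ip V x z = ip V y z"
  then show "null_class V x = null_class V y" using assms by (auto simp: in_null_class_iff)
qed

text \<open>The chosen representative has the same inner products as \<open>x\<close>, so the
  operations of \<open>separation\<close>, defined through \<open>class_rep\<close>, do not depend
  on the choice.\<close>

lemma class_rep_null_class:
  assumes "x \<in> carrier V"
  shows class_rep_closed: "class_rep (null_class V x) \<in> carrier V"
    and ip_class_rep_left: "z \<in> carrier V \<Longrightarrow> ip V (class_rep (null_class V x)) z = ip V x z"
    and ip_class_rep_right: "z \<in> carrier V \<Longrightarrow> ip V z (class_rep (null_class V x)) = ip V z x"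
proof -
  have "x \<in> null_class V x" using assms by (simp add: in_null_class_iff)
  then have *: "class_rep (null_class V x) \<in> null_class V x"
    unfolding class_rep_def by (rule someI)
  then show c: "class_rep (null_class V x) \<in> carrier V" using assms by (simp add: in_null_class_iff)
  show l: "ip V (class_rep (null_class V x)) z = ip V x z" if "z \<in> carrier V" for z
    using * assms that by (simp add: in_null_class_iff)
  show "ip V z (class_rep (null_class V x)) = ip V z x" if "z \<in> carrier V"
    using l[OF that] ip_commute[OF c that] ip_commute[OF assms that] by simp
qed

lemma null_class_class_rep:
  "A \<in> carrier (separation V) \<Longrightarrow> null_class V (class_rep A) = A"
proof -
  assume "A \<in> carrier (separation V)"
  then obtain x where x: "x \<in> carrier V" "A = null_class V x"
    by (auto simp: separation_def)
  show ?thesis unfolding x(2) using x(1) by (subst null_class_eq_iff) (simp_all add: class_rep_null_class)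
qed

lemma carrier_separation: "carrier (separation V) = null_class V ` carrier V"
  by (simp add: separation_def)

lemma add_separation:
  "\<lbrakk>x \<in> carrier V; y \<in> carrier V\<rbrakk> \<Longrightarrow>
    null_class V x \<oplus>\<^bsub>separation V\<^esub> null_class V y = null_class V (x \<oplus> y)"
  by (simp add: separation_def null_class_eq_iff class_rep_null_class ip_add_left)

lemma smult_separation:
  "x \<in> carrier V \<Longrightarrow> c \<odot>\<^bsub>separation V\<^esub> null_class V x = null_class V (c \<odot>\<^bsub>V\<^esub> x)"
  by (simp add: separation_def null_class_eq_iff class_rep_null_class ip_smult_left)

lemma ip_separation:
  "\<lbrakk>x \<in> carrier V; y \<in> carrier V\<rbrakk> \<Longrightarrow> ip (separation V) (null_class V x) (null_class V y) = ip V x y"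
  by (simp add: separation_def class_rep_null_class)

lemma zero_separation: "\<zero>\<^bsub>separation V\<^esub> = null_class V \<zero>"
  by (simp add: separation_def)

lemma definite_separation: "definite_ip_space (separation V)"
proof -
  interpret S: semi_ip_space "separation V"
    by (rule semi_ip_spaceI)
      (auto simp: carrier_separation add_separation smult_separation ip_separation zero_separation
        a_ac smult_l_distr[of _ _ _, simplified] smult_r_distr smult_assoc1[of _ _ _, simplified] smult_one[simplified]
        smult_l_null[simplified] ip_add_left ip_smult_left ip_nonneg intro: ip_commute)
  show ?thesis
  proof
    fix A assume "A \<in> carrier (separation V)" and A: "ip (separation V) A A = 0"
    then obtain x where x: "x \<in> carrier V" "A = null_class V x"
      by (auto simp: carrier_separation)
    then have "ip V x x = 0" using A by (simp add: ip_separation)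
    then have "ip_norm V x = 0" by (simp add: ip_norm_def)
    then show "A = \<zero>\<^bsub>separation V\<^esub>"
      using x by (simp add: zero_separation null_class_eq_iff ip_norm_eq_0_iff)
  qed
qed

end

section \<open>Cauchy sequences\<close>

context semi_ip_space
begin

lemma cauchy_spaceI:
  assumes "\<And>n. X n \<in> carrier V"
    and "\<And>e. e > 0 \<Longrightarrow> \<exists>N. \<forall>m\<ge>N. \<forall>n\<ge>N. ip_norm V (X m \<ominus> X n) < e"
  shows "X \<in> carrier (cauchy_space V)"
  using assms by (auto simp: cauchy_space_def)

lemma cauchy_space_closed: "X \<in> carrier (cauchy_space V) \<Longrightarrow> X n \<in> carrier V"
  by (auto simp: cauchy_space_def)

lemma cauchy_spaceD:
  "\<lbrakk>X \<in> carrier (cauchy_space V); e > 0\<rbrakk> \<Longrightarrow> \<exists>N. \<forall>m\<ge>N. \<forall>n\<ge>N. ip_norm V (X m \<ominus> X n) < e"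
  by (auto simp: cauchy_space_def)

lemma cauchy_space_norm_bounded:
  assumes X: "X \<in> carrier (cauchy_space V)"
  shows "\<exists>B>0. \<forall>n. ip_norm V (X n) \<le> B"
proof -
  have "Cauchy (\<lambda>n. ip_norm V (X n))"
    unfolding Cauchy_altdef2 dist_real_def
  proof (intro allI impI)
    fix e :: real assume "e > 0"
    then obtain N where N: "\<forall>m\<ge>N. \<forall>n\<ge>N. ip_norm V (X m \<ominus> X n) < e"
      using cauchy_spaceD[OF X] by blast
    have "\<bar>ip_norm V (X n) - ip_norm V (X N)\<bar> < e" if "n \<ge> N" for n
      using ip_norm_triangle[of "X n" "X N"] N that cauchy_space_closed[OF X] by fastforce
    then show "\<exists>N. \<forall>n\<ge>N. \<bar>ip_norm V (X n) - ip_norm V (X N)\<bar> < e" by blast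
  qed
  then have "Bseq (\<lambda>n. ip_norm V (X n))" by (rule Cauchy_Bseq)
  then show ?thesis
    unfolding Bseq_def by (auto intro: order_trans[OF abs_ge_self])
qed

text \<open>This is the bound of \<open>ip_dist_le\<close> between two members of the sequences. It
  is stated with norms because norms do not change when an isometry is applied to \<open>X\<close>:
  one \<open>N\<close> then serves all group elements in
  \<open>isometric_action_cauchy_space\<close>.\<close>

lemma cauchy_space_dist_less:
  assumes X: "X \<in> carrier (cauchy_space V)" and Y: "Y \<in> carrier (cauchy_space V)" and e: "e > 0"
  shows "\<exists>N. \<forall>m\<ge>N. \<forall>n\<ge>N. ip_norm V (X m \<ominus> X n) * ip_norm V (Y m) +
      ip_norm V (X n) * ip_norm V (Y m \<ominus> Y n) < e"
proof -
  obtain B where B: "B > 0" "\<And>n. ip_norm V (X n) \<le> B" using cauchy_space_norm_bounded[OF X] by blast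
  obtain C where C: "C > 0" "\<And>n. ip_norm V (Y n) \<le> C" using cauchy_space_norm_bounded[OF Y] by blast
  obtain N where N: "\<forall>m\<ge>N. \<forall>n\<ge>N. ip_norm V (X m \<ominus> X n) < e / 2 / C"
    using cauchy_spaceD[OF X, of "e / 2 / C"] e C(1) by auto
  obtain M where M: "\<forall>m\<ge>M. \<forall>n\<ge>M. ip_norm V (Y m \<ominus> Y n) < e / 2 / B"
    using cauchy_spaceD[OF Y, of "e / 2 / B"] e B(1) by auto
  have "ip_norm V (X m \<ominus> X n) * ip_norm V (Y m) + ip_norm V (X n) * ip_norm V (Y m \<ominus> Y n) < e"
    if "m \<ge> max M N" "n \<ge> max M N" for m n
  proof -
    note c = cauchy_space_closed[OF X] cauchy_space_closed[OF Y]
    have "ip_norm V (X m \<ominus> X n) * ip_norm V (Y m) \<le> ip_norm V (X m \<ominus> X n) * C"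
      using C c by (intro mult_left_mono ip_norm_nonneg) auto
    also have "\<dots> < e / 2 / C * C" using N that C by (intro mult_strict_right_mono) auto
    also have "\<dots> = e / 2" using C by simp
    finally have 1: "ip_norm V (X m \<ominus> X n) * ip_norm V (Y m) < e / 2" .
    have "ip_norm V (X n) * ip_norm V (Y m \<ominus> Y n) \<le> B * ip_norm V (Y m \<ominus> Y n)"
      using B c by (intro mult_right_mono ip_norm_nonneg) auto
    also have "\<dots> < B * (e / 2 / B)" using M that B by (intro mult_strict_left_mono) auto
    also have "\<dots> = e / 2" using B by simp
    finally show ?thesis using 1 by simp
  qed
  then show ?thesis by blast
qed

text \<open>The \<open>lim\<close> in the form of \<open>cauchy_space\<close> is a genuine limit, so
  the laws of the form pass to the limit by uniqueness.\<close>

lemma cauchy_space_LIMSEQ: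
  assumes X: "X \<in> carrier (cauchy_space V)" and Y: "Y \<in> carrier (cauchy_space V)"
  shows "(\<lambda>n. ip V (X n) (Y n)) \<longlonglongrightarrow> ip (cauchy_space V) X Y"
proof -
  have "Cauchy (\<lambda>n. ip V (X n) (Y n))"
    unfolding Cauchy_def dist_norm
  proof (intro allI impI)
    fix e :: real assume "e > 0"
    then obtain N where N: "\<forall>m\<ge>N. \<forall>n\<ge>N. ip_norm V (X m \<ominus> X n) * ip_norm V (Y m) +
      ip_norm V (X n) * ip_norm V (Y m \<ominus> Y n) < e"
      using cauchy_space_dist_less[OF X Y] by blast
    then show "\<exists>M. \<forall>m\<ge>M. \<forall>n\<ge>M. cmod (ip V (X m) (Y m) - ip V (X n) (Y n)) < e"
      using ip_dist_le cauchy_space_closed X Y by (meson order_le_less_trans)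
  qed
  then have "convergent (\<lambda>n. ip V (X n) (Y n))" by (simp add: Cauchy_convergent_iff)
  then show ?thesis by (simp add: cauchy_space_def convergent_LIMSEQ_iff)
qed

lemma semi_ip_cauchy_space: "semi_ip_space (cauchy_space V)"
proof -
  let ?C = "cauchy_space V"
  note c = cauchy_space_closed
  have add: "(X \<oplus>\<^bsub>?C\<^esub> Y) = (\<lambda>n. X n \<oplus> Y n)" for X Y by (simp add: cauchy_space_def)
  have smult: "(a \<odot>\<^bsub>?C\<^esub> X) = (\<lambda>n. a \<odot>\<^bsub>V\<^esub> X n)" for a X by (simp add: cauchy_space_def)
  have zero: "\<zero>\<^bsub>?C\<^esub> = (\<lambda>n. \<zero>)" by (simp add: cauchy_space_def)
  have add_closed: "(\<lambda>n. X n \<oplus> Y n) \<in> carrier ?C" if X: "X \<in> carrier ?C" and Y: "Y \<in> carrier ?C" for X Y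
  proof (rule cauchy_spaceI)
    fix e :: real assume "e > 0"
    then obtain N M where N: "\<forall>m\<ge>N. \<forall>n\<ge>N. ip_norm V (X m \<ominus> X n) < e/2"
       and M: "\<forall>m\<ge>M. \<forall>n\<ge>M. ip_norm V (Y m \<ominus> Y n) < e/2"
      using cauchy_spaceD[OF X, of "e/2"] cauchy_spaceD[OF Y, of "e/2"] by auto
    have "ip_norm V (X m \<oplus> Y m \<ominus> (X n \<oplus> Y n)) < e" if "m \<ge> max M N" "n \<ge> max M N" for m n
    proof -
      have "ip_norm V (X m \<oplus> Y m \<ominus> (X n \<oplus> Y n)) \<le> ip_norm V (X m \<ominus> X n) + ip_norm V (Y m \<ominus> Y n)"
        using c[OF X] c[OF Y] by (simp add: add_minus_add ip_norm_add)
      moreover have "ip_norm V (X m \<ominus> X n) < e/2" "ip_norm V (Y m \<ominus> Y n) < e/2"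
        using N M that by auto
      ultimately show ?thesis by linarith
    qed
    then show "\<exists>N. \<forall>m\<ge>N. \<forall>n\<ge>N. ip_norm V (X m \<oplus> Y m \<ominus> (X n \<oplus> Y n)) < e" by blast
  qed (use c[OF X] c[OF Y] in auto)
  have smult_closed: "(\<lambda>n. a \<odot>\<^bsub>V\<^esub> X n) \<in> carrier ?C" if X: "X \<in> carrier ?C" for a X
  proof (rule cauchy_spaceI)
    fix e :: real assume "e > 0"
    \<comment> \<open>The summand 1 covers the case \<open>a = 0\<close>.\<close>
    then obtain N where N: "\<forall>m\<ge>N. \<forall>n\<ge>N. ip_norm V (X m \<ominus> X n) < e / (cmod a + 1)"
      using cauchy_spaceD[OF X, of "e / (cmod a + 1)"] by (auto simp: add_nonneg_pos)
    have "ip_norm V (a \<odot>\<^bsub>V\<^esub> X m \<ominus> a \<odot>\<^bsub>V\<^esub> X n) < e" if "m \<ge> N" "n \<ge> N" for m n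
    proof -
      have "ip_norm V (a \<odot>\<^bsub>V\<^esub> X m \<ominus> a \<odot>\<^bsub>V\<^esub> X n) = cmod a * ip_norm V (X m \<ominus> X n)"
        using c[OF X] by (simp add: smult_minus_smult ip_norm_smult)
      also have "\<dots> \<le> (cmod a + 1) * ip_norm V (X m \<ominus> X n)"
        using c[OF X] by (intro mult_right_mono ip_norm_nonneg) auto
      also have "\<dots> < (cmod a + 1) * (e / (cmod a + 1))"
        using N that by (intro mult_strict_left_mono) (auto simp: add_nonneg_pos)
      also have "\<dots> = e" by (simp add: add_nonneg_eq_0_iff)
      finally show ?thesis .
    qed
    then show "\<exists>N. \<forall>m\<ge>N. \<forall>n\<ge>N. ip_norm V (a \<odot>\<^bsub>V\<^esub> X m \<ominus> a \<odot>\<^bsub>V\<^esub> X n) < e" by blast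
  qed (use c[OF X] in auto)
  note lim = cauchy_space_LIMSEQ and closed = add_closed smult_closed
  show ?thesis
  proof (rule semi_ip_spaceI)
    show "\<zero>\<^bsub>?C\<^esub> \<in> carrier ?C" unfolding zero by (rule cauchy_spaceI) (auto simp: ip_norm_minus)
    fix X Y Z a assume X: "X \<in> carrier ?C" and Y: "Y \<in> carrier ?C"
    show "X \<oplus>\<^bsub>?C\<^esub> Y = Y \<oplus>\<^bsub>?C\<^esub> X"
      using c[OF X] c[OF Y] by (simp add: add a_comm)
    show "ip ?C Y X = cnj (ip ?C X Y)"
    proof (rule LIMSEQ_unique[OF lim[OF Y X]])
      have "(\<lambda>n. ip V (Y n) (X n)) = (\<lambda>n. cnj (ip V (X n) (Y n)))"
        using ip_commute c[OF X] c[OF Y] by blast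
      then show "(\<lambda>n. ip V (Y n) (X n)) \<longlonglongrightarrow> cnj (ip ?C X Y)"
        using lim[OF X Y] by (simp add: tendsto_cnj)
    qed
    show "ip ?C (a \<odot>\<^bsub>?C\<^esub> X) Y = a * ip ?C X Y"
      unfolding smult using tendsto_mult_left[OF lim[OF X Y], of a] c[OF X] c[OF Y]
      by (intro LIMSEQ_unique[OF lim[OF smult_closed[OF X] Y]]) (simp add: ip_smult_left)
    show "ip ?C X X \<in> \<real>\<^sub>\<ge>\<^sub>0"
      by (rule Lim_in_closed_set[OF closed_nonneg_Reals_complex _ _ lim[OF X X]]) (use c[OF X] ip_nonneg in auto)
    show "X \<oplus>\<^bsub>?C\<^esub> Y \<oplus>\<^bsub>?C\<^esub> Z = X \<oplus>\<^bsub>?C\<^esub> (Y \<oplus>\<^bsub>?C\<^esub> Z)" if "Z \<in> carrier ?C"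
      using c[OF X] c[OF Y] c[OF that] by (simp add: add a_assoc)
    show "ip ?C (X \<oplus>\<^bsub>?C\<^esub> Y) Z = ip ?C X Z + ip ?C Y Z" if Z: "Z \<in> carrier ?C"
      unfolding add using tendsto_add[OF lim[OF X Z] lim[OF Y Z]] c[OF X] c[OF Y] c[OF Z]
      by (intro LIMSEQ_unique[OF lim[OF add_closed[OF X Y] Z]]) (simp add: ip_add_left)
  qed (use c in \<open>auto simp: add smult zero smult_l_distr[simplified] smult_r_distr smult_assoc1[simplified]
      smult_one[simplified] smult_l_null[simplified] closed\<close>)
qed

end

section \<open>Direct sums\<close>

lemma summable_on_product_le:
  fixes a b :: "'i \<Rightarrow> real" and f :: "'i \<Rightarrow> complex"
  assumes "(\<lambda>i. (a i)\<^sup>2) summable_on I" "(\<lambda>i. (b i)\<^sup>2) summable_on I"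
    and "\<And>i. i \<in> I \<Longrightarrow> cmod (f i) \<le> a i * b i"
  shows "(\<lambda>i. norm (f i)) summable_on I"
proof (rule Infinite_Sum.abs_summable_on_comparison_test)
  have "(\<lambda>i. (a i)\<^sup>2 + (b i)\<^sup>2) summable_on I"
    using assms(1,2) by (rule summable_on_add)
  then show "(\<lambda>i. norm ((a i)\<^sup>2 + (b i)\<^sup>2)) summable_on I"
    by (simp add: abs_of_nonneg cong: summable_on_cong)
  fix i assume "i \<in> I"
  have "a i * b i \<le> (a i)\<^sup>2 + (b i)\<^sup>2"
    using sum_squares_bound[of "a i" "b i"] zero_le_power2[of "a i"] zero_le_power2[of "b i"] by linarith
  then show "norm (f i) \<le> norm ((a i)\<^sup>2 + (b i)\<^sup>2)"
    using assms(3)[OF \<open>i \<in> I\<close>] by simp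
qed

locale ip_space_family =
  fixes I :: "'i set" and V :: "'i \<Rightarrow> ('v, 'm) ip_space_scheme"
  assumes fam: "i \<in> I \<Longrightarrow> definite_ip_space (V i)"
begin

abbreviation "D \<equiv> direct_sum I V"

lemma carrier_direct_sum_iff:
  "\<xi> \<in> carrier D \<longleftrightarrow> \<xi> \<in> extensional I \<and> (\<forall>i\<in>I. \<xi> i \<in> carrier (V i)) \<and>
     (\<lambda>i. (ip_norm (V i) (\<xi> i))\<^sup>2) summable_on I"
  by (auto simp: direct_sum_def PiE_def)

lemma fam_semi: "i \<in> I \<Longrightarrow> semi_ip_space (V i)"
  using fam definite_ip_space_def by blast

lemma direct_sum_abs_summable:
  assumes "\<xi> \<in> carrier D" "\<eta> \<in> carrier D"
  shows "(\<lambda>i. norm (ip (V i) (\<xi> i) (\<eta> i))) summable_on I"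
  using assms
  by (intro summable_on_product_le[of "\<lambda>i. ip_norm (V i) (\<xi> i)" _ "\<lambda>i. ip_norm (V i) (\<eta> i)"])
    (auto simp: carrier_direct_sum_iff intro: semi_ip_space.Cauchy_Schwarz fam_semi)

lemma direct_sum_summable:
  assumes "\<xi> \<in> carrier D" "\<eta> \<in> carrier D"
  shows "(\<lambda>i. ip (V i) (\<xi> i) (\<eta> i)) summable_on I"
  using direct_sum_abs_summable[OF assms] by (rule abs_summable_summable)

lemma ip_direct_sum: "ip D \<xi> \<eta> = (\<Sum>\<^sub>\<infinity>i\<in>I. ip (V i) (\<xi> i) (\<eta> i))"
  by (simp add: direct_sum_def)

lemma semi_ip_direct_sum: "semi_ip_space D"
proof -
  have add: "(\<xi> \<oplus>\<^bsub>D\<^esub> \<eta>) = (\<lambda>i\<in>I. \<xi> i \<oplus>\<^bsub>V i\<^esub> \<eta> i)" for \<xi> \<eta> by (simp add: direct_sum_def)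
  have smult: "(c \<odot>\<^bsub>D\<^esub> \<xi>) = (\<lambda>i\<in>I. c \<odot>\<^bsub>V i\<^esub> \<xi> i)" for c \<xi> by (simp add: direct_sum_def)
  have zero: "\<zero>\<^bsub>D\<^esub> = (\<lambda>i\<in>I. \<zero>\<^bsub>V i\<^esub>)" by (simp add: direct_sum_def)
  note c = carrier_direct_sum_iff
  have add_closed: "\<xi> \<oplus>\<^bsub>D\<^esub> \<eta> \<in> carrier D" if \<xi>: "\<xi> \<in> carrier D" and \<eta>: "\<eta> \<in> carrier D" for \<xi> \<eta>
  proof -
    have "(\<lambda>i. (ip_norm (V i) (\<xi> i \<oplus>\<^bsub>V i\<^esub> \<eta> i))\<^sup>2) summable_on I"
    proof (rule summable_on_comparison_test)
      show "(\<lambda>i. 2 * (ip_norm (V i) (\<xi> i))\<^sup>2 + 2 * (ip_norm (V i) (\<eta> i))\<^sup>2) summable_on I"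
        using that by (intro summable_on_add summable_on_cmult_right) (auto simp: c)
      fix i assume i: "i \<in> I"
      interpret semi_ip_space "V i" by (rule fam_semi[OF i])
      have ci: "\<xi> i \<in> carrier (V i)" "\<eta> i \<in> carrier (V i)" using that i by (auto simp: c)
      have "(ip_norm (V i) (\<xi> i \<oplus>\<^bsub>V i\<^esub> \<eta> i))\<^sup>2 \<le> (ip_norm (V i) (\<xi> i) + ip_norm (V i) (\<eta> i))\<^sup>2"
        using ip_norm_add[OF ci] ip_norm_nonneg ci by (intro power_mono) auto
      also have "\<dots> \<le> 2 * (ip_norm (V i) (\<xi> i))\<^sup>2 + 2 * (ip_norm (V i) (\<eta> i))\<^sup>2"
        using sum_squares_bound[of "ip_norm (V i) (\<xi> i)" "ip_norm (V i) (\<eta> i)"]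
        by (simp add: power2_sum)
      finally show "(ip_norm (V i) (\<xi> i \<oplus>\<^bsub>V i\<^esub> \<eta> i))\<^sup>2 \<le> 2 * (ip_norm (V i) (\<xi> i))\<^sup>2 + 2 * (ip_norm (V i) (\<eta> i))\<^sup>2" .
    qed auto
    moreover have "\<xi> i \<oplus>\<^bsub>V i\<^esub> \<eta> i \<in> carrier (V i)" if i: "i \<in> I" for i
    proof -
      interpret semi_ip_space "V i" by (rule fam_semi[OF i])
      show ?thesis using \<xi> \<eta> i by (auto simp: c)
    qed
    ultimately show ?thesis by (simp add: c add cong: summable_on_cong)
  qed
  have smult_closed: "a \<odot>\<^bsub>D\<^esub> \<xi> \<in> carrier D" if \<xi>: "\<xi> \<in> carrier D" for a \<xi>
  proof -
    have *: "a \<odot>\<^bsub>V i\<^esub> \<xi> i \<in> carrier (V i) \<and>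
      (ip_norm (V i) (a \<odot>\<^bsub>V i\<^esub> \<xi> i))\<^sup>2 = (cmod a)\<^sup>2 * (ip_norm (V i) (\<xi> i))\<^sup>2" if i: "i \<in> I" for i
    proof -
      interpret semi_ip_space "V i" by (rule fam_semi[OF i])
      show ?thesis using \<xi> i by (auto simp: c ip_norm_smult power_mult_distrib)
    qed
    have "(\<lambda>i. (cmod a)\<^sup>2 * (ip_norm (V i) (\<xi> i))\<^sup>2) summable_on I"
      using \<xi> by (intro summable_on_cmult_right) (auto simp: c)
    then show ?thesis using * by (simp add: c smult cong: summable_on_cong)
  qed
  show ?thesis
  proof (rule semi_ip_spaceI)
    have "\<zero>\<^bsub>V i\<^esub> \<in> carrier (V i) \<and> ip_norm (V i) \<zero>\<^bsub>V i\<^esub> = 0" if i: "i \<in> I" for i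
    proof -
      interpret semi_ip_space "V i" by (rule fam_semi[OF i])
      show ?thesis by simp
    qed
    then show "\<zero>\<^bsub>D\<^esub> \<in> carrier D" by (simp add: c zero cong: summable_on_cong)
    fix \<xi> \<eta> \<zeta> a b assume \<xi>: "\<xi> \<in> carrier D" and \<eta>: "\<eta> \<in> carrier D"
    show "\<xi> \<oplus>\<^bsub>D\<^esub> \<eta> = \<eta> \<oplus>\<^bsub>D\<^esub> \<xi>"
      unfolding add
    proof (rule restrict_ext)
      fix i assume i: "i \<in> I"
      interpret semi_ip_space "V i" by (rule fam_semi[OF i])
      show "\<xi> i \<oplus>\<^bsub>V i\<^esub> \<eta> i = \<eta> i \<oplus>\<^bsub>V i\<^esub> \<xi> i" using \<xi> \<eta> i by (auto simp: c a_comm)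
    qed
    show "ip D \<eta> \<xi> = cnj (ip D \<xi> \<eta>)"
      unfolding ip_direct_sum infsum_cnj[symmetric]
      using \<xi> \<eta> by (intro infsum_cong semi_ip_space.ip_commute fam_semi) (auto simp: c)
    show "ip D (a \<odot>\<^bsub>D\<^esub> \<xi>) \<eta> = a * ip D \<xi> \<eta>"
      unfolding ip_direct_sum infsum_cmult_right'[symmetric]
      using \<xi> \<eta> by (intro infsum_cong) (auto simp: c smult semi_ip_space.ip_smult_left[OF fam_semi])
    have nn: "0 \<le> Re (ip (V i) (\<xi> i) (\<xi> i)) \<and> Im (ip (V i) (\<xi> i) (\<xi> i)) = 0" if i: "i \<in> I" for i
      using semi_ip_space.ip_nonneg[OF fam_semi[OF i], of "\<xi> i"] \<xi> i
      by (auto simp: c complex_nonneg_Reals_iff)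
    then show "ip D \<xi> \<xi> \<in> \<real>\<^sub>\<ge>\<^sub>0"
      unfolding ip_direct_sum complex_nonneg_Reals_iff
      using infsum_Re[OF direct_sum_summable[OF \<xi> \<xi>]] infsum_Im[OF direct_sum_summable[OF \<xi> \<xi>]]
      by (auto intro!: infsum_nonneg infsum_0 dest!: sym[of _ "Re _"] sym[of _ "Im _"])
    show "(a + b) \<odot>\<^bsub>D\<^esub> \<xi> = a \<odot>\<^bsub>D\<^esub> \<xi> \<oplus>\<^bsub>D\<^esub> b \<odot>\<^bsub>D\<^esub> \<xi>"
      unfolding add smult
    proof (rule restrict_ext)
      fix i assume i: "i \<in> I"
      interpret semi_ip_space "V i" by (rule fam_semi[OF i])
      show "(a + b) \<odot>\<^bsub>V i\<^esub> \<xi> i = (\<lambda>i\<in>I. a \<odot>\<^bsub>V i\<^esub> \<xi> i) i \<oplus>\<^bsub>V i\<^esub> (\<lambda>i\<in>I. b \<odot>\<^bsub>V i\<^esub> \<xi> i) i"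
        using \<xi> i by (auto simp: c smult_l_distr[simplified])
    qed
    show "a \<odot>\<^bsub>D\<^esub> (\<xi> \<oplus>\<^bsub>D\<^esub> \<eta>) = a \<odot>\<^bsub>D\<^esub> \<xi> \<oplus>\<^bsub>D\<^esub> a \<odot>\<^bsub>D\<^esub> \<eta>"
      unfolding add smult
    proof (rule restrict_ext)
      fix i assume i: "i \<in> I"
      interpret semi_ip_space "V i" by (rule fam_semi[OF i])
      show "a \<odot>\<^bsub>V i\<^esub> (\<lambda>i\<in>I. \<xi> i \<oplus>\<^bsub>V i\<^esub> \<eta> i) i = (\<lambda>i\<in>I. a \<odot>\<^bsub>V i\<^esub> \<xi> i) i \<oplus>\<^bsub>V i\<^esub> (\<lambda>i\<in>I. a \<odot>\<^bsub>V i\<^esub> \<eta> i) i"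
        using \<xi> \<eta> i by (auto simp: c smult_r_distr)
    qed
    show "(a * b) \<odot>\<^bsub>D\<^esub> \<xi> = a \<odot>\<^bsub>D\<^esub> (b \<odot>\<^bsub>D\<^esub> \<xi>)"
      unfolding add smult
    proof (rule restrict_ext)
      fix i assume i: "i \<in> I"
      interpret semi_ip_space "V i" by (rule fam_semi[OF i])
      show "(a * b) \<odot>\<^bsub>V i\<^esub> \<xi> i = a \<odot>\<^bsub>V i\<^esub> (\<lambda>i\<in>I. b \<odot>\<^bsub>V i\<^esub> \<xi> i) i"
        using \<xi> i by (auto simp: c smult_assoc1[simplified])
    qed
    show "1 \<odot>\<^bsub>D\<^esub> \<xi> = \<xi>"
      unfolding smult
    proof (rule extensionalityI[of _ I])
      fix i assume i: "i \<in> I"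
      interpret semi_ip_space "V i" by (rule fam_semi[OF i])
      show "(\<lambda>i\<in>I. 1 \<odot>\<^bsub>V i\<^esub> \<xi> i) i = \<xi> i" using \<xi> i by (auto simp: c smult_one[simplified])
    qed (use \<xi> in \<open>auto simp: c\<close>)
    show "\<zero>\<^bsub>D\<^esub> \<oplus>\<^bsub>D\<^esub> \<xi> = \<xi>"
      unfolding add zero
    proof (rule extensionalityI[of _ I])
      fix i assume i: "i \<in> I"
      interpret semi_ip_space "V i" by (rule fam_semi[OF i])
      show "(\<lambda>i\<in>I. (\<lambda>i\<in>I. \<zero>\<^bsub>V i\<^esub>) i \<oplus>\<^bsub>V i\<^esub> \<xi> i) i = \<xi> i" using \<xi> i by (auto simp: c)
    qed (use \<xi> in \<open>auto simp: c\<close>)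
    show "0 \<odot>\<^bsub>D\<^esub> \<xi> = \<zero>\<^bsub>D\<^esub>"
      unfolding smult zero
    proof (rule restrict_ext)
      fix i assume i: "i \<in> I"
      interpret semi_ip_space "V i" by (rule fam_semi[OF i])
      show "0 \<odot>\<^bsub>V i\<^esub> \<xi> i = \<zero>\<^bsub>V i\<^esub>" using \<xi> i by (auto simp: c smult_l_null[simplified])
    qed
    show "\<xi> \<oplus>\<^bsub>D\<^esub> \<eta> \<oplus>\<^bsub>D\<^esub> \<zeta> = \<xi> \<oplus>\<^bsub>D\<^esub> (\<eta> \<oplus>\<^bsub>D\<^esub> \<zeta>)" if \<zeta>: "\<zeta> \<in> carrier D"
      unfolding add
    proof (rule restrict_ext)
      fix i assume i: "i \<in> I"
      interpret semi_ip_space "V i" by (rule fam_semi[OF i])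
      show "(\<lambda>i\<in>I. \<xi> i \<oplus>\<^bsub>V i\<^esub> \<eta> i) i \<oplus>\<^bsub>V i\<^esub> \<zeta> i = \<xi> i \<oplus>\<^bsub>V i\<^esub> (\<lambda>i\<in>I. \<eta> i \<oplus>\<^bsub>V i\<^esub> \<zeta> i) i"
        using \<xi> \<eta> \<zeta> i by (auto simp: c a_assoc)
    qed
    show "ip D (\<xi> \<oplus>\<^bsub>D\<^esub> \<eta>) \<zeta> = ip D \<xi> \<zeta> + ip D \<eta> \<zeta>" if \<zeta>: "\<zeta> \<in> carrier D"
      unfolding ip_direct_sum infsum_add[symmetric, OF direct_sum_summable[OF \<xi> \<zeta>] direct_sum_summable[OF \<eta> \<zeta>]]
      using \<xi> \<eta> \<zeta> by (intro infsum_cong) (auto simp: c add semi_ip_space.ip_add_left[OF fam_semi])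
  qed (use add_closed smult_closed in auto)
qed

lemma definite_direct_sum: "definite_ip_space D"
proof -
  interpret S: semi_ip_space D by (rule semi_ip_direct_sum)
  show ?thesis
  proof
    fix \<xi> assume \<xi>: "\<xi> \<in> carrier D" and "ip D \<xi> \<xi> = 0"
    then have "0 = Re (\<Sum>\<^sub>\<infinity>i\<in>I. ip (V i) (\<xi> i) (\<xi> i))" by (simp add: ip_direct_sum)
    also have "\<dots> = (\<Sum>\<^sub>\<infinity>i\<in>I. Re (ip (V i) (\<xi> i) (\<xi> i)))"
      using infsum_Re[OF direct_sum_summable[OF \<xi> \<xi>]] by simp
    finally have s: "(\<Sum>\<^sub>\<infinity>i\<in>I. Re (ip (V i) (\<xi> i) (\<xi> i))) = 0" by simp
    show "\<xi> = \<zero>\<^bsub>D\<^esub>"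
    proof (rule extensionalityI[of _ I])
      fix i assume i: "i \<in> I"
      interpret definite_ip_space "V i" by (rule fam[OF i])
      have ci: "\<xi> i \<in> carrier (V i)" using \<xi> i by (simp add: carrier_direct_sum_iff)
      have nn: "ip (V j) (\<xi> j) (\<xi> j) \<in> \<real>\<^sub>\<ge>\<^sub>0" if "j \<in> I" for j
        using semi_ip_space.ip_nonneg[OF fam_semi[OF that], of "\<xi> j"] \<xi> that by (auto simp: carrier_direct_sum_iff)
      have "Re (ip (V i) (\<xi> i) (\<xi> i)) = 0"
      proof (rule nonneg_infsum_le_0D[of "\<lambda>i. Re (ip (V i) (\<xi> i) (\<xi> i))" I])
        show "(\<lambda>i. Re (ip (V i) (\<xi> i) (\<xi> i))) summable_on I"
          by (rule summable_on_Re[OF direct_sum_summable[OF \<xi> \<xi>]])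
      qed (use s i nn in \<open>auto simp: complex_nonneg_Reals_iff\<close>)
      then have "ip (V i) (\<xi> i) (\<xi> i) = 0"
        using nn[OF i] by (auto simp: complex_nonneg_Reals_iff complex_eq_iff)
      then show "\<xi> i = \<zero>\<^bsub>D\<^esub> i"
        using ip_definite[OF ci] i by (simp add: direct_sum_def)
    next
      show "\<xi> \<in> extensional I" using \<xi> by (simp add: carrier_direct_sum_iff)
    qed (auto simp: direct_sum_def)
  qed
qed

end

section \<open>Isometric actions\<close>

text \<open>By \<open>ip_norm_minus\<close> the distance of two vectors is a combination of four
  inner products, so it is preserved by every map that preserves the form, linear or not.\<close>

lemma null_class_isometry:
  assumes "semi_ip_space V" "semi_ip_space V'"
    and closed: "\<And>x. x \<in> carrier V \<Longrightarrow> f x \<in> carrier V'"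
    and isometry: "\<And>x y. \<lbrakk>x \<in> carrier V; y \<in> carrier V\<rbrakk> \<Longrightarrow> ip V' (f x) (f y) = ip V x y"
    and x: "x \<in> carrier V" and y: "y \<in> carrier V" and eq: "null_class V x = null_class V y"
  shows "null_class V' (f x) = null_class V' (f y)"
proof -
  interpret V: semi_ip_space V by fact
  interpret V': semi_ip_space V' by fact
  have "ip_norm V (x \<ominus>\<^bsub>V\<^esub> y) = 0"
    using eq x y by (simp add: V.null_class_eq_iff V.ip_norm_minus_eq_0_iff)
  then have "ip_norm V' (f x \<ominus>\<^bsub>V'\<^esub> f y) = 0"
    using x y by (simp add: closed isometry V.ip_norm_minus V'.ip_norm_minus)
  then show ?thesis
    using x y by (simp add: closed V'.null_class_eq_iff V'.ip_norm_minus_eq_0_iff)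
qed

text \<open>Distances are preserved for the same reason. The implication from images back to
  \<open>X\<close> yields surjectivity in \<open>intertwines_cauchy_space\<close>.\<close>

lemma cauchy_space_isometry:
  assumes "semi_ip_space V" "semi_ip_space V'"
    and closed: "\<And>x. x \<in> carrier V \<Longrightarrow> f x \<in> carrier V'"
    and isometry: "\<And>x y. \<lbrakk>x \<in> carrier V; y \<in> carrier V\<rbrakk> \<Longrightarrow> ip V' (f x) (f y) = ip V x y"
    and X: "\<And>n. X n \<in> carrier V"
  shows "(\<lambda>n. f (X n)) \<in> carrier (cauchy_space V') \<longleftrightarrow> X \<in> carrier (cauchy_space V)"
proof -
  interpret V: semi_ip_space V by fact
  interpret V': semi_ip_space V' by fact
  have "ip_norm V' (f (X m) \<ominus>\<^bsub>V'\<^esub> f (X n)) = ip_norm V (X m \<ominus>\<^bsub>V\<^esub> X n)" for m n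
    using X by (simp add: closed isometry V.ip_norm_minus V'.ip_norm_minus)
  then show ?thesis using X closed by (auto simp: cauchy_space_def)
qed

text \<open>Linearity is not demanded: on a definite space it follows from the isometry property
  (\<open>surjective_isometry_bounded\<close> below), and on the semidefinite spaces it is not needed.\<close>

locale isometric_action = G: group G + V: semi_ip_space V
  for G :: "('a, 'g) top_monoid_scheme" (structure) and V :: "('v, 'm) ip_space_scheme"
    and T :: "'a \<Rightarrow> 'v \<Rightarrow> 'v" +
  assumes closed: "\<lbrakk>s \<in> carrier G; x \<in> carrier V\<rbrakk> \<Longrightarrow> T s x \<in> carrier V"
    and isometry: "\<lbrakk>s \<in> carrier G; x \<in> carrier V; y \<in> carrier V\<rbrakk> \<Longrightarrow> ip V (T s x) (T s y) = ip V x y"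
    and mult: "\<lbrakk>s \<in> carrier G; t \<in> carrier G; x \<in> carrier V\<rbrakk> \<Longrightarrow> T (s \<otimes> t) x = T s (T t x)"
    and one: "x \<in> carrier V \<Longrightarrow> T \<one> x = x"
    and continuous: "\<lbrakk>x \<in> carrier V; y \<in> carrier V\<rbrakk> \<Longrightarrow>
      continuous_map (topo G) euclidean (\<lambda>s. ip V (T s x) y)"
    and topspace: "topspace (topo G) = carrier G"
begin

lemma inverse [simp]:
  "\<lbrakk>s \<in> carrier G; x \<in> carrier V\<rbrakk> \<Longrightarrow> T (inv s) (T s x) = x"
  "\<lbrakk>s \<in> carrier G; x \<in> carrier V\<rbrakk> \<Longrightarrow> T s (T (inv s) x) = x"
  by (simp_all add: one flip: mult)

lemma isometric_norm: "\<lbrakk>s \<in> carrier G; x \<in> carrier V\<rbrakk> \<Longrightarrow> ip_norm V (T s x) = ip_norm V x"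
  by (simp add: ip_norm_def isometry)

lemma isometric_dist: "\<lbrakk>s \<in> carrier G; x \<in> carrier V; y \<in> carrier V\<rbrakk> \<Longrightarrow>
    ip_norm V (T s x \<ominus>\<^bsub>V\<^esub> T s y) = ip_norm V (x \<ominus>\<^bsub>V\<^esub> y)"
  by (simp add: closed isometry V.ip_norm_minus)

text \<open>Since the action is isometric, the inner products along the sequences converge uniformly
  in \<open>s\<close>; a coefficient of the new action is thus a uniform limit of coefficients at
  the members \<open>X N\<close> and \<open>Y N\<close>.\<close>

lemma isometric_action_cauchy_space:
  "isometric_action G (cauchy_space V) (\<lambda>s X n. T s (X n))"
proof -
  let ?C = "cauchy_space V"
  interpret C: semi_ip_space ?C by (rule V.semi_ip_cauchy_space)
  note c = V.cauchy_space_closed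
  have closed_C: "(\<lambda>n. T s (X n)) \<in> carrier ?C" if "s \<in> carrier G" "X \<in> carrier ?C" for s X
    using cauchy_space_isometry[of V V "T s" X] V.semi_ip_space_axioms that closed isometry c by auto
  show ?thesis
  proof
    fix X Y assume X: "X \<in> carrier ?C" and Y: "Y \<in> carrier ?C"
    show "continuous_map (topo G) euclidean (\<lambda>s. ip ?C (\<lambda>n. T s (X n)) Y)"
    proof (rule continuous_map_uniform_approx)
      fix e :: real assume e: "e > 0"
      then obtain N where N: "\<forall>m\<ge>N. \<forall>n\<ge>N. ip_norm V (X m \<ominus>\<^bsub>V\<^esub> X n) * ip_norm V (Y m) +
          ip_norm V (X n) * ip_norm V (Y m \<ominus>\<^bsub>V\<^esub> Y n) < e/2"
        using V.cauchy_space_dist_less[OF X Y, of "e/2"] by auto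
      have "dist (ip ?C (\<lambda>n. T s (X n)) Y) (ip V (T s (X N)) (Y N)) < e" if s: "s \<in> topspace (topo G)" for s
      proof -
        have s: "s \<in> carrier G" using s by (simp add: topspace)
        \<comment> \<open>The limit in \<open>m\<close> preserves only weak inequalities, hence the
          bound \<open>e/2\<close> before the strict one.\<close>
        have "dist (ip ?C (\<lambda>n. T s (X n)) Y) (ip V (T s (X N)) (Y N)) \<le> e/2"
        proof (rule LIMSEQ_le_const2)
          show "(\<lambda>m. dist (ip V (T s (X m)) (Y m)) (ip V (T s (X N)) (Y N)))
             \<longlonglongrightarrow> dist (ip ?C (\<lambda>n. T s (X n)) Y) (ip V (T s (X N)) (Y N))"
            by (intro tendsto_intros V.cauchy_space_LIMSEQ closed_C s X Y)
          have "dist (ip V (T s (X m)) (Y m)) (ip V (T s (X N)) (Y N)) \<le> e/2" if "m \<ge> N" for m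
          proof -
            have "cmod (ip V (T s (X m)) (Y m) - ip V (T s (X N)) (Y N)) \<le>
               ip_norm V (T s (X m) \<ominus>\<^bsub>V\<^esub> T s (X N)) * ip_norm V (Y m) + ip_norm V (T s (X N)) * ip_norm V (Y m \<ominus>\<^bsub>V\<^esub> Y N)"
              by (intro V.ip_dist_le closed s c X Y)
            also have "\<dots> \<le> e/2"
              using N that s c[OF X] by (simp add: isometric_norm isometric_dist less_imp_le)
            finally show ?thesis by (simp add: dist_norm)
          qed
          then show "\<exists>N'. \<forall>m\<ge>N'. dist (ip V (T s (X m)) (Y m)) (ip V (T s (X N)) (Y N)) \<le> e/2" by blast
        qed
        then show ?thesis using e by simp
      qed
      moreover have "continuous_map (topo G) euclidean (\<lambda>s. ip V (T s (X N)) (Y N))"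
        by (intro continuous c X Y)
      ultimately show "\<exists>g. continuous_map (topo G) euclidean g \<and>
          (\<forall>x\<in>topspace (topo G). dist (ip ?C (\<lambda>n. T x (X n)) Y) (g x) < e)" by blast
    qed
    show "ip ?C (\<lambda>n. T s (X n)) (\<lambda>n. T s (Y n)) = ip ?C X Y" if "s \<in> carrier G" for s
      using c[OF X] c[OF Y] that by (simp add: cauchy_space_def isometry)
    show "(\<lambda>n. T \<one> (X n)) = X" using c[OF X] by (simp add: one)
    show "(\<lambda>n. T (s \<otimes> t) (X n)) = (\<lambda>n. T s (T t (X n)))" if "s \<in> carrier G" "t \<in> carrier G" for s t
      using c[OF X] that by (simp add: mult)
  qed (auto simp: closed_C topspace)
qed

lemma separation_map_null_class:
  assumes "s \<in> carrier G" "x \<in> carrier V"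
  shows "separation_map V (T s) (null_class V x) = null_class V (T s x)"
proof -
  have "null_class V (T s (class_rep (null_class V x))) = null_class V (T s x)"
    using assms by (intro null_class_isometry[of V V "T s"] V.semi_ip_space_axioms)
      (simp_all add: closed isometry V.class_rep_closed V.null_class_class_rep V.carrier_separation)
  then show ?thesis
    using assms by (simp add: separation_map_def V.carrier_separation)
qed

lemma isometric_action_separation:
  "isometric_action G (separation V) (\<lambda>s. separation_map V (T s))"
proof -
  interpret S: definite_ip_space "separation V" by (rule V.definite_separation)
  show ?thesis
  proof
    fix A B assume "A \<in> carrier (separation V)" "B \<in> carrier (separation V)"
    then obtain x y where xy: "x \<in> carrier V" "y \<in> carrier V" "A = null_class V x" "B = null_class V y"
      by (auto simp: V.carrier_separation)
    show "continuous_map (topo G) euclidean (\<lambda>s. ip (separation V) (separation_map V (T s) A) B)"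
      using xy by (intro continuous_map_eq[OF continuous[OF xy(1,2)]])
        (simp add: topspace separation_map_null_class V.ip_separation closed)
  qed (auto simp: V.carrier_separation separation_map_null_class closed isometry V.ip_separation mult one topspace)
qed

end

locale isometric_action_family =
  fixes G :: "('a, 'g) top_monoid_scheme" and I :: "'i set" and V :: "'i \<Rightarrow> ('v, 'm) ip_space_scheme"
    and T :: "'i \<Rightarrow> 'a \<Rightarrow> 'v \<Rightarrow> 'v"
  assumes act: "i \<in> I \<Longrightarrow> isometric_action G (V i) (T i)"
    and definite: "i \<in> I \<Longrightarrow> definite_ip_space (V i)"
    and group: "group G" and topspace: "topspace (topo G) = carrier G"

sublocale isometric_action_family \<subseteq> ip_space_family I V
  by (rule ip_space_family.intro) (rule definite)

context isometric_action_family
begin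

text \<open>For the GNS representations this is \<open>universal_rep\<close>, see
  \<open>universal_rep_eq\<close>.\<close>

definition sum_action :: "'a \<Rightarrow> ('i \<Rightarrow> 'v) \<Rightarrow> 'i \<Rightarrow> 'v"
  where "sum_action s = (\<lambda>\<xi>\<in>carrier D. \<lambda>i\<in>I. T i s (\<xi> i))"

lemma sum_action_closed:
  assumes s: "s \<in> carrier G" and \<xi>: "\<xi> \<in> carrier D"
  shows "sum_action s \<xi> \<in> carrier D"
proof -
  have "T i s (\<xi> i) \<in> carrier (V i)" "ip_norm (V i) (T i s (\<xi> i)) = ip_norm (V i) (\<xi> i)" if "i \<in> I" for i
    using isometric_action.closed[OF act[OF that] s] isometric_action.isometric_norm[OF act[OF that] s]
      \<xi> that by (auto simp: carrier_direct_sum_iff)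
  then show ?thesis
    using \<xi> by (simp add: carrier_direct_sum_iff sum_action_def cong: summable_on_cong)
qed

text \<open>The terms of a coefficient are bounded by the products of the norms of the components, a
  summable family that does not involve \<open>s\<close>. Finite subsums therefore approximate the
  coefficient uniformly on the group.\<close>

lemma isometric_action_direct_sum: "isometric_action G D sum_action"
proof -
  interpret G: group G by (rule group)
  interpret definite_ip_space D by (rule definite_direct_sum)
  have ci: "\<xi> i \<in> carrier (V i)" if "\<xi> \<in> carrier D" "i \<in> I" for \<xi> i
    using that by (simp add: carrier_direct_sum_iff)
  show ?thesis
  proof
    fix \<xi> \<eta> assume \<xi>: "\<xi> \<in> carrier D" and \<eta>: "\<eta> \<in> carrier D"
    show "sum_action (s \<otimes>\<^bsub>G\<^esub> t) \<xi> = sum_action s (sum_action t \<xi>)" if "s \<in> carrier G" "t \<in> carrier G" for s t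
      using sum_action_closed[OF that(2) \<xi>] \<xi> that ci[OF \<xi>]
      by (auto simp: sum_action_def isometric_action.mult[OF act] intro!: restrict_ext)
    show "ip D (sum_action s \<xi>) (sum_action s \<eta>) = ip D \<xi> \<eta>" if "s \<in> carrier G" for s
      using \<xi> \<eta> that ci
      by (auto simp: sum_action_def ip_direct_sum isometric_action.isometry[OF act] intro!: infsum_cong)
    show "sum_action \<one>\<^bsub>G\<^esub> \<xi> = \<xi>"
      using \<xi> by (intro extensionalityI[of _ I])
        (auto simp: sum_action_def ci isometric_action.one[OF act] carrier_direct_sum_iff)
    let ?b = "\<lambda>i. ip_norm (V i) (\<xi> i) * ip_norm (V i) (\<eta> i)"
    have bn: "0 \<le> ?b i" if "i \<in> I" for i
      using semi_ip_space.ip_norm_nonneg[OF fam_semi[OF that]] ci \<xi> \<eta> that by simp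
    have bs: "?b summable_on I"
    proof -
      have "(\<lambda>i. norm (complex_of_real (?b i))) summable_on I"
        using \<xi> \<eta> bn by (intro summable_on_product_le[of "\<lambda>i. ip_norm (V i) (\<xi> i)" _ "\<lambda>i. ip_norm (V i) (\<eta> i)"])
          (auto simp: carrier_direct_sum_iff abs_of_nonneg simp flip: of_real_mult)
      moreover have "norm (complex_of_real (?b i)) = ?b i" if "i \<in> I" for i
        using bn[OF that] by (simp only: norm_of_real abs_of_nonneg)
      ultimately show ?thesis by (simp cong: summable_on_cong)
    qed
    let ?g = "\<lambda>s i. ip (V i) (T i s (\<xi> i)) (\<eta> i)"
    have ip_eq: "ip D (sum_action s \<xi>) \<eta> = (\<Sum>\<^sub>\<infinity>i\<in>I. ?g s i)" if "s \<in> carrier G" for s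
      unfolding ip_direct_sum using \<xi> by (intro infsum_cong) (simp add: sum_action_def)
    have g_le: "cmod (?g s i) \<le> ?b i" if "s \<in> carrier G" "i \<in> I" for s i
      using semi_ip_space.Cauchy_Schwarz[OF fam_semi[OF that(2)]] ci[OF \<xi> that(2)] ci[OF \<eta> that(2)]
        isometric_action.closed[OF act[OF that(2)] that(1)] isometric_action.isometric_norm[OF act[OF that(2)] that(1)]
      by metis
    show "continuous_map (topo G) euclidean (\<lambda>s. ip D (sum_action s \<xi>) \<eta>)"
    proof (rule continuous_map_uniform_approx)
      fix e :: real assume e: "e > 0"
      have "(sum ?b \<longlongrightarrow> infsum ?b I) (finite_subsets_at_top I)"
        using has_sum_infsum[OF bs] by (simp add: has_sum_def)
      then have "\<forall>\<^sub>F F in finite_subsets_at_top I. dist (sum ?b F) (infsum ?b I) < e"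
        using e by (rule tendstoD)
      then obtain F where F: "finite F" "F \<subseteq> I" "dist (sum ?b F) (infsum ?b I) < e"
        unfolding eventually_finite_subsets_at_top by (elim exE conjE) auto
      have "dist (ip D (sum_action s \<xi>) \<eta>) (\<Sum>i\<in>F. ?g s i) < e" if s: "s \<in> topspace (topo G)" for s
      proof -
        have s: "s \<in> carrier G" using s by (simp add: topspace)
        have gs: "?g s summable_on I"
        proof -
          have "(\<lambda>i. norm (?g s i)) summable_on I"
            using \<xi> \<eta> g_le[OF s] by (intro summable_on_product_le[of "\<lambda>i. ip_norm (V i) (\<xi> i)" _ "\<lambda>i. ip_norm (V i) (\<eta> i)"])
              (auto simp: carrier_direct_sum_iff)
          then show ?thesis by (rule abs_summable_summable)
        qed
        have "ip D (sum_action s \<xi>) \<eta> - (\<Sum>i\<in>F. ?g s i) = infsum (?g s) (I - F)"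
          by (simp only: ip_eq[OF s] infsum_Diff[OF gs summable_on_finite[OF F(1)] F(2)] infsum_finite[OF F(1)])
        also have "cmod \<dots> \<le> infsum ?b (I - F)"
        proof (rule norm_infsum_le)
          show "(?g s has_sum infsum (?g s) (I - F)) (I - F)"
            by (rule has_sum_infsum[OF summable_on_subset_banach[OF gs Diff_subset]])
          show "(?b has_sum infsum ?b (I - F)) (I - F)"
            by (rule has_sum_infsum[OF summable_on_subset_banach[OF bs Diff_subset]])
        qed (use g_le[OF s] in auto)
        also have "\<dots> = infsum ?b I - sum ?b F"
          by (simp only: infsum_Diff[OF bs summable_on_finite[OF F(1)] F(2)] infsum_finite[OF F(1)])
        also have "\<dots> < e" using F(3) by (simp add: dist_real_def)
        finally show ?thesis by (simp add: dist_norm)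
      qed
      moreover have "continuous_map (topo G) euclidean (\<lambda>s. \<Sum>i\<in>F. ?g s i)"
        using F \<xi> \<eta> by (intro continuous_map_sum isometric_action.continuous[OF act] ci) auto
      ultimately show "\<exists>g. continuous_map (topo G) euclidean g \<and>
        (\<forall>s\<in>topspace (topo G). dist (ip D (sum_action s \<xi>) \<eta>) (g s) < e)" by blast
    qed
  qed (auto simp: sum_action_closed topspace)
qed

end

section \<open>Unitary actions\<close>

text \<open>Continuity is inherited in the form of continuous coefficients, from which
  \<open>continuous_map_action\<close> derives weak* continuity. Extensionality places the maps
  \<open>T s\<close> among the operators of \<open>bounded_operators\<close>.\<close>

locale unitary_action = isometric_action G V T + V: definite_ip_space V
  for G :: "('a, 'g) top_monoid_scheme" (structure) and V :: "('v, 'm) ip_space_scheme"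
    and T :: "'a \<Rightarrow> 'v \<Rightarrow> 'v" +
  assumes extensional: "s \<in> carrier G \<Longrightarrow> T s \<in> extensional (carrier V)"

text \<open>By surjectivity every test vector has the form \<open>S w\<close>; inner products
  against it are pulled back through \<open>S\<close>, where additivity and homogeneity are
  known.\<close>

lemma (in definite_ip_space) surjective_isometry_bounded:
  assumes ext: "S \<in> extensional (carrier V)" and surj: "S ` carrier V = carrier V"
    and isometry: "\<And>x y. \<lbrakk>x \<in> carrier V; y \<in> carrier V\<rbrakk> \<Longrightarrow> ip V (S x) (S y) = ip V x y"
  shows "S \<in> bounded_operators V"
proof -
  have c: "S x \<in> carrier V" if "x \<in> carrier V" for x using surj that by blast
  have "S (x \<oplus> y) = S x \<oplus> S y" if xy: "x \<in> carrier V" "y \<in> carrier V" for x y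
  proof -
    have "ip V (S (x \<oplus> y)) z = ip V (S x \<oplus> S y) z" if z: "z \<in> carrier V" for z
    proof -
      obtain w where "w \<in> carrier V" "z = S w" using surj z by blast
      then show ?thesis using xy by (simp add: isometry ip_add_left c)
    qed
    then show ?thesis using xy c by (subst eq_iff_ip) auto
  qed
  moreover have "S (a \<odot>\<^bsub>V\<^esub> x) = a \<odot>\<^bsub>V\<^esub> S x" if x: "x \<in> carrier V" for x a
  proof -
    have "ip V (S (a \<odot>\<^bsub>V\<^esub> x)) z = ip V (a \<odot>\<^bsub>V\<^esub> S x) z" if z: "z \<in> carrier V" for z
    proof -
      obtain w where "w \<in> carrier V" "z = S w" using surj z by blast
      then show ?thesis using x by (simp add: isometry ip_smult_left c)
    qed
    then show ?thesis using x c by (subst eq_iff_ip) auto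
  qed
  moreover have "ip_norm V (S x) \<le> 1 * ip_norm V x" if "x \<in> carrier V" for x
    using that by (simp add: ip_norm_def isometry)
  ultimately show ?thesis
    using c ext unfolding bounded_operators_def PiE_def by blast
qed

lemma (in unitary_action) action_bounded: "s \<in> carrier G \<Longrightarrow> T s \<in> bounded_operators V"
proof (rule V.surjective_isometry_bounded)
  assume s: "s \<in> carrier G"
  show "T s ` carrier V = carrier V"
  proof
    show "carrier V \<subseteq> T s ` carrier V"
    proof
      fix x assume "x \<in> carrier V"
      then show "x \<in> T s ` carrier V" using s by (intro image_eqI[of _ _ "T (inv s) x"]) (auto simp: closed)
    qed
  qed (use closed s in auto)
qed (auto simp: extensional isometry)

lemma (in definite_ip_space) Metric_space_ip_dist: "Metric_space (carrier V) (ip_dist V)"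
proof
  show "0 \<le> ip_dist V x y" for x y by (simp add: ip_dist_def ip_norm_nonneg)
  show "ip_dist V x y = ip_dist V y x" for x y by (simp add: ip_dist_def ip_norm_minus_commute)
  show "(ip_dist V x y = 0) = (x = y)" if "x \<in> carrier V" "y \<in> carrier V" for x y
    using that by (simp add: ip_dist_def ip_norm_minus_eq_0_iff eq_iff_ip)
  show "ip_dist V x z \<le> ip_dist V x y + ip_dist V y z"
    if "x \<in> carrier V" "y \<in> carrier V" "z \<in> carrier V" for x y z
  proof -
    have "x \<ominus> z = (x \<ominus> y) \<oplus> (y \<ominus> z)"
      using that by (subst eq_iff_ip) (auto simp: ip_minus_left ip_add_left)
    then show ?thesis using that ip_norm_add[of "x \<ominus> y" "y \<ominus> z"] by (simp add: ip_dist_def)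
  qed
qed

text \<open>Strong continuity passes to coefficients by Cauchy-Schwarz.\<close>

lemma continuous_unitary_rep_unitary_action:
  fixes G :: "('a, 'g) top_monoid_scheme" (structure)
  assumes "group G" and topspace: "topspace (topo G) = carrier G" and rep: "continuous_unitary_rep G V \<pi>"
  shows "unitary_action G V \<pi>"
proof -
  interpret G: group G by fact
  interpret complex_hilbert_space V using rep by (simp add: continuous_unitary_rep_def)
  have unitary: "\<pi> s \<in> unitary_operators V" if "s \<in> carrier G" for s
    using rep that by (simp add: continuous_unitary_rep_def)
  have cont: "continuous_map (topo G) (Metric_space.mtopology (carrier V) (ip_dist V)) (\<lambda>s. \<pi> s x)"
    if "x \<in> carrier V" for x
    using rep that by (simp add: continuous_unitary_rep_def)
  interpret V: definite_ip_space V by (rule definite_ip_space)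
  interpret M: Metric_space "carrier V" "ip_dist V" by (rule V.Metric_space_ip_dist)
  have closed: "\<pi> s x \<in> carrier V" if "s \<in> carrier G" "x \<in> carrier V" for s x
    using unitary[OF that(1)] that unfolding unitary_operators_def by blast
  have isometry: "ip V (\<pi> s x) (\<pi> s y) = ip V x y"
    if "s \<in> carrier G" "x \<in> carrier V" "y \<in> carrier V" for s x y
    using unitary[OF that(1)] that unfolding unitary_operators_def by blast
  have mult: "\<pi> (s \<otimes> t) x = \<pi> s (\<pi> t x)"
    if "s \<in> carrier G" "t \<in> carrier G" "x \<in> carrier V" for s t x
    using rep that by (simp add: continuous_unitary_rep_def compose_eq)
  show ?thesis
  proof
    fix x y assume x: "x \<in> carrier V" and y: "y \<in> carrier V"
    show "\<pi> \<one> x = x"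
    proof -
      \<comment> \<open>An idempotent map is the identity on its range, and the range of the
        idempotent \<open>\<pi> \<one>\<close> is everything.\<close>
      have "\<pi> \<one> ` carrier V = carrier V"
        using unitary[of \<one>] unfolding unitary_operators_def by blast
      then obtain z where "z \<in> carrier V" "x = \<pi> \<one> z" using x by blast
      then show ?thesis using mult[of \<one> \<one> z] by simp
    qed
    have c: "continuous_map (topo G) M.mtopology (\<lambda>s. \<pi> s x)"
      by (rule cont[OF x])
    show "continuous_map (topo G) euclidean (\<lambda>s. ip V (\<pi> s x) y)"
      unfolding mtopology_is_euclidean[symmetric] Met_TC.continuous_map_to_metric
    proof (intro ballI allI impI)
      fix s and e :: real assume s: "s \<in> topspace (topo G)" and e: "e > 0"
      \<comment> \<open>The summand 1 keeps the denominator positive for a null vector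
        \<open>y\<close>.\<close>
      define d where "d = e / (ip_norm V y + 1)"
      have n: "ip_norm V y + 1 > 0" using V.ip_norm_nonneg[OF y] by simp
      then have d: "d > 0" using e by (simp add: d_def)
      obtain U where U: "openin (topo G) U" "s \<in> U" "\<And>t. t \<in> U \<Longrightarrow> \<pi> t x \<in> M.mball (\<pi> s x) d"
        using c[unfolded M.continuous_map_to_metric, rule_format, OF s d] by (elim exE conjE) simp
      have "ip V (\<pi> t x) y \<in> ball (ip V (\<pi> s x) y) e" if "t \<in> U" for t
      proof -
        have t: "\<pi> s x \<in> carrier V" "\<pi> t x \<in> carrier V" "ip_norm V (\<pi> s x \<ominus>\<^bsub>V\<^esub> \<pi> t x) < d"
          using U(3)[OF that] by (auto simp: M.mball_def ip_dist_def)
        have "cmod (ip V (\<pi> s x) y - ip V (\<pi> t x) y) = cmod (ip V (\<pi> s x \<ominus>\<^bsub>V\<^esub> \<pi> t x) y)"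
          using t y by (simp add: V.ip_minus_left)
        also have "\<dots> \<le> ip_norm V (\<pi> s x \<ominus>\<^bsub>V\<^esub> \<pi> t x) * ip_norm V y"
          using t y by (intro V.Cauchy_Schwarz) auto
        also have "\<dots> \<le> ip_norm V (\<pi> s x \<ominus>\<^bsub>V\<^esub> \<pi> t x) * (ip_norm V y + 1)"
          using t by (intro mult_left_mono V.ip_norm_nonneg) auto
        also have "\<dots> < d * (ip_norm V y + 1)"
          using t n by (intro mult_strict_right_mono)
        also have "\<dots> = e" using n by (simp add: d_def)
        finally show ?thesis by (simp add: dist_norm)
      qed
      then show "\<exists>U. openin (topo G) U \<and> s \<in> U \<and> (\<forall>y'\<in>U. ip V (\<pi> y' x) y \<in> Met_TC.mball (ip V (\<pi> s x) y) e)"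
        using U(1,2) by auto
    qed
  next
    show "\<pi> s \<in> extensional (carrier V)" if "s \<in> carrier G" for s
      using unitary[OF that] unfolding unitary_operators_def bounded_operators_def PiE_def by blast
  qed (fact closed isometry mult topspace)+
qed

lemma continuous_map_complex_mult [continuous_intros]:
  fixes f g :: "'a \<Rightarrow> complex"
  shows "\<lbrakk>continuous_map X euclidean f; continuous_map X euclidean g\<rbrakk> \<Longrightarrow>
    continuous_map X euclidean (\<lambda>x. f x * g x)"
  by (simp add: continuous_map_atin tendsto_mult)

section \<open>The weak* topology\<close>

context semi_ip_space
begin

lemma square_summable_finite:
  "x \<in> carrier V \<Longrightarrow> (\<lambda>n. if n = 0 then x else \<zero>) \<in> square_summable_seqs V"
  unfolding square_summable_seqs_def
  using summable_finite[of "{0::nat}" "\<lambda>n. (ip_norm V (if n = 0 then x else \<zero>))\<^sup>2"] by auto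

text \<open>The subbasic set belonging to \<open>U = UNIV\<close> is the set of all bounded
  operators.\<close>

lemma topspace_weak_star [simp]: "topspace (weak_star_topology V) = bounded_operators V"
proof -
  have "\<exists>\<xi>\<in>square_summable_seqs V. True" using square_summable_finite[OF zero_closed] by blast
  then have "bounded_operators V \<subseteq> topspace (weak_star_topology V)"
    unfolding weak_star_topology_def topology_generated_by_topspace
    by (intro Union_upper CollectI) (use open_UNIV in auto)
  then show ?thesis
    unfolding weak_star_topology_def topology_generated_by_topspace by auto
qed

lemma continuous_map_weak_star_functional:
  assumes "\<xi> \<in> square_summable_seqs V" "\<eta> \<in> square_summable_seqs V"
  shows "continuous_map (weak_star_topology V) euclidean (\<lambda>S. \<Sum>n. ip V (S (\<xi> n)) (\<eta> n))"
proof -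
  have "openin (weak_star_topology V) {S \<in> bounded_operators V. (\<Sum>n. ip V (S (\<xi> n)) (\<eta> n)) \<in> U}" if "open U" for U
    unfolding weak_star_topology_def
    by (rule topology_generated_by_Basis) (use assms that in blast)
  then show ?thesis
    by (simp add: continuous_map_def)
qed

lemma continuous_map_into_weak_star:
  assumes "\<And>x. x \<in> topspace X \<Longrightarrow> f x \<in> bounded_operators V"
    and "\<And>\<xi> \<eta>. \<lbrakk>\<xi> \<in> square_summable_seqs V; \<eta> \<in> square_summable_seqs V\<rbrakk>
      \<Longrightarrow> continuous_map X euclidean (\<lambda>x. \<Sum>n. ip V (f x (\<xi> n)) (\<eta> n))"
  shows "continuous_map X (weak_star_topology V) f"
  unfolding weak_star_topology_def continuous_on_generated_topo_iff
proof (intro conjI allI impI)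
  fix A assume "A \<in> {{T \<in> bounded_operators V. (\<Sum>n. ip V (T (\<xi> n)) (\<eta> n)) \<in> U} | \<xi> \<eta> U.
      \<xi> \<in> square_summable_seqs V \<and> \<eta> \<in> square_summable_seqs V \<and> open U}"
  then obtain \<xi> \<eta> U where A: "A = {T \<in> bounded_operators V. (\<Sum>n. ip V (T (\<xi> n)) (\<eta> n)) \<in> U}"
    and *: "\<xi> \<in> square_summable_seqs V" "\<eta> \<in> square_summable_seqs V" "open U"
    by blast
  have "openin X {x \<in> topspace X. (\<Sum>n. ip V (f x (\<xi> n)) (\<eta> n)) \<in> U}"
    by (rule openin_continuous_map_preimage[OF assms(2)[OF *(1,2)]]) (use *(3) in simp)
  moreover have "f -` A \<inter> topspace X = {x \<in> topspace X. (\<Sum>n. ip V (f x (\<xi> n)) (\<eta> n)) \<in> U}"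
    using assms(1) by (auto simp: A)
  ultimately show "openin X (f -` A \<inter> topspace X)" by simp
next
  have "\<Union> {{T \<in> bounded_operators V. (\<Sum>n. ip V (T (\<xi> n)) (\<eta> n)) \<in> U} | \<xi> \<eta> U.
      \<xi> \<in> square_summable_seqs V \<and> \<eta> \<in> square_summable_seqs V \<and> open U} = bounded_operators V"
    using topspace_weak_star unfolding weak_star_topology_def topology_generated_by_topspace .
  then show "f ` topspace X \<subseteq> \<Union> {{T \<in> bounded_operators V. (\<Sum>n. ip V (T (\<xi> n)) (\<eta> n)) \<in> U} | \<xi> \<eta> U.
      \<xi> \<in> square_summable_seqs V \<and> \<eta> \<in> square_summable_seqs V \<and> open U}"
    using assms(1) by auto
qed

lemma bounded_operators_closed: "\<lbrakk>S \<in> bounded_operators V; x \<in> carrier V\<rbrakk> \<Longrightarrow> S x \<in> carrier V"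
  unfolding bounded_operators_def by blast

lemma bounded_operators_zero: "S \<in> bounded_operators V \<Longrightarrow> S \<zero> = \<zero>"
proof -
  assume S: "S \<in> bounded_operators V"
  then have "S (0 \<odot>\<^bsub>V\<^esub> \<zero>) = 0 \<odot>\<^bsub>V\<^esub> S \<zero>"
    unfolding bounded_operators_def mem_Collect_eq by (metis zero_closed)
  then show ?thesis
    using smult_l_null[of "S \<zero>"] smult_l_null[of \<zero>] bounded_operators_closed[OF S, of \<zero>] by simp
qed

text \<open>A single coefficient is the weak* functional of two sequences concentrated at index 0;
  the other terms vanish because operators map \<zero> to \<zero>.\<close>

lemma continuous_map_coefficient:
  assumes x: "x \<in> carrier V" and y: "y \<in> carrier V"
  shows "continuous_map (weak_star_topology V) euclidean (\<lambda>S. ip V (S x) y)"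
proof (rule continuous_map_eq[OF continuous_map_weak_star_functional[OF square_summable_finite[OF x] square_summable_finite[OF y]]])
  fix S assume "S \<in> topspace (weak_star_topology V)"
  then have S: "S \<in> bounded_operators V" by simp
  have "(\<Sum>n. ip V (S (if n = 0 then x else \<zero>)) (if n = 0 then y else \<zero>)) =
    (\<Sum>n\<in>{0::nat}. ip V (S (if n = 0 then x else \<zero>)) (if n = 0 then y else \<zero>))"
    by (rule suminf_finite) (auto simp: bounded_operators_zero[OF S])
  then show "(\<Sum>n. ip V (S (if n = 0 then x else \<zero>)) (if n = 0 then y else \<zero>)) = ip V (S x) y" by simp
qed

lemma compose_bounded:
  assumes S: "S \<in> bounded_operators V" and R: "R \<in> bounded_operators V"
  shows "compose (carrier V) S R \<in> bounded_operators V"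
proof -
  obtain C D where C: "\<And>x. x \<in> carrier V \<Longrightarrow> ip_norm V (S x) \<le> C * ip_norm V x"
    and D: "\<And>x. x \<in> carrier V \<Longrightarrow> ip_norm V (R x) \<le> D * ip_norm V x"
    using S R unfolding bounded_operators_def mem_Collect_eq by metis
  note cl = bounded_operators_closed[OF S] bounded_operators_closed[OF R]
  have "ip_norm V (S (R x)) \<le> (\<bar>C\<bar> * D) * ip_norm V x" if x: "x \<in> carrier V" for x
  proof -
    have "ip_norm V (S (R x)) \<le> C * ip_norm V (R x)" using C cl x by blast
    also have "\<dots> \<le> \<bar>C\<bar> * ip_norm V (R x)"
      using ip_norm_nonneg cl x by (intro mult_right_mono) auto
    also have "\<dots> \<le> \<bar>C\<bar> * (D * ip_norm V x)" using D[OF x] by (intro mult_left_mono) auto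
    finally show ?thesis by (simp add: mult.assoc)
  qed
  moreover have "compose (carrier V) S R \<in> carrier V \<rightarrow>\<^sub>E carrier V"
    using cl by (auto simp: compose_def)
  moreover have "S (x \<oplus> y) = S x \<oplus> S y" "R (x \<oplus> y) = R x \<oplus> R y" "S (c \<odot>\<^bsub>V\<^esub> x) = c \<odot>\<^bsub>V\<^esub> S x"
    "R (c \<odot>\<^bsub>V\<^esub> x) = c \<odot>\<^bsub>V\<^esub> R x" if "x \<in> carrier V" "y \<in> carrier V" for x y c
    using S R that by (auto simp: bounded_operators_def)
  ultimately show ?thesis
    unfolding bounded_operators_def using cl by (auto simp: compose_eq)
qed

text \<open>Polarization: the norm of a sum determines the real part of the inner product, and the
  real part at \<open>\<i>\<close> times \<open>y\<close> gives the imaginary part.\<close>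

lemma norm_preserving_ip:
  assumes S: "S \<in> bounded_operators V"
    and norm: "\<And>x. x \<in> carrier V \<Longrightarrow> ip_norm V (S x) = ip_norm V x"
    and x: "x \<in> carrier V" and y: "y \<in> carrier V"
  shows "ip V (S x) (S y) = ip V x y"
proof -
  note cl = bounded_operators_closed[OF S]
  have Re: "Re (ip V (S x) (S y)) = Re (ip V x y)" if "x \<in> carrier V" "y \<in> carrier V" for x y
  proof -
    have n: "(ip_norm V (x \<oplus> y))\<^sup>2 = (ip_norm V x)\<^sup>2 + 2 * Re (ip V x y) + (ip_norm V y)\<^sup>2"
      if "x \<in> carrier V" "y \<in> carrier V" for x y
      using that by (simp add: Re_ip_self[symmetric] ip_add_left ip_add_right ip_commute[of x y])
    have "S (x \<oplus> y) = S x \<oplus> S y" using S that by (auto simp: bounded_operators_def)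
    then show ?thesis
      using n[of x y] n[of "S x" "S y"] norm[of "x \<oplus> y"] norm[of x] norm[of y] that cl by simp
  qed
  have "S (\<i> \<odot>\<^bsub>V\<^esub> y) = \<i> \<odot>\<^bsub>V\<^esub> S y" using S y by (auto simp: bounded_operators_def)
  then have "Im (ip V (S x) (S y)) = Im (ip V x y)"
    using Re[of x "\<i> \<odot>\<^bsub>V\<^esub> y"] x y cl by (simp add: ip_smult_right)
  then show ?thesis using Re[OF x y] by (simp add: complex_eq_iff)
qed

end

text \<open>Different operators differ in some coefficient, and coefficients are weak*
  continuous.\<close>

lemma (in definite_ip_space) Hausdorff_weak_star: "Hausdorff_space (weak_star_topology V)"
  unfolding Hausdorff_space_def
proof (intro allI impI)
  fix S R assume "S \<in> topspace (weak_star_topology V) \<and> R \<in> topspace (weak_star_topology V) \<and> S \<noteq> R"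
  then have S: "S \<in> bounded_operators V" and R: "R \<in> bounded_operators V" and ne: "S \<noteq> R" by auto
  have "S \<in> extensional (carrier V)" "R \<in> extensional (carrier V)"
    using S R by (auto simp: bounded_operators_def PiE_def)
  then obtain x where x: "x \<in> carrier V" "S x \<noteq> R x" using ne extensionalityI by metis
  then obtain y where y: "y \<in> carrier V" "ip V (S x) y \<noteq> ip V (R x) y"
    using eq_iff_ip[of "S x" "R x"] bounded_operators_closed S R by blast
  obtain A B where AB: "open A" "open B" "ip V (S x) y \<in> A" "ip V (R x) y \<in> B" "A \<inter> B = {}"
    using hausdorff[OF y(2)] by blast
  have o: "openin (weak_star_topology V) {S \<in> topspace (weak_star_topology V). ip V (S x) y \<in> A}" if "open A" for A
    by (rule openin_continuous_map_preimage[OF continuous_map_coefficient[OF x(1) y(1)]]) (use that in simp)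
  show "\<exists>U W. openin (weak_star_topology V) U \<and> openin (weak_star_topology V) W \<and> S \<in> U \<and> R \<in> W \<and> disjnt U W"
    using o[OF AB(1)] o[OF AB(2)] AB(3-5) S R
    by (intro exI[of _ "{S \<in> topspace (weak_star_topology V). ip V (S x) y \<in> A}"]
       exI[of _ "{S \<in> topspace (weak_star_topology V). ip V (S x) y \<in> B}"]) (auto simp: disjnt_def)
qed

text \<open>The coefficients of \<open>f R\<close> are coefficients of \<open>R\<close> at
  transformed vectors, and norm preservation keeps square summable sequences square summable.
  Instances are multiplication from the left by a unit (\<open>b\<close> is its inverse), from the
  right by a group element (\<open>a\<close> is its action), and conjugation by an isometry.\<close>

lemma continuous_map_weak_star_conjugation:
  assumes "semi_ip_space V" "semi_ip_space V'"
    and f: "\<And>R. R \<in> bounded_operators V \<Longrightarrow> f R \<in> bounded_operators V'"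
    and a: "\<And>y. y \<in> carrier V' \<Longrightarrow> a y \<in> carrier V \<and> ip_norm V (a y) = ip_norm V' y"
    and b: "\<And>y. y \<in> carrier V' \<Longrightarrow> b y \<in> carrier V \<and> ip_norm V (b y) = ip_norm V' y"
    and ip: "\<And>R y z. \<lbrakk>R \<in> bounded_operators V; y \<in> carrier V'; z \<in> carrier V'\<rbrakk> \<Longrightarrow> ip V' (f R y) z = ip V (R (a y)) (b z)"
  shows "continuous_map (weak_star_topology V) (weak_star_topology V') f"
proof -
  interpret V: semi_ip_space V by fact
  interpret V': semi_ip_space V' by fact
  show ?thesis
  proof (rule V'.continuous_map_into_weak_star)
    fix \<xi> \<eta> assume "\<xi> \<in> square_summable_seqs V'" "\<eta> \<in> square_summable_seqs V'"
    then have c: "\<And>n. \<xi> n \<in> carrier V'" "\<And>n. \<eta> n \<in> carrier V'"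
      and s: "summable (\<lambda>n. (ip_norm V' (\<xi> n))\<^sup>2)" "summable (\<lambda>n. (ip_norm V' (\<eta> n))\<^sup>2)"
      by (auto simp: square_summable_seqs_def)
    have "(\<lambda>n. a (\<xi> n)) \<in> square_summable_seqs V" "(\<lambda>n. b (\<eta> n)) \<in> square_summable_seqs V"
      using c s a b by (auto simp: square_summable_seqs_def)
    from V.continuous_map_weak_star_functional[OF this]
    show "continuous_map (weak_star_topology V) euclidean (\<lambda>R. \<Sum>n. ip V' (f R (\<xi> n)) (\<eta> n))"
      by (rule continuous_map_eq) (simp add: ip c)
  qed (simp add: f)
qed

section \<open>The compactification of a unitary action\<close>

lemma rep_compactification_simps [simp]:
  "carrier (rep_compactification G V \<pi>) = weak_star_topology V closure_of (\<pi> ` carrier G)"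
  "mult (rep_compactification G V \<pi>) = compose (carrier V)"
  "one (rep_compactification G V \<pi>) = (\<lambda>x\<in>carrier V. x)"
  "topo (rep_compactification G V \<pi>) = subtopology (weak_star_topology V) (weak_star_topology V closure_of (\<pi> ` carrier G))"
  by (simp_all add: rep_compactification_def Let_def)

text \<open>The compact set carries \<open>f\<close> and lies inside \<open>U\<close>: small
  \<open>U\<close> make the action an open map, and for \<open>U\<close> the complement of a point
  it becomes injective.\<close>

definition separating ::
    "('a, 'm) top_monoid_scheme \<Rightarrow> ('v, 'n) ip_space_scheme \<Rightarrow> ('a \<Rightarrow> 'v \<Rightarrow> 'v) \<Rightarrow> bool"
  where "separating G V \<pi> \<longleftrightarrow> (\<forall>s U. openin (topo G) U \<and> s \<in> U \<longrightarrow>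
    (\<exists>f\<in>eberlein_algebra G V \<pi>. f s \<noteq> 0 \<and>
      (\<exists>K. compactin (topo G) K \<and> K \<subseteq> U \<and> (\<forall>t\<in>carrier G - K. f t = 0))))"

lemma separatingE:
  assumes "separating G V \<pi>" "openin (topo G) U" "s \<in> U"
  obtains f K where "f \<in> eberlein_algebra G V \<pi>" "f s \<noteq> 0" "compactin (topo G) K" "K \<subseteq> U"
    "\<And>t. t \<in> carrier G \<Longrightarrow> t \<notin> K \<Longrightarrow> f t = 0"
  using assms unfolding separating_def by (metis DiffI)

lemma summable_product_le:
  fixes a b :: "nat \<Rightarrow> real"
  assumes "summable (\<lambda>n. (a n)\<^sup>2)" "summable (\<lambda>n. (b n)\<^sup>2)"
  shows "summable (\<lambda>n. \<bar>a n * b n\<bar>)"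
proof (rule summable_comparison_test'[of "\<lambda>n. (a n)\<^sup>2 + (b n)\<^sup>2" 0])
  show "summable (\<lambda>n. (a n)\<^sup>2 + (b n)\<^sup>2)" using assms by (rule summable_add)
  fix n
  have "2 * (\<bar>a n\<bar> * \<bar>b n\<bar>) \<le> (a n)\<^sup>2 + (b n)\<^sup>2"
    using sum_squares_bound[of "\<bar>a n\<bar>" "\<bar>b n\<bar>"] by simp
  moreover have "0 \<le> \<bar>a n\<bar> * \<bar>b n\<bar>" by simp
  ultimately show "norm \<bar>a n * b n\<bar> \<le> (a n)\<^sup>2 + (b n)\<^sup>2" by (simp only: real_norm_def abs_mult abs_abs)
qed

section \<open>The weak* closure of the image of the group: embedding, contractions and
  units\<close>

context unitary_action
begin

abbreviation "cpt \<equiv> weak_star_topology V closure_of (T ` carrier G)"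

lemma mult_compose: "\<lbrakk>s \<in> carrier G; t \<in> carrier G\<rbrakk> \<Longrightarrow> T (s \<otimes> t) = compose (carrier V) (T s) (T t)"
  by (rule extensionalityI[of _ "carrier V"]) (auto simp: extensional mult compose_eq)

lemma one_restrict: "T \<one> = (\<lambda>x\<in>carrier V. x)"
  by (rule extensionalityI[of _ "carrier V"]) (auto simp: extensional one)

text \<open>The tails of the series are bounded by the tails of a summable series of products of
  norms, independently of the group element, so its partial sums, finite sums of coefficients,
  converge uniformly.\<close>

lemma continuous_map_action: "continuous_map (topo G) (weak_star_topology V) T"
proof (rule V.continuous_map_into_weak_star)
  fix \<xi> \<eta> assume "\<xi> \<in> square_summable_seqs V" "\<eta> \<in> square_summable_seqs V"
  then have c: "\<And>n. \<xi> n \<in> carrier V" "\<And>n. \<eta> n \<in> carrier V"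
    and s: "summable (\<lambda>n. (ip_norm V (\<xi> n))\<^sup>2)" "summable (\<lambda>n. (ip_norm V (\<eta> n))\<^sup>2)"
    by (auto simp: square_summable_seqs_def)
  define b where "b n = \<bar>ip_norm V (\<xi> n) * ip_norm V (\<eta> n)\<bar>" for n
  have b: "summable b" unfolding b_def by (rule summable_product_le[OF s])
  have le: "cmod (ip V (T t (\<xi> n)) (\<eta> n)) \<le> b n" if "t \<in> carrier G" for t n
    using V.Cauchy_Schwarz[of "T t (\<xi> n)" "\<eta> n"] c closed that by (simp add: isometric_norm b_def)
  show "continuous_map (topo G) euclidean (\<lambda>t. \<Sum>n. ip V (T t (\<xi> n)) (\<eta> n))"
  proof (rule continuous_map_uniform_approx)
    fix e :: real assume "e > 0"
    then obtain N where N: "norm (\<Sum>i. b (i + N)) < e"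
      using suminf_exist_split[OF _ b, of e] by blast
    have "dist (\<Sum>n. ip V (T t (\<xi> n)) (\<eta> n)) (\<Sum>n<N. ip V (T t (\<xi> n)) (\<eta> n)) < e" if "t \<in> topspace (topo G)" for t
    proof -
      have t: "t \<in> carrier G" using that by (simp add: topspace)
      have sm: "summable (\<lambda>n. ip V (T t (\<xi> n)) (\<eta> n))"
        by (rule summable_comparison_test'[OF b, of 0]) (use le[OF t] in simp)
      have "(\<Sum>n. ip V (T t (\<xi> n)) (\<eta> n)) - (\<Sum>n<N. ip V (T t (\<xi> n)) (\<eta> n)) = (\<Sum>n. ip V (T t (\<xi> (n + N))) (\<eta> (n + N)))"
        using suminf_split_initial_segment[OF sm, of N] by simp
      also have "cmod \<dots> \<le> (\<Sum>n. b (n + N))"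
        by (rule norm_suminf_le) (use le[OF t] b in \<open>auto simp: summable_ignore_initial_segment\<close>)
      also have "\<dots> < e" using N by simp
      finally show ?thesis by (simp add: dist_norm)
    qed
    moreover have "continuous_map (topo G) euclidean (\<lambda>t. \<Sum>n<N. ip V (T t (\<xi> n)) (\<eta> n))"
      by (intro continuous_map_sum continuous c) auto
    ultimately show "\<exists>g. continuous_map (topo G) euclidean g \<and>
       (\<forall>x\<in>topspace (topo G). dist (\<Sum>n. ip V (T x (\<xi> n)) (\<eta> n)) (g x) < e)" by blast
  qed
qed (simp add: topspace action_bounded)

lemma action_in_closure: "s \<in> carrier G \<Longrightarrow> T s \<in> cpt"
  using closure_of_subset[of "T ` carrier G" "weak_star_topology V"] action_bounded by auto

lemma closure_bounded: "S \<in> cpt \<Longrightarrow> S \<in> bounded_operators V"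
  using closure_of_subset_topspace[of "weak_star_topology V"] by auto

text \<open>For fixed \<open>S x\<close> the bound of \<langle>R x, S x\<rangle> by the product of
  the norms of \<open>x\<close> and \<open>S x\<close> is a weak* closed condition on
  \<open>R\<close> that holds on the image of the group. At \<open>R = S\<close> it bounds the
  square of the norm of \<open>S x\<close>.\<close>

lemma closure_contraction:
  assumes S: "S \<in> cpt" and x: "x \<in> carrier V"
  shows "ip_norm V (S x) \<le> ip_norm V x"
proof -
  have Sx: "S x \<in> carrier V" using closure_bounded[OF S] V.bounded_operators_closed x by blast
  let ?A = "{R \<in> topspace (weak_star_topology V). ip V (R x) (S x) \<in> cball 0 (ip_norm V x * ip_norm V (S x))}"
  have "closedin (weak_star_topology V) ?A"
    by (rule closedin_continuous_map_preimage[OF V.continuous_map_coefficient[OF x Sx]]) simp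
  moreover have "T ` carrier G \<subseteq> ?A"
  proof clarsimp
    fix s assume s: "s \<in> carrier G"
    then show "T s \<in> bounded_operators V \<and> cmod (ip V (T s x) (S x)) \<le> ip_norm V x * ip_norm V (S x)"
      using V.Cauchy_Schwarz[of "T s x" "S x"] x Sx closed[OF s x] by (simp add: action_bounded isometric_norm)
  qed
  ultimately have "S \<in> ?A" using S closure_of_minimal by blast
  then have "cmod (ip V (S x) (S x)) \<le> ip_norm V x * ip_norm V (S x)" by simp
  then have le: "ip_norm V (S x) * ip_norm V (S x) \<le> ip_norm V x * ip_norm V (S x)"
    by (simp add: V.ip_self[OF Sx] power2_eq_square del: of_real_mult)
  show ?thesis
  proof (cases "ip_norm V (S x) = 0")
    case True then show ?thesis using V.ip_norm_nonneg[OF x] by simp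
  next
    case False
    then have "ip_norm V (S x) > 0" using V.ip_norm_nonneg[OF Sx] by simp
    then show ?thesis using le by simp
  qed
qed

text \<open>\<open>P\<close> is the same polynomial in coefficients and conjugated coefficients, now
  read as a function of the operator; so it can also be evaluated at limit points of the image of
  the group.\<close>

lemma generated_extends:
  assumes "h \<in> generated_function_algebra (carrier G) {\<lambda>s\<in>carrier G. f s + cnj (g s) | f g.
        f \<in> coefficient_space G V T \<and> g \<in> coefficient_space G V T}"
  shows "\<exists>P. continuous_map (weak_star_topology V) euclidean P \<and> (\<forall>s\<in>carrier G. P (T s) = h s)"
  using assms
proof induction
  case (gen h)
  have *: "\<exists>P. continuous_map (weak_star_topology V) euclidean P \<and> (\<forall>s\<in>carrier G. P (T s) = f s)"
    if f: "f \<in> coefficient_space G V T" for f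
  proof -
    obtain n :: nat and c \<xi> \<eta> where f: "f = (\<lambda>s\<in>carrier G. \<Sum>i<n. c i * ip V (T s (\<xi> i)) (\<eta> i))"
      and c: "\<forall>i<n. \<xi> i \<in> carrier V \<and> \<eta> i \<in> carrier V"
      using f unfolding coefficient_space_def by blast
    show ?thesis
      unfolding f using c
      by (intro exI[of _ "\<lambda>S. \<Sum>i<n. c i * ip V (S (\<xi> i)) (\<eta> i)"] conjI continuous_map_sum
        continuous_map_complex_mult V.continuous_map_coefficient) auto
  qed
  obtain f g where f: "f \<in> coefficient_space G V T" and g: "g \<in> coefficient_space G V T" and h: "h = (\<lambda>s\<in>carrier G. f s + cnj (g s))"
    using gen by blast
  obtain P where P: "continuous_map (weak_star_topology V) euclidean P" "\<forall>s\<in>carrier G. P (T s) = f s"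
    using *[OF f] by (elim exE conjE) simp
  obtain Q where Q: "continuous_map (weak_star_topology V) euclidean Q" "\<forall>s\<in>carrier G. Q (T s) = g s"
    using *[OF g] by (elim exE conjE) simp
  have "continuous_map (weak_star_topology V) euclidean (cnj \<circ> Q)"
    by (rule continuous_map_compose[OF Q(1)]) (auto intro!: continuous_intros)
  then have "continuous_map (weak_star_topology V) euclidean (\<lambda>S. P S + (cnj \<circ> Q) S)"
    by (intro continuous_map_add P)
  then show ?case using P(2) Q(2) unfolding h by (intro exI[of _ "\<lambda>S. P S + (cnj \<circ> Q) S"]) auto
next
  case (add f g)
  then obtain P Q where "continuous_map (weak_star_topology V) euclidean P" "\<forall>s\<in>carrier G. P (T s) = f s"
    and "continuous_map (weak_star_topology V) euclidean Q" "\<forall>s\<in>carrier G. Q (T s) = g s"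
    by (elim exE conjE) simp
  then show ?case by (intro exI[of _ "\<lambda>S. P S + Q S"]) (auto intro: continuous_map_add)
next
  case (smult f c)
  then obtain P where "continuous_map (weak_star_topology V) euclidean P" "\<forall>s\<in>carrier G. P (T s) = f s"
    by (elim exE conjE) simp
  then show ?case by (intro exI[of _ "\<lambda>S. c * P S"]) (auto intro!: continuous_map_complex_mult)
next
  case (mult f g)
  then obtain P Q where "continuous_map (weak_star_topology V) euclidean P" "\<forall>s\<in>carrier G. P (T s) = f s"
    and "continuous_map (weak_star_topology V) euclidean Q" "\<forall>s\<in>carrier G. Q (T s) = g s"
    by (elim exE conjE) simp
  then show ?case by (intro exI[of _ "\<lambda>S. P S * Q S"]) (auto intro: continuous_map_complex_mult)
qed

lemma eberlein_approx:
  assumes "f \<in> eberlein_algebra G V T" "e > 0"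
  shows "\<exists>P. continuous_map (weak_star_topology V) euclidean P \<and> (\<forall>s\<in>carrier G. cmod (f s - P (T s)) < e)"
proof -
  obtain h where h: "h \<in> generated_function_algebra (carrier G) {\<lambda>s\<in>carrier G. f s + cnj (g s) | f g.
        f \<in> coefficient_space G V T \<and> g \<in> coefficient_space G V T}" and *: "\<forall>s\<in>carrier G. cmod (f s - h s) < e"
    using assms unfolding eberlein_algebra_def uniform_closure_def by blast
  obtain P where "continuous_map (weak_star_topology V) euclidean P" "\<forall>s\<in>carrier G. P (T s) = h s"
    using generated_extends[OF h] by blast
  then show ?thesis using * by (intro exI[of _ P]) auto
qed

text \<open>If \<open>f\<close> vanishes off the compact set \<open>K\<close> and \<open>P\<close> approximates \<open>f\<close>, then the part of
  the compactification where \<open>P\<close> is large lies in the closed set \<open>T ` K\<close>.\<close>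

lemma open_image:
  assumes sep: "separating G V T" and U: "openin (topo G) U"
  shows "openin (subtopology (weak_star_topology V) cpt) (T ` U)"
proof (subst openin_subopen, intro ballI)
  have UG: "U \<subseteq> carrier G" using openin_subset[OF U] by (simp add: topspace)
  fix S assume "S \<in> T ` U"
  then obtain s where s: "s \<in> U" "S = T s" by blast
  obtain f K where f: "f \<in> eberlein_algebra G V T" "f s \<noteq> 0"
    and K: "compactin (topo G) K" "K \<subseteq> U" "\<And>t. t \<in> carrier G \<Longrightarrow> t \<notin> K \<Longrightarrow> f t = 0"
    by (rule separatingE[OF sep U s(1)]) simp
  \<comment> \<open>With error \<open>d\<close> the approximant exceeds \<open>2 * d\<close> at
    \<open>T s\<close> and stays below \<open>d\<close> at the group elements outside
    \<open>K\<close>, so the level \<open>d\<close> separates the two.\<close>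
  define d where "d = cmod (f s) / 3"
  have d: "d > 0" using f(2) by (simp add: d_def)
  obtain P where P: "continuous_map (weak_star_topology V) euclidean P" "\<And>t. t \<in> carrier G \<Longrightarrow> cmod (f t - P (T t)) < d"
    using eberlein_approx[OF f(1) d] by blast
  define W where "W = {R \<in> topspace (weak_star_topology V). P R \<in> - cball 0 d}"
  have W: "openin (weak_star_topology V) W"
    unfolding W_def by (rule openin_continuous_map_preimage[OF P(1)]) auto
  have "S \<in> W"
  proof -
    have "cmod (f s) \<le> cmod (f s - P (T s)) + cmod (P (T s))"
      by (metis add.commute diff_add_cancel norm_triangle_ineq)
    then have "cmod (P (T s)) > d" using P(2)[OF subsetD[OF UG s(1)]] d unfolding d_def by linarith
    then show ?thesis using s UG action_bounded by (auto simp: W_def)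
  qed
  moreover have "W \<inter> cpt \<subseteq> T ` U"
  proof (rule ccontr)
    assume "\<not> W \<inter> cpt \<subseteq> T ` U"
    then obtain R where R: "R \<in> W" "R \<in> cpt" "R \<notin> T ` K" using K(2) by blast
    have "compactin (weak_star_topology V) (T ` K)"
      by (rule image_compactin[OF K(1) continuous_map_action])
    then have "closedin (weak_star_topology V) (T ` K)"
      using V.Hausdorff_weak_star compactin_imp_closedin by blast
    \<comment> \<open>This is an open neighbourhood of \<open>R\<close>, a point of the closure, and
      so contains some \<open>T t\<close>. Then \<open>t\<close> lies outside \<open>K\<close>,
      where the approximant is below the level \<open>d\<close>.\<close>
    then have "openin (weak_star_topology V) (W - T ` K)" using W by blast
    then obtain t where t: "t \<in> carrier G" "T t \<in> W - T ` K"
      using R unfolding in_closure_of by blast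
    then have "t \<notin> K" by blast
    then have "cmod (P (T t)) < d" using P(2)[OF t(1)] K(3)[of t] t(1) by simp
    then show False using t(2) by (auto simp: W_def)
  qed
  moreover have "openin (subtopology (weak_star_topology V) cpt) (W \<inter> cpt)"
    using W by (auto simp: openin_subtopology)
  ultimately show "\<exists>A. openin (subtopology (weak_star_topology V) cpt) A \<and> S \<in> A \<and> A \<subseteq> T ` U"
    using action_in_closure s UG by blast
qed

text \<open>The open complement of \<open>t\<close> supports some \<open>f\<close> with
  \<open>f s \<noteq> 0\<close> and \<open>f t = 0\<close>; an approximation within half the modulus
  of \<open>f s\<close> still distinguishes \<open>T s\<close> from \<open>T t\<close>.\<close>

lemma inj_action:
  assumes sep: "separating G V T" and "Hausdorff_space (topo G)"
  shows "inj_on T (carrier G)"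
proof (rule inj_onI, rule ccontr)
  fix s t assume st: "s \<in> carrier G" "t \<in> carrier G" "T s = T t" "s \<noteq> t"
  have "closedin (topo G) {t}"
    using assms(2) st(2) by (simp add: closedin_Hausdorff_singleton topspace)
  then have "openin (topo G) (carrier G - {t})" using topspace by (metis closedin_def)
  moreover have "s \<in> carrier G - {t}" using st by blast
  ultimately obtain f K where f: "f \<in> eberlein_algebra G V T" "f s \<noteq> 0"
    and K: "K \<subseteq> carrier G - {t}" "\<And>t. t \<in> carrier G \<Longrightarrow> t \<notin> K \<Longrightarrow> f t = 0"
    by (rule separatingE[OF sep]) simp
  have ft: "f t = 0" using K st by blast
  obtain P where P: "\<And>t. t \<in> carrier G \<Longrightarrow> cmod (f t - P (T t)) < cmod (f s) / 2"
    using eberlein_approx[OF f(1), of "cmod (f s) / 2"] f(2) by auto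
  have "cmod (f s) \<le> cmod (f s - P (T s)) + cmod (P (T s))"
    by (metis add.commute diff_add_cancel norm_triangle_ineq)
  then show False using P[OF st(1)] P[OF st(2)] st(3) ft by simp
qed

lemma embedding_action:
  assumes "separating G V T" "Hausdorff_space (topo G)"
  shows "embedding_map (topo G) (topo (rep_compactification G V T)) T"
proof (rule injective_open_imp_embedding_map)
  show "continuous_map (topo G) (topo (rep_compactification G V T)) T"
    using continuous_map_action action_in_closure
    by (auto simp: continuous_map_in_subtopology topspace)
  show "open_map (topo G) (topo (rep_compactification G V T)) T"
    using open_image[OF assms(1)] by (simp add: open_map_def)
  show "inj_on T (topspace (topo G))" using inj_action[OF assms] by (simp add: topspace)
qed

text \<open>A unit \<open>S\<close> of the compactification and its inverse \<open>R\<close> are contractions, hence isometries,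
  so multiplication by \<open>R\<close> is weak* continuous and the open set of all \<open>A\<close> with \<open>R A\<close> in the open
  set \<open>T ` carrier G\<close> is a neighbourhood of \<open>S\<close>; therefore it meets the dense set \<open>T ` carrier G\<close>.\<close>

lemma Units_compactification:
  assumes sep: "separating G V T"
  shows "Units (rep_compactification G V T) = T ` carrier G"
proof
  show "T ` carrier G \<subseteq> Units (rep_compactification G V T)"
  proof clarify
    fix s assume s: "s \<in> carrier G"
    then have "compose (carrier V) (T s) (T (inv s)) = (\<lambda>x\<in>carrier V. x)"
      "compose (carrier V) (T (inv s)) (T s) = (\<lambda>x\<in>carrier V. x)"
      by (simp_all add: one_restrict flip: mult_compose)
    then show "T s \<in> Units (rep_compactification G V T)"
      using action_in_closure s G.inv_closed unfolding Units_def by fastforce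
  qed
  show "Units (rep_compactification G V T) \<subseteq> T ` carrier G"
  proof
    fix S assume "S \<in> Units (rep_compactification G V T)"
    then obtain R where S: "S \<in> cpt" and R: "R \<in> cpt"
      and SR: "compose (carrier V) S R = (\<lambda>x\<in>carrier V. x)" and RS: "compose (carrier V) R S = (\<lambda>x\<in>carrier V. x)"
      unfolding Units_def by auto
    have Sc: "S x \<in> carrier V" and Rc: "R x \<in> carrier V" if "x \<in> carrier V" for x
      using S R that closure_bounded V.bounded_operators_closed by blast+
    have SR': "S (R x) = x" and RS': "R (S x) = x" if "x \<in> carrier V" for x
      using fun_cong[OF SR, of x] fun_cong[OF RS, of x] that by (simp_all add: compose_eq)
    \<comment> \<open>Both \<open>R\<close> and \<open>S\<close> are contractions and
      \<open>x = S (R x)\<close>, so neither inequality can be strict.\<close>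
    have norm_R: "ip_norm V (R x) = ip_norm V x" if "x \<in> carrier V" for x
      using closure_contraction[OF R that] closure_contraction[OF S Rc[OF that]] that by (simp add: SR')
    have norm_S: "ip_norm V (S x) = ip_norm V x" if "x \<in> carrier V" for x
      using closure_contraction[OF S that] closure_contraction[OF R Sc[OF that]] that by (simp add: RS')
    have ip_R: "ip V (R x) (R y) = ip V x y" if "x \<in> carrier V" "y \<in> carrier V" for x y
    proof (rule V.norm_preserving_ip)
      show "R \<in> bounded_operators V" using closure_bounded[OF R] .
    qed (use norm_R that in auto)
    have contR: "continuous_map (weak_star_topology V) (weak_star_topology V) (compose (carrier V) R)"
    \<comment> \<open>\<open>S\<close> serves as adjoint of the isometry \<open>R\<close>:
      \<langle>R A y, z\<rangle> = \<langle>R A y, R S z\<rangle> = \<langle>A y, S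
      z\<rangle>.\<close>
    proof (rule continuous_map_weak_star_conjugation[where a = "\<lambda>x. x" and b = S])
      fix A assume A: "A \<in> bounded_operators V"
      show "compose (carrier V) R A \<in> bounded_operators V"
        by (rule V.compose_bounded[OF closure_bounded[OF R] A])
      show "ip V (compose (carrier V) R A y) z = ip V (A y) (S z)" if "y \<in> carrier V" "z \<in> carrier V" for y z
        using ip_R[of "A y" "S z"] that A V.bounded_operators_closed Sc by (simp add: compose_eq RS')
    qed (use V.semi_ip_space_axioms norm_S Sc in auto)
    have "openin (subtopology (weak_star_topology V) cpt) (T ` carrier G)"
      by (rule open_image[OF sep]) (simp flip: topspace)
    then obtain Q where Q: "openin (weak_star_topology V) Q" "T ` carrier G = Q \<inter> cpt"
      unfolding openin_subtopology by blast
    have "openin (weak_star_topology V) {A \<in> topspace (weak_star_topology V). compose (carrier V) R A \<in> Q}"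
      by (rule openin_continuous_map_preimage[OF contR Q(1)])
    moreover have "compose (carrier V) R S \<in> Q"
      using Q(2) action_in_closure[of \<one>] by (auto simp: RS simp flip: one_restrict)
    moreover have "S \<in> topspace (weak_star_topology V)" using closure_bounded[OF S] by simp
    ultimately have "\<exists>A. A \<in> T ` carrier G \<and> A \<in> {A \<in> topspace (weak_star_topology V). compose (carrier V) R A \<in> Q}"
      using S[unfolded in_closure_of, THEN conjunct2, rule_format,
        of "{A \<in> topspace (weak_star_topology V). compose (carrier V) R A \<in> Q}"] by blast
    then obtain t where t: "t \<in> carrier G" "compose (carrier V) R (T t) \<in> Q" by blast
    \<comment> \<open>Multiplication by \<open>T t\<close> from the right is weak* continuous and
      maps the image of the group into itself; hence it maps the closure into itself.\<close>
    have "compose (carrier V) R (T t) \<in> cpt"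
    proof -
      let ?N = "{A \<in> topspace (weak_star_topology V). compose (carrier V) A (T t) \<in> cpt}"
      have "continuous_map (weak_star_topology V) (weak_star_topology V) (\<lambda>A. compose (carrier V) A (T t))"
      proof (rule continuous_map_weak_star_conjugation[where a = "T t" and b = "\<lambda>x. x"])
        fix A assume A: "A \<in> bounded_operators V"
        show "compose (carrier V) A (T t) \<in> bounded_operators V"
          by (rule V.compose_bounded[OF A action_bounded[OF t(1)]])
      qed (use V.semi_ip_space_axioms t(1) in \<open>auto simp: closed isometric_norm compose_eq\<close>)
      then have "closedin (weak_star_topology V) ?N"
        by (rule closedin_continuous_map_preimage) simp
      moreover have "T ` carrier G \<subseteq> ?N"
        using t(1) by (auto simp: action_bounded action_in_closure simp flip: mult_compose)
      ultimately show ?thesis using R closure_of_minimal by blast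
    qed
    then obtain s where s: "s \<in> carrier G" "compose (carrier V) R (T t) = T s"
      using t(2) Q(2) by blast
    \<comment> \<open>Since \<open>R\<close> followed after \<open>T t\<close> is
      \<open>T s\<close>, applying \<open>S\<close> and precomposing with \<open>T (inv s)\<close>
      leaves \<open>S\<close> on one side and \<open>T (t \<otimes> inv s)\<close> on the
      other.\<close>
    have "S = T (t \<otimes> inv s)"
    proof (rule extensionalityI[of _ "carrier V"])
      show "S \<in> extensional (carrier V)"
        using closure_bounded[OF S] by (auto simp: bounded_operators_def PiE_def)
      fix x assume x: "x \<in> carrier V"
      let ?y = "T (inv s) x"
      have y: "?y \<in> carrier V" using x s closed by simp
      have "R (T t ?y) = x" using fun_cong[OF s(2), of ?y] x y s(1) by (simp add: compose_eq)
      then have "S x = T t ?y" using SR'[of "T t ?y"] y t closed by simp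
      then show "S x = T (t \<otimes> inv s) x" using x s t by (simp add: mult)
    qed (use extensional s t in simp)
    then show "S \<in> T ` carrier G" using s t by blast
  qed
qed

end

lemma (in locally_compact_group) continuous_map_mult [continuous_intros]:
  assumes "continuous_map X (topo G) f" "continuous_map X (topo G) g"
  shows "continuous_map X (topo G) (\<lambda>x. f x \<otimes> g x)"
proof -
  have "continuous_map X (topo G) ((\<lambda>(x, y). x \<otimes> y) \<circ> (\<lambda>x. (f x, g x)))"
    by (rule continuous_map_compose[OF _ continuous_mult]) (use assms in \<open>simp add: continuous_map_pairedI\<close>)
  then show ?thesis by (simp add: o_def)
qed

text \<open>An isomorphism maps units to units, but the preimage of a unit need not be one a priori, as
  products are not known to stay in the compactification. Instead, the units hit form the image of
  an open subgroup of \<open>H\<close>, which is dense and therefore meets all of its cosets.\<close>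

lemma top_isomorphic_of_compactifications:
  fixes G :: "('a, 'g) top_monoid_scheme" and H :: "('b, 'h) top_monoid_scheme"
  assumes "unitary_action G V T" "Hausdorff_space (topo G)" and sepG: "separating G V T"
    and "unitary_action H W S" "locally_compact_group H" and sepH: "separating H W S"
    and "top_isomorphic (rep_compactification G V T) (rep_compactification H W S)"
  shows "top_isomorphic G H"
proof -
  let ?M = "rep_compactification G V T" and ?N = "rep_compactification H W S"
  interpret A: unitary_action G V T by fact
  interpret B: unitary_action H W S by fact
  interpret H: locally_compact_group H by fact
  have topM: "topspace (topo ?M) = carrier ?M"
    by simp (metis A.V.topspace_weak_star Int_absorb1 closure_of_subset_topspace)
  obtain \<phi> where iso: "\<phi> \<in> iso ?M ?N" and homeo: "homeomorphic_map (topo ?M) (topo ?N) \<phi>"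
    using assms(7) unfolding top_isomorphic_def by blast
  have bij: "bij_betw \<phi> (carrier ?M) (carrier ?N)" and hom: "\<phi> \<in> hom ?M ?N"
    using iso by (auto simp: iso_def)
  have hom': "\<phi> (x \<otimes>\<^bsub>?M\<^esub> y) = \<phi> x \<otimes>\<^bsub>?N\<^esub> \<phi> y" if "x \<in> carrier ?M" "y \<in> carrier ?M" for x y
    using hom that by (rule hom_mult)
  note \<phi>_closed = bij_betwE[OF bij, rule_format]
  have \<phi>_surj: "\<exists>x. x \<in> carrier ?M \<and> \<phi> x = y" if "y \<in> carrier ?N" for y
    using that bij_betw_imp_surj_on[OF bij] by (metis imageE)
  have oneM: "\<one>\<^bsub>?M\<^esub> \<in> carrier ?M" using A.action_in_closure[of "\<one>\<^bsub>G\<^esub>"] by (simp flip: A.one_restrict)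
  have oneN: "\<one>\<^bsub>?N\<^esub> \<in> carrier ?N" using B.action_in_closure[of "\<one>\<^bsub>H\<^esub>"] by (simp flip: B.one_restrict)
  have neutral: "compose (carrier V) R (\<lambda>x\<in>carrier V. x) = R" "compose (carrier V) (\<lambda>x\<in>carrier V. x) R = R"
    if "R \<in> carrier ?M" for R
    using A.closure_bounded[of R] that unfolding bounded_operators_def
    by (auto intro!: extensionalityI[of _ "carrier V"] simp: compose_eq PiE_def)
  have neutralN: "compose (carrier W) R (\<lambda>x\<in>carrier W. x) = R" "compose (carrier W) (\<lambda>x\<in>carrier W. x) R = R"
    if "R \<in> carrier ?N" for R
    using B.closure_bounded[of R] that unfolding bounded_operators_def
    by (auto intro!: extensionalityI[of _ "carrier W"] simp: compose_eq PiE_def)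
  have \<phi>_one: "\<phi> \<one>\<^bsub>?M\<^esub> = \<one>\<^bsub>?N\<^esub>"
  proof -
    \<comment> \<open>A preimage \<open>e\<close> of the neutral element gives \<phi> 1 = (\<phi> 1)
      (\<phi> e) = \<phi> (1 e) = \<phi> e.\<close>
    obtain e where e: "e \<in> carrier ?M" "\<phi> e = \<one>\<^bsub>?N\<^esub>" using \<phi>_surj[OF oneN] by (elim exE conjE)
    have "\<phi> \<one>\<^bsub>?M\<^esub> \<in> carrier ?N" by (rule \<phi>_closed[OF oneM])
    then have "\<phi> \<one>\<^bsub>?M\<^esub> = \<phi> \<one>\<^bsub>?M\<^esub> \<otimes>\<^bsub>?N\<^esub> \<one>\<^bsub>?N\<^esub>" using neutralN by simp
    also have "\<dots> = \<phi> (\<one>\<^bsub>?M\<^esub> \<otimes>\<^bsub>?M\<^esub> e)" using hom'[OF oneM e(1)] e(2) by simp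
    also have "\<dots> = \<one>\<^bsub>?N\<^esub>" using neutral[OF e(1)] e(2) by simp
    finally show ?thesis .
  qed
  have "\<phi> ` Units ?M \<subseteq> Units ?N"
  proof clarify
    fix x assume "x \<in> Units ?M"
    then obtain y where y: "x \<in> carrier ?M" "y \<in> carrier ?M" "x \<otimes>\<^bsub>?M\<^esub> y = \<one>\<^bsub>?M\<^esub>" "y \<otimes>\<^bsub>?M\<^esub> x = \<one>\<^bsub>?M\<^esub>"
      unfolding Units_def by blast
    then have "\<phi> x \<otimes>\<^bsub>?N\<^esub> \<phi> y = \<one>\<^bsub>?N\<^esub>" "\<phi> y \<otimes>\<^bsub>?N\<^esub> \<phi> x = \<one>\<^bsub>?N\<^esub>"
      using hom'[OF y(1,2)] hom'[OF y(2,1)] \<phi>_one by (simp_all only:)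
    moreover have "\<phi> x \<in> carrier ?N" "\<phi> y \<in> carrier ?N" using y by (simp_all only: \<phi>_closed)
    ultimately show "\<phi> x \<in> Units ?N" unfolding Units_def by blast
  qed
  then have sub: "\<phi> ` T ` carrier G \<subseteq> S ` carrier H"
    by (simp add: A.Units_compactification[OF sepG] B.Units_compactification[OF sepH])
  have embT: "embedding_map (topo G) (topo ?M) T"
    by (rule A.embedding_action[OF sepG assms(2)])
  have embS: "embedding_map (topo H) (topo ?N) S"
    by (rule B.embedding_action[OF sepH H.Hausdorff])
  have contS: "continuous_map (topo H) (topo ?N) S"
    using embS homeomorphic_imp_continuous_map continuous_map_into_fulltopology
    unfolding embedding_map_def by metis
  have openN: "openin (topo ?N) (\<phi> ` T ` carrier G)"
  proof -
    have "openin (topo ?M) (T ` carrier G)"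
      using A.open_image[OF sepG openin_topspace] by (simp add: A.topspace)
    then show ?thesis
      using homeo homeomorphic_map_openness_eq[OF homeo] by blast
  qed
  have S_mult: "S (h \<otimes>\<^bsub>H\<^esub> k) = S h \<otimes>\<^bsub>?N\<^esub> S k" if "h \<in> carrier H" "k \<in> carrier H" for h k
    using B.mult_compose[OF that] by simp
  have T_mult: "T (s \<otimes>\<^bsub>G\<^esub> t) = T s \<otimes>\<^bsub>?M\<^esub> T t" if "s \<in> carrier G" "t \<in> carrier G" for s t
    using A.mult_compose[OF that] by simp
  have injS: "inj_on S (carrier H)" by (rule B.inj_action[OF sepH H.Hausdorff])
  have surj: "\<phi> ` T ` carrier G = S ` carrier H"
  proof
    show "S ` carrier H \<subseteq> \<phi> ` T ` carrier G"
    proof clarify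
      fix h assume h: "h \<in> carrier H"
      \<comment> \<open>The left coset by \<open>h\<close> of the subgroup of all elements of
        \<open>H\<close> hit from \<open>G\<close>; it is open because the set of hit operators is
        open.\<close>
      define L where "L = {k \<in> topspace (topo H). S (inv\<^bsub>H\<^esub> h \<otimes>\<^bsub>H\<^esub> k) \<in> \<phi> ` T ` carrier G}"
      have "continuous_map (topo H) (topo H) (\<lambda>k. inv\<^bsub>H\<^esub> h \<otimes>\<^bsub>H\<^esub> k)"
        using h by (intro H.continuous_map_mult) (auto simp: H.topspace_topo)
      then have "continuous_map (topo H) (topo ?N) (\<lambda>k. S (inv\<^bsub>H\<^esub> h \<otimes>\<^bsub>H\<^esub> k))"
        using continuous_map_compose[OF _ contS] by (simp only: o_def)
      then have "openin (topo H) L"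
        unfolding L_def using openN by (rule openin_continuous_map_preimage)
      then have SL: "openin (topo ?N) (S ` L)"
        using B.open_image[OF sepH] by simp
      have "S \<one>\<^bsub>H\<^esub> \<in> \<phi> ` T ` carrier G"
      proof -
        have "\<phi> (T \<one>\<^bsub>G\<^esub>) = S \<one>\<^bsub>H\<^esub>" using \<phi>_one by (simp add: A.one_restrict B.one_restrict)
        then show ?thesis by force
      qed
      then have hL: "h \<in> L" using h by (simp add: L_def H.topspace_topo B.G.l_inv)
      \<comment> \<open>This open set contains the preimage of \<open>S h\<close>. The image of
        \<open>G\<close> is dense, so some \<open>T t\<close> lies in it, which says that the coset
        \<open>L\<close> contains an element \<open>k\<close> hit from \<open>G\<close>.\<close>
      have "openin (topo ?M) {x \<in> topspace (topo ?M). \<phi> x \<in> S ` L}"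
        using homeomorphic_imp_continuous_map[OF homeo] SL by (rule openin_continuous_map_preimage)
      then obtain Q where Q: "openin (weak_star_topology V) Q" "{x \<in> topspace (topo ?M). \<phi> x \<in> S ` L} = Q \<inter> carrier ?M"
        by (auto simp: openin_subtopology)
      have ShN: "S h \<in> carrier ?N" using B.action_in_closure[OF h] by simp
      obtain x where x: "x \<in> carrier ?M" "\<phi> x = S h"
        using \<phi>_surj[OF ShN] by (elim exE conjE)
      then have "x \<in> Q" using Q(2) hL topM by blast
      then obtain t where t: "t \<in> carrier G" "T t \<in> Q"
        using x(1) Q(1) by (auto simp: in_closure_of)
      then have "T t \<in> Q \<inter> carrier ?M" using A.action_in_closure by simp
      then obtain k where k: "k \<in> L" "\<phi> (T t) = S k" using Q(2) by (metis (no_types, lifting) imageE mem_Collect_eq)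
      then have kH: "k \<in> carrier H" by (simp add: L_def H.topspace_topo)
      obtain s where s: "s \<in> carrier G" "S (inv\<^bsub>H\<^esub> h \<otimes>\<^bsub>H\<^esub> k) = \<phi> (T s)"
        using k(1) unfolding L_def by (elim CollectE conjE imageE) simp
      \<comment> \<open>Both \<open>k\<close> and \<open>inv h\<close> times \<open>k\<close> are
        hit, by \<open>t\<close> and \<open>s\<close>. Their quotient, which is \<open>h\<close>,
        should be hit by the quotient of \<open>t\<close> and \<open>s\<close>; injectivity of
        \<open>S\<close> identifies \<open>h'\<close> with \<open>h\<close>.\<close>
      obtain h' where h': "h' \<in> carrier H" "\<phi> (T (t \<otimes>\<^bsub>G\<^esub> inv\<^bsub>G\<^esub> s)) = S h'"
      proof -
        have "\<phi> (T (t \<otimes>\<^bsub>G\<^esub> inv\<^bsub>G\<^esub> s)) \<in> S ` carrier H"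
          using s(1) t(1) by (intro subsetD[OF sub] imageI) simp
        then show ?thesis using that by (elim imageE)
      qed
      have "S (h' \<otimes>\<^bsub>H\<^esub> (inv\<^bsub>H\<^esub> h \<otimes>\<^bsub>H\<^esub> k)) = \<phi> (T (t \<otimes>\<^bsub>G\<^esub> inv\<^bsub>G\<^esub> s)) \<otimes>\<^bsub>?N\<^esub> \<phi> (T s)"
        using h' s h kH by (subst S_mult) auto
      also have "\<dots> = \<phi> (T (t \<otimes>\<^bsub>G\<^esub> inv\<^bsub>G\<^esub> s) \<otimes>\<^bsub>?M\<^esub> T s)"
        using s t by (subst hom') (auto intro: A.action_in_closure)
      also have "\<dots> = \<phi> (T t)"
        using s t by (subst T_mult[symmetric]) (auto simp: A.G.m_assoc)
      finally have "S (h' \<otimes>\<^bsub>H\<^esub> (inv\<^bsub>H\<^esub> h \<otimes>\<^bsub>H\<^esub> k)) = S k" using k by simp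
      then have "h' \<otimes>\<^bsub>H\<^esub> (inv\<^bsub>H\<^esub> h \<otimes>\<^bsub>H\<^esub> k) = k"
        using injS h' h kH by (auto dest: inj_onD)
      then have "h' \<otimes>\<^bsub>H\<^esub> inv\<^bsub>H\<^esub> h = \<one>\<^bsub>H\<^esub>"
        using h h' kH by (metis B.G.inv_closed B.G.m_assoc B.G.m_closed B.G.r_cancel_one)
      then have "h' = h" using h h' by (metis B.G.inv_closed B.G.inv_equality B.G.inv_inv)
      then show "S h \<in> \<phi> ` T ` carrier G" using h' s t by (metis A.G.inv_closed A.G.m_closed image_eqI)
    qed
  qed (rule sub)
  have homT: "homeomorphic_map (topo G) (subtopology (topo ?M) (T ` carrier G)) T"
    using embT by (simp add: embedding_map_def A.topspace)
  have homS: "homeomorphic_map (topo H) (subtopology (topo ?N) (S ` carrier H)) S"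
    using embS by (simp add: embedding_map_def B.topspace)
  have hom\<phi>: "homeomorphic_map (subtopology (topo ?M) (T ` carrier G)) (subtopology (topo ?N) (S ` carrier H)) \<phi>"
  proof (rule homeomorphic_map_subtopologies_alt[OF homeo])
    fix x assume x: "x \<in> topspace (topo ?M)" "\<phi> x \<in> topspace (topo ?N)"
    have TM: "T ` carrier G \<subseteq> carrier ?M" using A.action_in_closure by auto
    show "\<phi> x \<in> S ` carrier H \<longleftrightarrow> x \<in> T ` carrier G"
      unfolding surj[symmetric] using x(1) TM bij unfolding topM bij_betw_def inj_on_def by blast
  qed
  obtain g where g: "homeomorphic_maps (topo H) (subtopology (topo ?N) (S ` carrier H)) S g"
    using homS by (auto simp: homeomorphic_map_maps)
  then have homg: "homeomorphic_map (subtopology (topo ?N) (S ` carrier H)) (topo H) g"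
    by (rule homeomorphic_maps_imp_map[OF homeomorphic_maps_sym[THEN iffD1]])
  define \<psi> where "\<psi> = g \<circ> (\<phi> \<circ> T)"
  have hom\<psi>: "homeomorphic_map (topo G) (topo H) \<psi>"
    unfolding \<psi>_def by (rule homeomorphic_map_compose[OF homeomorphic_map_compose[OF homT hom\<phi>] homg])
  have \<psi>_closed: "\<psi> s \<in> carrier H" if "s \<in> carrier G" for s
    using homeomorphic_imp_surjective_map[OF hom\<psi>] that by (auto simp: A.topspace B.topspace)
  have gS: "g (S h) = h" if "h \<in> carrier H" for h
    using g that by (simp add: homeomorphic_maps_def B.topspace)
  have S\<psi>: "S (\<psi> s) = \<phi> (T s)" if s: "s \<in> carrier G" for s
  proof -
    obtain h where "h \<in> carrier H" "\<phi> (T s) = S h" using sub s by blast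
    then show ?thesis by (simp add: \<psi>_def gS)
  qed
  have "\<psi> (s \<otimes>\<^bsub>G\<^esub> t) = \<psi> s \<otimes>\<^bsub>H\<^esub> \<psi> t" if s: "s \<in> carrier G" and t: "t \<in> carrier G" for s t
  proof (rule inj_onD[OF injS])
    have "S (\<psi> (s \<otimes>\<^bsub>G\<^esub> t)) = \<phi> (T s \<otimes>\<^bsub>?M\<^esub> T t)" using s t by (simp only: S\<psi> A.G.m_closed T_mult)
    also have "\<dots> = \<phi> (T s) \<otimes>\<^bsub>?N\<^esub> \<phi> (T t)" using s t by (intro hom') (auto intro: A.action_in_closure)
    also have "\<dots> = S (\<psi> s \<otimes>\<^bsub>H\<^esub> \<psi> t)" using s t by (simp only: S\<psi> S_mult \<psi>_closed)
    finally show "S (\<psi> (s \<otimes>\<^bsub>G\<^esub> t)) = S (\<psi> s \<otimes>\<^bsub>H\<^esub> \<psi> t)" .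
  qed (use s t \<psi>_closed in auto)
  then have "\<psi> \<in> iso G H"
    using \<psi>_closed homeomorphic_imp_injective_map[OF hom\<psi>] homeomorphic_imp_surjective_map[OF hom\<psi>]
    by (auto simp: iso_def hom_def bij_betw_def A.topspace B.topspace)
  then show ?thesis using hom\<psi> unfolding top_isomorphic_def by blast
qed

section \<open>Locally compact groups\<close>

context locally_compact_group
begin

lemma continuous_map_inverse [continuous_intros]:
  "continuous_map X (topo G) f \<Longrightarrow> continuous_map X (topo G) (\<lambda>x. inv (f x))"
  using continuous_map_compose[OF _ continuous_inv, of X f] by (simp add: o_def)

lemma continuous_map_translate: "s \<in> carrier G \<Longrightarrow> continuous_map (topo G) (topo G) (\<lambda>t. s \<otimes> t)"
  by (intro continuous_map_mult) (auto simp: topspace_topo)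

lemma l_coset_eq:
  assumes "s \<in> carrier G" "A \<subseteq> carrier G"
  shows "s <# A = {t \<in> carrier G. inv s \<otimes> t \<in> A}"
proof
  show "s <# A \<subseteq> {t \<in> carrier G. inv s \<otimes> t \<in> A}"
    using assms by (auto simp: l_coset_def m_assoc[symmetric] subset_iff)
  show "{t \<in> carrier G. inv s \<otimes> t \<in> A} \<subseteq> s <# A"
  proof clarify
    fix t assume t: "t \<in> carrier G" "inv s \<otimes> t \<in> A"
    then have "t = s \<otimes> (inv s \<otimes> t)" using assms by (simp add: m_assoc[symmetric])
    then show "t \<in> s <# A" using t(2) unfolding l_coset_def by blast
  qed
qed

lemma openin_l_coset:
  assumes "s \<in> carrier G" "openin (topo G) U"
  shows "openin (topo G) (s <# U)"
proof -
  have "openin (topo G) {t \<in> topspace (topo G). inv s \<otimes> t \<in> U}"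
    using assms by (intro openin_continuous_map_preimage[OF continuous_map_translate]) auto
  then show ?thesis
    using assms openin_subset[OF assms(2)] by (simp add: l_coset_eq topspace_topo)
qed

lemma compact_neighbourhood:
  assumes "openin (topo G) U" "s \<in> U"
  shows "\<exists>N A. openin (topo G) N \<and> compactin (topo G) A \<and> s \<in> N \<and> N \<subseteq> A \<and> A \<subseteq> U"
  using locally_compact_space_neighbourhood_base[of "topo G"] Hausdorff locally_compact assms
  unfolding neighbourhood_base_of by blast

text \<open>Continuity of (x, y) \<mapsto> s x y^-1 at the identity, with \<open>K\<close> the image
  of A \<times> A. The set \<open>K\<close> controls supports: if the translates of \<open>A\<close>
  by \<open>s\<close> and \<open>t\<close> meet, then \<open>t\<close> lies in s A A^-1, hence in
  \<open>K\<close>.\<close>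

lemma compact_quotient_neighbourhood:
  assumes U: "openin (topo G) U" and s: "s \<in> U"
  shows "\<exists>N A K. openin (topo G) N \<and> \<one> \<in> N \<and> N \<subseteq> A \<and> compactin (topo G) A \<and> compactin (topo G) K \<and> K \<subseteq> U \<and>
    (\<forall>x\<in>A. \<forall>y\<in>A. s \<otimes> x \<otimes> inv y \<in> K)"
proof -
  have sG: "s \<in> carrier G" using openin_subset[OF U] s by (auto simp: topspace_topo)
  let ?q = "\<lambda>p. s \<otimes> fst p \<otimes> inv (snd p)"
  have q: "continuous_map (prod_topology (topo G) (topo G)) (topo G) ?q"
    using sG by (intro continuous_intros) (auto simp: topspace_topo)
  have "openin (prod_topology (topo G) (topo G)) {p \<in> topspace (prod_topology (topo G) (topo G)). ?q p \<in> U}"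
    by (rule openin_continuous_map_preimage[OF q U])
  moreover have "(\<one>, \<one>) \<in> {p \<in> topspace (prod_topology (topo G) (topo G)). ?q p \<in> U}"
    using sG s by (simp add: topspace_topo)
  ultimately obtain B C where BC: "openin (topo G) B" "openin (topo G) C" "\<one> \<in> B" "\<one> \<in> C"
    "B \<times> C \<subseteq> {p \<in> topspace (prod_topology (topo G) (topo G)). ?q p \<in> U}"
    unfolding openin_prod_topology_alt by (smt (verit))
  then obtain N A where NA: "openin (topo G) N" "compactin (topo G) A" "\<one> \<in> N" "N \<subseteq> A" "A \<subseteq> B \<inter> C"
    using compact_neighbourhood[of "B \<inter> C" \<one>] by blast
  define K where "K = ?q ` (A \<times> A)"
  have "compactin (topo G) K"
    unfolding K_def by (rule image_compactin[OF _ q]) (simp add: compactin_Times NA)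
  moreover have "K \<subseteq> U" using NA(5) BC(5) unfolding K_def by blast
  moreover have "\<forall>x\<in>A. \<forall>y\<in>A. s \<otimes> x \<otimes> inv y \<in> K" unfolding K_def by force
  ultimately show ?thesis using NA by blast
qed

end

section \<open>The left regular representation\<close>

lemma borel_measurable_cnj [measurable (raw)]:
  "f \<in> borel_measurable M \<Longrightarrow> (\<lambda>t. cnj (f t)) \<in> borel_measurable M"
  by (rule borel_measurable_continuous_on[of cnj]) (auto intro: continuous_intros)

lemma integrable_mult_cnj:
  fixes f g :: "'a \<Rightarrow> complex"
  assumes [measurable]: "f \<in> borel_measurable M" "g \<in> borel_measurable M"
    and "integrable M (\<lambda>t. (cmod (f t))\<^sup>2)" "integrable M (\<lambda>t. (cmod (g t))\<^sup>2)"
  shows "integrable M (\<lambda>t. f t * cnj (g t))"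
proof (rule Bochner_Integration.integrable_bound)
  show "integrable M (\<lambda>t. (cmod (f t))\<^sup>2 + (cmod (g t))\<^sup>2)" using assms(3,4) by simp
  have "cmod (f t) * cmod (g t) \<le> (cmod (f t))\<^sup>2 + (cmod (g t))\<^sup>2" for t
  proof -
    have "2 * (cmod (f t) * cmod (g t)) \<le> (cmod (f t))\<^sup>2 + (cmod (g t))\<^sup>2"
      using sum_squares_bound[of "cmod (f t)" "cmod (g t)"] by simp
    moreover have "0 \<le> cmod (f t) * cmod (g t)" by simp
    ultimately show ?thesis by linarith
  qed
  then show "AE t in M. norm (f t * cnj (g t)) \<le> norm ((cmod (f t))\<^sup>2 + (cmod (g t))\<^sup>2)"
    by (simp add: norm_mult)
  show "(\<lambda>t. f t * cnj (g t)) \<in> borel_measurable M" by (intro borel_measurable_times) (auto intro: borel_measurable_cnj)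
qed

lemma semi_ip_square_integrable_space: "semi_ip_space (square_integrable_space \<mu>)"
proof -
  let ?L = "square_integrable_space \<mu>"
  have carrier: "f \<in> carrier ?L \<longleftrightarrow> f \<in> borel_measurable \<mu> \<and> integrable \<mu> (\<lambda>t. (cmod (f t))\<^sup>2)" for f
    by (simp add: square_integrable_space_def)
  have ip: "ip ?L f g = (\<integral>t. f t * cnj (g t) \<partial>\<mu>)" for f g by (simp add: square_integrable_space_def)
  have add: "f \<oplus>\<^bsub>?L\<^esub> g = (\<lambda>t. f t + g t)" for f g by (simp add: square_integrable_space_def)
  have smult: "c \<odot>\<^bsub>?L\<^esub> f = (\<lambda>t. c * f t)" for c f by (simp add: square_integrable_space_def)
  have zero: "\<zero>\<^bsub>?L\<^esub> = (\<lambda>t. 0)" by (simp add: square_integrable_space_def)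
  have int: "integrable \<mu> (\<lambda>t. f t * cnj (g t))" if "f \<in> carrier ?L" "g \<in> carrier ?L" for f g
    using that by (intro integrable_mult_cnj) (auto simp: carrier)
  show ?thesis
  proof (rule semi_ip_spaceI)
    fix f g assume f: "f \<in> carrier ?L" and g: "g \<in> carrier ?L"
    have [measurable]: "f \<in> borel_measurable \<mu>" "g \<in> borel_measurable \<mu>" using f g by (auto simp: carrier)
    have "integrable \<mu> (\<lambda>t. (cmod (f t + g t))\<^sup>2)"
    proof (rule Bochner_Integration.integrable_bound)
      show "integrable \<mu> (\<lambda>t. 2 * (cmod (f t))\<^sup>2 + 2 * (cmod (g t))\<^sup>2)" using f g by (simp add: carrier)
      have "(cmod (f t + g t))\<^sup>2 \<le> 2 * (cmod (f t))\<^sup>2 + 2 * (cmod (g t))\<^sup>2" for t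
      proof -
        have "(cmod (f t + g t))\<^sup>2 \<le> (cmod (f t) + cmod (g t))\<^sup>2" by (intro power_mono norm_triangle_ineq) auto
        also have "\<dots> \<le> 2 * (cmod (f t))\<^sup>2 + 2 * (cmod (g t))\<^sup>2"
          using sum_squares_bound[of "cmod (f t)" "cmod (g t)"] by (simp add: power2_sum)
        finally show ?thesis .
      qed
      then show "AE t in \<mu>. norm ((cmod (f t + g t))\<^sup>2) \<le> norm (2 * (cmod (f t))\<^sup>2 + 2 * (cmod (g t))\<^sup>2)"
        by simp
      show "(\<lambda>t. (cmod (f t + g t))\<^sup>2) \<in> borel_measurable \<mu>" by measurable
    qed
    then show "f \<oplus>\<^bsub>?L\<^esub> g \<in> carrier ?L" using f g by (simp add: carrier add)
    show "f \<oplus>\<^bsub>?L\<^esub> g = g \<oplus>\<^bsub>?L\<^esub> f" by (simp add: add add.commute)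
    show "ip ?L g f = cnj (ip ?L f g)"
      unfolding ip Bochner_Integration.integral_cnj[symmetric] by (simp add: mult.commute)
    show "ip ?L (c \<odot>\<^bsub>?L\<^esub> f) g = c * ip ?L f g" for c
      unfolding ip smult by (simp add: mult.assoc)
    show "ip ?L f f \<in> \<real>\<^sub>\<ge>\<^sub>0"
    proof -
      have "ip ?L f f = of_real (\<integral>t. (cmod (f t))\<^sup>2 \<partial>\<mu>)"
        unfolding ip by (simp flip: complex_norm_square integral_complex_of_real)
      then show ?thesis by (simp add: integral_nonneg_AE del: of_real_power)
    qed
    show "c \<odot>\<^bsub>?L\<^esub> f \<in> carrier ?L" for c
      using f by (simp add: carrier smult norm_mult power_mult_distrib)
    show "ip ?L (f \<oplus>\<^bsub>?L\<^esub> g) h = ip ?L f h + ip ?L g h" if "h \<in> carrier ?L" for h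
      unfolding ip add using int[OF f that] int[OF g that] by (simp add: ring_distribs)
  qed (auto simp: carrier add smult zero algebra_simps)
qed

section \<open>Haar measure and the coefficients of left translation\<close>

locale haar_measure = locally_compact_group G for G :: "'a top_monoid" (structure) +
  fixes \<mu> :: "'a measure"
  assumes haar: "left_haar_measure G \<mu>"
begin

abbreviation "L2 \<equiv> square_integrable_space \<mu>"

lemma space_haar: "space \<mu> = carrier G"
  and sets_haar: "sets \<mu> = sigma_sets (carrier G) {U. openin (topo G) U}"
  and haar_nonzero: "emeasure \<mu> (carrier G) \<noteq> 0"
  and haar_finite: "compactin (topo G) K \<Longrightarrow> emeasure \<mu> K < \<infinity>"
  and haar_inner: "openin (topo G) U \<Longrightarrow>
      emeasure \<mu> U = (SUP K\<in>{K. compactin (topo G) K \<and> K \<subseteq> U}. emeasure \<mu> K)"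
  and haar_invariant: "\<lbrakk>s \<in> carrier G; A \<in> sets \<mu>\<rbrakk> \<Longrightarrow> emeasure \<mu> (s <# A) = emeasure \<mu> A"
  using haar unfolding left_haar_measure_def by auto

lemma sets_open: "openin (topo G) U \<Longrightarrow> U \<in> sets \<mu>"
  by (simp add: sets_haar sigma_sets.Basic)

lemma sets_compact: "compactin (topo G) K \<Longrightarrow> K \<in> sets \<mu>"
proof -
  assume K: "compactin (topo G) K"
  then have "openin (topo G) (carrier G - K)"
    using compactin_imp_closedin[OF Hausdorff K] by (metis closedin_def topspace_topo)
  then have "space \<mu> - (carrier G - K) \<in> sets \<mu>" using sets_open by blast
  moreover have "space \<mu> - (carrier G - K) = K"
    using compactin_subset_topspace[OF K] by (auto simp: space_haar topspace_topo)
  ultimately show "K \<in> sets \<mu>" by simp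
qed

lemma measurable_translate: "s \<in> carrier G \<Longrightarrow> (\<lambda>t. s \<otimes> t) \<in> measurable \<mu> \<mu>"
proof (rule measurable_sigma_sets[OF sets_haar])
  assume s: "s \<in> carrier G"
  show "{U. openin (topo G) U} \<subseteq> Pow (carrier G)"
    using openin_subset[of "topo G"] by (auto simp: topspace_topo)
  show "(\<lambda>t. s \<otimes> t) -` U \<inter> space \<mu> \<in> sets \<mu>" if "U \<in> {U. openin (topo G) U}" for U
  proof -
    have "openin (topo G) {t \<in> topspace (topo G). s \<otimes> t \<in> U}"
      using that s by (intro openin_continuous_map_preimage[OF continuous_map_translate]) auto
    moreover have "(\<lambda>t. s \<otimes> t) -` U \<inter> space \<mu> = {t \<in> topspace (topo G). s \<otimes> t \<in> U}"
      by (auto simp: space_haar topspace_topo)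
    ultimately show ?thesis using sets_open by simp
  qed
qed (auto simp: space_haar)

text \<open>Invariance as an equality of image measures, the form in which integrals are
  substituted.\<close>

lemma distr_translate: "s \<in> carrier G \<Longrightarrow> distr \<mu> \<mu> (\<lambda>t. inv s \<otimes> t) = \<mu>"
proof (rule measure_eqI)
  fix A assume s: "s \<in> carrier G" and A: "A \<in> sets (distr \<mu> \<mu> (\<lambda>t. inv s \<otimes> t))"
  then have A: "A \<in> sets \<mu>" by simp
  then have "A \<subseteq> carrier G" using sets.sets_into_space[OF A] by (simp add: space_haar)
  then have "(\<lambda>t. inv s \<otimes> t) -` A \<inter> space \<mu> = s <# A"
    using s by (auto simp: space_haar l_coset_eq)
  then show "emeasure (distr \<mu> \<mu> (\<lambda>t. inv s \<otimes> t)) A = emeasure \<mu> A"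
    using s A by (simp add: emeasure_distr measurable_translate haar_invariant)
qed simp

lemma left_translate_square_integrable:
  assumes s: "s \<in> carrier G" and f: "f \<in> carrier L2"
  shows "left_translate G s f \<in> carrier L2"
proof -
  have fm: "f \<in> borel_measurable \<mu>" and fi: "integrable \<mu> (\<lambda>t. (cmod (f t))\<^sup>2)"
    using f by (auto simp: square_integrable_space_def)
  have m: "(\<lambda>t. f (inv s \<otimes> t)) \<in> borel_measurable \<mu>"
    using measurable_compose[OF measurable_translate fm] s by simp
  have "integrable (distr \<mu> \<mu> (\<lambda>t. inv s \<otimes> t)) (\<lambda>t. (cmod (f t))\<^sup>2)"
    using s fi by (simp add: distr_translate)
  then have i: "integrable \<mu> (\<lambda>t. (cmod (f (inv s \<otimes> t)))\<^sup>2)"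
    using s fm by (subst (asm) integrable_distr_eq) (auto intro: measurable_translate)
  have eq: "left_translate G s f t = f (inv s \<otimes> t)" if "t \<in> space \<mu>" for t
    using that by (simp add: left_translate_def space_haar)
  show ?thesis
    using m i by (simp add: square_integrable_space_def eq cong: measurable_cong Bochner_Integration.integrable_cong)
qed

lemma left_translate_isometry:
  assumes s: "s \<in> carrier G" and f: "f \<in> carrier L2" and g: "g \<in> carrier L2"
  shows "ip L2 (left_translate G s f) (left_translate G s g) = ip L2 f g"
proof -
  have m: "(\<lambda>t. f t * cnj (g t)) \<in> borel_measurable \<mu>"
    using f g by (intro borel_measurable_times) (auto simp: square_integrable_space_def intro: borel_measurable_cnj)
  have "ip L2 (left_translate G s f) (left_translate G s g) = (\<integral>t. f (inv s \<otimes> t) * cnj (g (inv s \<otimes> t)) \<partial>\<mu>)"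
    unfolding square_integrable_space_def
    by (auto simp: left_translate_def space_haar intro!: Bochner_Integration.integral_cong)
  also have "\<dots> = (\<integral>t. f t * cnj (g t) \<partial>distr \<mu> \<mu> (\<lambda>t. inv s \<otimes> t))"
    using s m by (subst integral_distr) (auto intro: measurable_translate)
  also have "\<dots> = ip L2 f g" using s by (simp add: distr_translate square_integrable_space_def)
  finally show ?thesis .
qed

text \<open>Translation is isometric and therefore respects null classes, so the representative
  chosen in the definition may be replaced by \<open>f\<close>.\<close>

lemma left_regular_coefficient:
  assumes s: "s \<in> carrier G" and f: "f \<in> carrier L2" and g: "g \<in> carrier L2"
  shows "ip (L2_space \<mu>) (left_regular_rep G \<mu> s (null_class L2 f)) (null_class L2 g)
    = ip L2 (left_translate G s f) g"
proof -
  interpret L: semi_ip_space L2 by (rule semi_ip_square_integrable_space)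
  let ?r = "class_rep (null_class L2 f)"
  have r: "?r \<in> carrier L2" by (rule L.class_rep_closed[OF f])
  have "null_class L2 (left_translate G s ?r) = null_class L2 (left_translate G s f)"
    by (rule null_class_isometry[where f = "left_translate G s"])
      (use s f r in \<open>auto simp: left_translate_square_integrable left_translate_isometry L.semi_ip_space_axioms
         L.null_class_class_rep L.carrier_separation\<close>)
  then show ?thesis
    using s f g by (simp add: left_regular_rep_def separation_map_def L2_space_def L.carrier_separation
        L.ip_separation left_translate_square_integrable)
qed

text \<open>If \<open>N\<close> were null, every compact set would be covered by finitely many null
  translates of \<open>N\<close>, and inner regularity would make the whole group null.\<close>

lemma open_positive:
  assumes N: "openin (topo G) N" "\<one> \<in> N"
  shows "emeasure \<mu> N \<noteq> 0"
proof
  assume 0: "emeasure \<mu> N = 0"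
  have NG: "N \<subseteq> carrier G" using openin_subset[OF N(1)] by (simp add: topspace_topo)
  have "emeasure \<mu> K = 0" if K: "compactin (topo G) K" for K
  proof -
    have KG: "K \<subseteq> carrier G" using compactin_subset_topspace[OF K] by (simp add: topspace_topo)
    have "K \<subseteq> \<Union> ((\<lambda>k. k <# N) ` K)"
    proof
      fix k assume "k \<in> K"
      then have "k \<in> k <# N" using N(2) KG NG by (auto simp: l_coset_eq l_inv)
      then show "k \<in> \<Union> ((\<lambda>k. k <# N) ` K)" using \<open>k \<in> K\<close> by blast
    qed
    moreover have "openin (topo G) F" if "F \<in> (\<lambda>k. k <# N) ` K" for F
      using that KG openin_l_coset[OF _ N(1)] by auto
    ultimately obtain \<F> where \<F>: "finite \<F>" "\<F> \<subseteq> (\<lambda>k. k <# N) ` K" "K \<subseteq> \<Union>\<F>"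
      using compactinD[OF K] by metis
    have "F \<in> null_sets \<mu>" if F: "F \<in> \<F>" for F
    proof -
      obtain k where k: "k \<in> carrier G" "F = k <# N"
        using subsetD[OF \<F>(2) F] subsetD[OF KG] by (metis imageE)
      then show ?thesis
        using haar_invariant[OF k(1) sets_open[OF N(1)]] 0 sets_open[OF openin_l_coset[OF k(1) N(1)]] by auto
    qed
    then have "\<Union>\<F> \<in> null_sets \<mu>" using \<F>(1) by (intro null_sets.finite_Union) auto
    then have "K \<in> null_sets \<mu>" by (rule null_sets_subset[OF _ sets_compact[OF K] \<F>(3)])
    then show ?thesis by auto
  qed
  then have "emeasure \<mu> (carrier G) = 0"
    using haar_inner[OF openin_topspace] by (auto simp: topspace_topo intro!: antisym SUP_least)
  then show False using haar_nonzero by simp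
qed

end

text \<open>\<open>f\<close> is the generator with zero second component, and it approximates
  itself.\<close>

lemma coefficient_in_eberlein:
  assumes f: "f \<in> coefficient_space G V \<pi>"
  shows "f \<in> eberlein_algebra G V \<pi>"
proof -
  have ext: "f \<in> extensional (carrier G)" using f by (auto simp: coefficient_space_def)
  have "(\<lambda>s\<in>carrier G. 0) \<in> coefficient_space G V \<pi>"
    unfolding coefficient_space_def by (intro CollectI exI[of _ "0::nat"]) auto
  moreover have "f = (\<lambda>s\<in>carrier G. f s + cnj ((\<lambda>s\<in>carrier G. 0) s))"
    using ext by (intro extensionalityI[of _ "carrier G"]) auto
  ultimately have "f \<in> generated_function_algebra (carrier G) {\<lambda>s\<in>carrier G. f s + cnj (g s) | f g.
        f \<in> coefficient_space G V \<pi> \<and> g \<in> coefficient_space G V \<pi>}"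
    using f by (intro generated_function_algebra.gen) blast
  then show ?thesis
    using ext by (auto simp: eberlein_algebra_def uniform_closure_def intro!: bexI[of _ f])
qed

lemma single_coefficient:
  assumes "\<xi> \<in> carrier V" "\<eta> \<in> carrier V"
  shows "(\<lambda>s\<in>carrier G. ip V (\<pi> s \<xi>) \<eta>) \<in> coefficient_space G V \<pi>"
  unfolding coefficient_space_def using assms
  by (intro CollectI exI[of _ "1::nat"] exI[of _ "\<lambda>_. 1"] exI[of _ "\<lambda>_. \<xi>"] exI[of _ "\<lambda>_. \<eta>"]) auto

text \<open>The coefficient \<open>t \<mapsto> \<mu> (t A \<inter> s A)\<close> of the indicator functions of \<open>A\<close> and \<open>s A\<close> is
  supported in \<open>s A A\<^sup>-\<^sup>1\<close>.\<close>

lemma (in haar_measure) separating_of_eberlein_contained: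
  assumes cont: "eberlein_contained G (L2_space \<mu>) (left_regular_rep G \<mu>) V \<pi>"
  shows "separating G V \<pi>"
  unfolding separating_def
proof (intro allI impI, elim conjE)
  fix s U assume U: "openin (topo G) U" and sU: "s \<in> U"
  have s: "s \<in> carrier G" using openin_subset[OF U] sU by (auto simp: topspace_topo)
  obtain N A K where N: "openin (topo G) N" "\<one> \<in> N" "N \<subseteq> A" and A: "compactin (topo G) A"
    and K: "compactin (topo G) K" "K \<subseteq> U" and AK: "\<forall>x\<in>A. \<forall>y\<in>A. s \<otimes> x \<otimes> inv y \<in> K"
    using compact_quotient_neighbourhood[OF U sU] by blast
  interpret L: semi_ip_space L2 by (rule semi_ip_square_integrable_space)
  have AG: "A \<subseteq> carrier G" using compactin_subset_topspace[OF A] by (simp add: topspace_topo)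
  \<comment> \<open>\<open>a\<close> is the indicator of \<open>A\<close> and \<open>b\<close> below
    that of its translate by \<open>s\<close>; both are square integrable because \<open>A\<close>
    is compact.\<close>
  define a :: "'a \<Rightarrow> complex" where "a = indicator A"
  have "(\<lambda>t. (cmod (a t))\<^sup>2) = indicat_real A" by (auto simp: a_def indicator_def)
  then have a: "a \<in> carrier L2"
    using sets_compact[OF A] haar_finite[OF A] by (simp add: square_integrable_space_def a_def)
  define b where "b = left_translate G s a"
  have b: "b \<in> carrier L2" unfolding b_def by (rule left_translate_square_integrable[OF s a])
  define f where "f = (\<lambda>t\<in>carrier G. ip (L2_space \<mu>) (left_regular_rep G \<mu> t (null_class L2 a)) (null_class L2 b))"
  have feq: "f t = ip L2 (left_translate G t a) b" if "t \<in> carrier G" for t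
    using that a b by (simp add: f_def left_regular_coefficient)
  have "f \<in> coefficient_space G (L2_space \<mu>) (left_regular_rep G \<mu>)"
    unfolding f_def using a b by (intro single_coefficient) (auto simp: L2_space_def L.carrier_separation)
  then have "f \<in> eberlein_algebra G V \<pi>" using cont unfolding eberlein_contained_def by blast
  moreover have "f s \<noteq> 0"
  proof -
    \<comment> \<open>At \<open>s\<close> both vectors are the translate \<open>b\<close>, and
      translation is isometric.\<close>
    have "f s = ip L2 a a" using s a by (simp add: feq b_def left_translate_isometry)
    also have "\<dots> = (\<integral>t. a t * cnj (a t) \<partial>\<mu>)" by (simp add: square_integrable_space_def)
    also have "(\<lambda>t. a t * cnj (a t)) = (\<lambda>t. of_real (indicat_real A t))" by (auto simp: a_def indicator_def)
    also have "(\<integral>t. complex_of_real (indicat_real A t) \<partial>\<mu>) = of_real (\<integral>t. indicat_real A t \<partial>\<mu>)"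
      by (rule integral_complex_of_real)
    also have "\<dots> = of_real (measure \<mu> A)"
      using sets_compact[OF A] haar_finite[OF A] sets.sets_into_space[OF sets_compact[OF A]]
      by (simp add: Int_absorb2)
    finally have "f s = of_real (measure \<mu> A)" .
    moreover have "emeasure \<mu> A \<noteq> 0"
      using open_positive[OF N(1,2)] emeasure_mono[OF N(3) sets_compact[OF A]] by auto
    ultimately show ?thesis
      using haar_finite[OF A] by (auto simp: measure_def enn2real_eq_0_iff)
  qed
  moreover have "f t = 0" if "t \<in> carrier G - K" for t
  proof -
    have *: "left_translate G t a x * cnj (b x) = 0" if x: "x \<in> carrier G" for x
    proof (rule ccontr)
      assume "left_translate G t a x * cnj (b x) \<noteq> 0"
      then have tx: "inv t \<otimes> x \<in> A" and sx: "inv s \<otimes> x \<in> A"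
        using x by (auto simp: left_translate_def b_def a_def indicator_def split: if_splits)
      have t: "t \<in> carrier G" using \<open>t \<in> carrier G - K\<close> by simp
      \<comment> \<open>A common point \<open>x\<close> of the two translates exhibits
        \<open>t\<close> as an element of s A A^-1.\<close>
      have "s \<otimes> (inv s \<otimes> x) \<otimes> inv (inv t \<otimes> x) = t"
        using s t x by (simp add: inv_mult_group m_assoc) (simp add: m_assoc[symmetric])
      then have "t \<in> K" using AK tx sx by metis
      then show False using \<open>t \<in> carrier G - K\<close> by simp
    qed
    have "ip L2 (left_translate G t a) b = (\<integral>x. left_translate G t a x * cnj (b x) \<partial>\<mu>)"
      by (simp add: square_integrable_space_def)
    also have "\<dots> = (\<integral>x. 0 \<partial>\<mu>)"
      by (rule Bochner_Integration.integral_cong[OF refl]) (simp only: space_haar *)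
    finally show ?thesis using that by (simp add: feq)
  qed
  ultimately show "\<exists>f\<in>eberlein_algebra G V \<pi>. f s \<noteq> 0 \<and>
      (\<exists>K. compactin (topo G) K \<and> K \<subseteq> U \<and> (\<forall>t\<in>carrier G - K. f t = 0))"
    using K by blast
qed

section \<open>Invariant functionals on locally compact groups\<close>

context locally_compact_group
begin

text \<open>The cone of nonnegative continuous functions with compact support. Values off the
  carrier are unconstrained, so functions are compared on the carrier only.\<close>

definition Cc_pos :: "('a \<Rightarrow> real) set"
  where "Cc_pos = {f. continuous_map (topo G) euclideanreal f \<and> (\<forall>x\<in>carrier G. 0 \<le> f x) \<and>
    (\<exists>K. compactin (topo G) K \<and> (\<forall>x\<in>carrier G - K. f x = 0))}"

text \<open>The nonzero members of the cone: their translates can cover every other member.\<close>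

definition bumps :: "('a \<Rightarrow> real) set"
  where "bumps = {f \<in> Cc_pos. \<exists>x\<in>carrier G. 0 < f x}"

definition shift :: "'a \<Rightarrow> ('a \<Rightarrow> real) \<Rightarrow> 'a \<Rightarrow> real"
  where "shift s f = (\<lambda>x. f (inv s \<otimes> x))"

lemma Cc_posD:
  assumes "f \<in> Cc_pos"
  shows "continuous_map (topo G) euclideanreal f" "\<And>x. x \<in> carrier G \<Longrightarrow> 0 \<le> f x"
    "\<exists>K. compactin (topo G) K \<and> (\<forall>x\<in>carrier G - K. f x = 0)"
  using assms by (auto simp: Cc_pos_def)

lemma Cc_pos_add: "\<lbrakk>f \<in> Cc_pos; g \<in> Cc_pos\<rbrakk> \<Longrightarrow> (\<lambda>x. f x + g x) \<in> Cc_pos"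
proof -
  assume f: "f \<in> Cc_pos" and g: "g \<in> Cc_pos"
  obtain K where K: "compactin (topo G) K" "\<forall>x\<in>carrier G - K. f x = 0" using Cc_posD(3)[OF f] by blast
  obtain L where L: "compactin (topo G) L" "\<forall>x\<in>carrier G - L. g x = 0" using Cc_posD(3)[OF g] by blast
  have "compactin (topo G) (K \<union> L)" using K(1) L(1) by (rule compactin_Un)
  moreover have "\<forall>x\<in>carrier G - (K \<union> L). f x + g x = 0" using K(2) L(2) by simp
  ultimately show ?thesis
    using Cc_posD(1,2)[OF f] Cc_posD(1,2)[OF g] by (auto simp: Cc_pos_def intro!: continuous_map_add)
qed

lemma Cc_pos_mult_bounded:
  assumes f: "f \<in> Cc_pos" and g: "continuous_map (topo G) euclideanreal g" "\<And>x. x \<in> carrier G \<Longrightarrow> 0 \<le> g x"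
  shows "(\<lambda>x. f x * g x) \<in> Cc_pos"
proof -
  obtain K where K: "compactin (topo G) K" "\<forall>x\<in>carrier G - K. f x = 0" using Cc_posD(3)[OF f] by blast
  then have "\<exists>K. compactin (topo G) K \<and> (\<forall>x\<in>carrier G - K. f x * g x = 0)" by auto
  then show ?thesis using Cc_posD(1,2)[OF f] g by (auto simp: Cc_pos_def intro!: continuous_map_real_mult)
qed

lemma Cc_pos_scale: "\<lbrakk>f \<in> Cc_pos; 0 \<le> c\<rbrakk> \<Longrightarrow> (\<lambda>x. c * f x) \<in> Cc_pos"
  using Cc_pos_mult_bounded[of f "\<lambda>_. c"] by (simp add: mult.commute)

lemma Cc_pos_mult: "\<lbrakk>f \<in> Cc_pos; g \<in> Cc_pos\<rbrakk> \<Longrightarrow> (\<lambda>x. f x * g x) \<in> Cc_pos"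
  by (rule Cc_pos_mult_bounded) (auto dest: Cc_posD)

lemma Cc_pos_shift:
  assumes s: "s \<in> carrier G" and f: "f \<in> Cc_pos"
  shows "shift s f \<in> Cc_pos"
proof -
  obtain K where K: "compactin (topo G) K" "\<forall>x\<in>carrier G - K. f x = 0" using Cc_posD(3)[OF f] by blast
  have "compactin (topo G) ((\<lambda>x. s \<otimes> x) ` K)"
    by (rule image_compactin[OF K(1) continuous_map_translate[OF s]])
  moreover have "shift s f x = 0" if "x \<in> carrier G - (\<lambda>x. s \<otimes> x) ` K" for x
  proof -
    have "x = s \<otimes> (inv s \<otimes> x)" using s that by (simp flip: m_assoc)
    then have "inv s \<otimes> x \<notin> K" using that by blast
    then show ?thesis using K(2) s that by (simp add: shift_def)
  qed
  moreover have "continuous_map (topo G) euclideanreal (shift s f)"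
    using continuous_map_compose[OF continuous_map_translate Cc_posD(1)[OF f], of "inv s"] s
    by (simp add: shift_def o_def)
  ultimately show ?thesis
    using Cc_posD(2)[OF f] s unfolding Cc_pos_def by (auto simp: shift_def)
qed

lemma bumpsD: "\<phi> \<in> bumps \<Longrightarrow> \<phi> \<in> Cc_pos"
  by (simp add: bumps_def)

lemma Cc_pos_bounded:
  assumes f: "f \<in> Cc_pos"
  shows "\<exists>M>0. \<forall>x\<in>carrier G. f x \<le> M"
proof -
  obtain K where K: "compactin (topo G) K" "\<forall>x\<in>carrier G - K. f x = 0" using Cc_posD(3)[OF f] by blast
  have "compact (f ` K)" using image_compactin[OF K(1) Cc_posD(1)[OF f]] by simp
  then obtain B where B: "\<And>y. y \<in> f ` K \<Longrightarrow> \<bar>y\<bar> \<le> B" using compact_imp_bounded bounded_real by metis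
  have "f x \<le> max B 1" if "x \<in> carrier G" for x
    using B[of "f x"] K(2) that by (cases "x \<in> K") auto
  then show ?thesis by (intro exI[of _ "max B 1"]) auto
qed

text \<open>Locally compact Hausdorff spaces are completely regular. A function that is 0 at
  \<open>x\<close> and 1 off \<open>N\<close> is subtracted from 1; the result is carried by the
  compact set \<open>A\<close>.\<close>

lemma bump_in_neighbourhood:
  assumes U: "openin (topo G) U" and x: "x \<in> U"
  shows "\<exists>f\<in>Cc_pos. 0 < f x \<and> (\<forall>y\<in>carrier G - U. f y = 0)"
proof -
  obtain N A where N: "openin (topo G) N" "compactin (topo G) A" "x \<in> N" "N \<subseteq> A" "A \<subseteq> U"
    using compact_neighbourhood[OF U x] by blast
  have "completely_regular_space (topo G)"
    using locally_compact_regular_imp_completely_regular_space locally_compact Hausdorff by blast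
  moreover have "closedin (topo G) (carrier G - N)" using N(1) by (simp add: closedin_diff topspace_topo flip: topspace_topo)
  moreover have "x \<in> topspace (topo G) - (carrier G - N)"
    using N(3) openin_subset[OF N(1)] by auto
  ultimately obtain f :: "'a \<Rightarrow> real" where f: "continuous_map (topo G) (top_of_set {0..1}) f" "f x = 0" "f ` (carrier G - N) \<subseteq> {1}"
    unfolding completely_regular_space_def by metis
  have c: "continuous_map (topo G) euclideanreal f" and r: "\<And>y. y \<in> carrier G \<Longrightarrow> f y \<in> {0..1}"
    using f(1) by (auto simp: continuous_map_in_subtopology topspace_topo)
  have "(\<lambda>y. 1 - f y) \<in> Cc_pos"
    unfolding Cc_pos_def using c r f(3) N by (auto intro!: continuous_map_diff exI[of _ A])
  moreover have "\<forall>y\<in>carrier G - U. 1 - f y = 0" using f(3) N by auto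
  ultimately show ?thesis using f(2) by (intro bexI[of _ "\<lambda>y. 1 - f y"]) auto
qed

text \<open>Stated for a family of maps \<open>F n\<close> in order to cover left and right translations at once.\<close>

lemma uniformly_continuous:
  assumes F: "continuous_map (prod_topology (topo G) (topo G)) (topo G) (\<lambda>(n, y). F n y)"
    and one: "\<And>y. y \<in> carrier G \<Longrightarrow> F \<one> y = y"
    and inv: "\<And>n y. \<lbrakk>n \<in> carrier G; y \<in> carrier G\<rbrakk> \<Longrightarrow> F (inv n) (F n y) = y"
    and f: "f \<in> Cc_pos" and e: "e > 0"
  shows "\<exists>U. openin (topo G) U \<and> \<one> \<in> U \<and> (\<forall>n\<in>U. \<forall>y\<in>carrier G. \<bar>f (F n y) - f y\<bar> < e)"
proof -
  have closed: "F n y \<in> carrier G" if "n \<in> carrier G" "y \<in> carrier G" for n y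
    using continuous_map_funspace[OF F] that by (auto simp: topspace_topo Pi_iff)
  obtain K where K: "compactin (topo G) K" "\<forall>x\<in>carrier G - K. f x = 0" using Cc_posD(3)[OF f] by blast
  have KG: "K \<subseteq> carrier G" using compactin_subset_topspace[OF K(1)] by (simp add: topspace_topo)
  define d where "d = (\<lambda>p. f (case p of (n, y) \<Rightarrow> F n y) - f (snd p))"
  have "continuous_map (prod_topology (topo G) (topo G)) euclideanreal (\<lambda>p. f (case p of (n, y) \<Rightarrow> F n y))"
    using continuous_map_compose[OF F Cc_posD(1)[OF f]] by (simp add: o_def)
  moreover have "continuous_map (prod_topology (topo G) (topo G)) euclideanreal (\<lambda>p. f (snd p))"
    using continuous_map_compose[OF continuous_map_snd Cc_posD(1)[OF f]] by (simp add: o_def)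
  ultimately have "continuous_map (prod_topology (topo G) (topo G)) euclideanreal d"
    unfolding d_def by (rule continuous_map_diff)
  then have W: "openin (prod_topology (topo G) (topo G)) {p \<in> topspace (prod_topology (topo G) (topo G)). d p \<in> {-e<..<e}}"
    by (rule openin_continuous_map_preimage) simp
  have sub: "{\<one>} \<times> K \<subseteq> {p \<in> topspace (prod_topology (topo G) (topo G)). d p \<in> {-e<..<e}}"
    using KG e one by (auto simp: topspace_topo d_def)
  have "\<one> \<in> topspace (topo G)" by (simp add: topspace_topo)
  \<comment> \<open>The difference \<open>d\<close> vanishes over the identity, so by compactness of
    \<open>K\<close> one neighbourhood of the identity works for all points of
    \<open>K\<close>.\<close>
  from tube_lemma_right[OF W K(1) this sub]
  obtain U V where UV: "openin (topo G) U" "\<one> \<in> U" "K \<subseteq> V"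
      "U \<times> V \<subseteq> {p \<in> topspace (prod_topology (topo G) (topo G)). d p \<in> {-e<..<e}}"
    by (elim exE conjE)
  have UK: "\<bar>f (F n y) - f y\<bar> < e" if "n \<in> U" "y \<in> K" for n y
  proof -
    have "(n, y) \<in> U \<times> V" using that UV(3) by blast
    then have "d (n, y) \<in> {-e<..<e}" using UV(4) by blast
    then show ?thesis by (auto simp: d_def)
  qed
  \<comment> \<open>Closing \<open>U\<close> under inversion covers a point \<open>y\<close> off
    \<open>K\<close> that is moved into \<open>K\<close>: there the estimate is applied at the moved
    point with the inverse of \<open>n\<close>.\<close>
  define W where "W = U \<inter> {n \<in> topspace (topo G). inv n \<in> U}"
  have "openin (topo G) W"
    unfolding W_def by (intro openin_Int UV(1) openin_continuous_map_preimage[OF continuous_inv])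
  moreover have "\<one> \<in> W" using UV(2) by (simp add: W_def topspace_topo)
  moreover have "\<bar>f (F n y) - f y\<bar> < e" if n: "n \<in> W" and y: "y \<in> carrier G" for n y
  proof -
    have nU: "n \<in> U" "inv n \<in> U" "n \<in> carrier G" using n by (auto simp: W_def topspace_topo)
    show ?thesis
    proof (cases "y \<in> K")
      case False
      show ?thesis
      proof (cases "F n y \<in> K")
        case True
        then have "\<bar>f (F (inv n) (F n y)) - f (F n y)\<bar> < e" using UK nU by blast
        then show ?thesis using inv nU y by simp
      next
        case False
        then have "f (F n y) = 0" "f y = 0" using \<open>y \<notin> K\<close> K(2) closed nU y by auto
        then show ?thesis using e by simp
      qed
    qed (use UK nU in blast)
  qed
  ultimately show ?thesis by blast
qed

text \<open>\<open>ratio \<phi> f\<close> is the covering number usually written \<open>(f : \<phi>)\<close>.\<close>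

definition comb :: "('a \<Rightarrow> real) \<Rightarrow> (real \<times> 'a) list \<Rightarrow> 'a \<Rightarrow> real"
  where "comb \<phi> cs x = (\<Sum>p\<leftarrow>cs. fst p * \<phi> (inv (snd p) \<otimes> x))"

text \<open>A list of pairs of a coefficient and a translating element encodes a finite combination
  of left translates; appending lists adds combinations.\<close>

definition weights :: "(real \<times> 'a) list \<Rightarrow> bool"
  where "weights cs \<longleftrightarrow> (\<forall>p\<in>set cs. 0 \<le> fst p \<and> snd p \<in> carrier G)"

definition covers :: "('a \<Rightarrow> real) \<Rightarrow> ('a \<Rightarrow> real) \<Rightarrow> (real \<times> 'a) list \<Rightarrow> bool"
  where "covers \<phi> f cs \<longleftrightarrow> weights cs \<and> (\<forall>x\<in>carrier G. f x \<le> comb \<phi> cs x)"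

definition cost :: "(real \<times> 'a) list \<Rightarrow> real"
  where "cost cs = (\<Sum>p\<leftarrow>cs. fst p)"

definition ratio :: "('a \<Rightarrow> real) \<Rightarrow> ('a \<Rightarrow> real) \<Rightarrow> real"
  where "ratio \<phi> f = Inf {cost cs | cs. covers \<phi> f cs}"

section \<open>Covering numbers by translates: existence, sublinearity, invariance and
  comparison\<close>

lemma comb_simps [simp]: "comb \<phi> [] x = 0"
  "comb \<phi> (p # cs) x = fst p * \<phi> (inv (snd p) \<otimes> x) + comb \<phi> cs x"
  "comb \<phi> (cs @ ds) x = comb \<phi> cs x + comb \<phi> ds x"
  by (simp_all add: comb_def)

lemma cost_simps [simp]: "cost [] = 0" "cost (p # cs) = fst p + cost cs" "cost (cs @ ds) = cost cs + cost ds"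
  by (simp_all add: cost_def)

lemma weights_simps [simp]: "weights []" "weights (p # cs) \<longleftrightarrow> 0 \<le> fst p \<and> snd p \<in> carrier G \<and> weights cs"
  "weights (cs @ ds) \<longleftrightarrow> weights cs \<and> weights ds"
  by (auto simp: weights_def)

lemma cost_nonneg: "weights cs \<Longrightarrow> 0 \<le> cost cs"
  by (induction cs) auto

lemma comb_nonneg:
  "\<lbrakk>weights cs; \<phi> \<in> Cc_pos; x \<in> carrier G\<rbrakk> \<Longrightarrow> 0 \<le> comb \<phi> cs x"
  by (induction cs) (simp_all add: Cc_posD(2))

lemma comb_scale: "comb \<phi> (map (\<lambda>p. (a * fst p, snd p)) cs) x = a * comb \<phi> cs x"
  by (induction cs) (auto simp: algebra_simps)

lemma cost_scale: "cost (map (\<lambda>p. (a * fst p, snd p)) cs) = a * cost cs"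
  by (induction cs) (auto simp: algebra_simps)

lemma weights_scale: "\<lbrakk>weights cs; 0 \<le> a\<rbrakk> \<Longrightarrow> weights (map (\<lambda>p. (a * fst p, snd p)) cs)"
  by (induction cs) auto

lemma comb_translate:
  "\<lbrakk>weights cs; s \<in> carrier G; x \<in> carrier G\<rbrakk> \<Longrightarrow>
    comb \<phi> (map (\<lambda>p. (fst p, s \<otimes> snd p)) cs) x = comb \<phi> cs (inv s \<otimes> x)"
  by (induction cs) (auto simp: inv_mult_group m_assoc)

lemma cost_translate: "cost (map (\<lambda>p. (fst p, s \<otimes> snd p)) cs) = cost cs"
  by (induction cs) auto

lemma weights_translate: "\<lbrakk>weights cs; s \<in> carrier G\<rbrakk> \<Longrightarrow> weights (map (\<lambda>p. (fst p, s \<otimes> snd p)) cs)"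
  by (induction cs) auto

lemma comb_le_cost:
  assumes "weights cs" "\<And>x. x \<in> carrier G \<Longrightarrow> \<phi> x \<le> M" "x \<in> carrier G"
  shows "comb \<phi> cs x \<le> cost cs * M"
  using assms
proof (induction cs)
  case (Cons p cs)
  have "fst p * \<phi> (inv (snd p) \<otimes> x) \<le> fst p * M"
    using Cons.prems by (intro mult_left_mono) auto
  then show ?case using Cons by (simp add: distrib_right)
qed simp

text \<open>The translate of \<open>\<phi>\<close> by \<open>k \<otimes> inv x0\<close> has the
  positive value \<open>\<phi> x0\<close> at \<open>k\<close>, hence exceeds half of it near
  \<open>k\<close>. Finitely many such neighbourhoods cover \<open>K\<close>, and the weight
  \<open>2 / \<phi> x0\<close> lifts the value to at least 1.\<close>

lemma cover_compact:
  assumes K: "compactin (topo G) K" and \<phi>: "\<phi> \<in> bumps"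
  shows "\<exists>cs. weights cs \<and> (\<forall>x\<in>K. 1 \<le> comb \<phi> cs x)"
proof -
  obtain x0 where x0: "x0 \<in> carrier G" "0 < \<phi> x0" using \<phi> by (auto simp: bumps_def)
  have \<phi>C: "\<phi> \<in> Cc_pos" using \<phi> by (rule bumpsD)
  have KG: "K \<subseteq> carrier G" using compactin_subset_topspace[OF K] by (simp add: topspace_topo)
  define V where "V k = {x \<in> topspace (topo G). \<phi> (inv (k \<otimes> inv x0) \<otimes> x) \<in> {\<phi> x0 / 2<..}}" for k
  have open_V: "openin (topo G) F" if "F \<in> V ` K" for F
  proof -
    obtain k where k: "k \<in> K" "F = V k" using \<open>F \<in> V ` K\<close> by blast
    then have "k \<in> carrier G" using KG by blast
    then have "shift (k \<otimes> inv x0) \<phi> \<in> Cc_pos" using x0 \<phi>C by (intro Cc_pos_shift) auto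
    from openin_continuous_map_preimage[OF Cc_posD(1)[OF this], of "{\<phi> x0 / 2<..}"]
    show ?thesis unfolding k(2) V_def by (simp add: shift_def)
  qed
  moreover have "K \<subseteq> \<Union> (V ` K)"
  proof
    fix k assume k: "k \<in> K"
    then have "k \<in> carrier G" using KG by blast
    moreover from this have "inv (k \<otimes> inv x0) \<otimes> k = x0" using x0 by (simp add: inv_mult_group m_assoc)
    ultimately have "k \<in> V k" using x0 by (simp add: V_def topspace_topo)
    then show "k \<in> \<Union> (V ` K)" using k by blast
  qed
  ultimately obtain \<F> where \<F>: "finite \<F>" "\<F> \<subseteq> V ` K" "K \<subseteq> \<Union>\<F>"
    using compactinD[OF K] by metis
  obtain L where L: "finite L" "L \<subseteq> K" "\<F> = V ` L"
    using finite_subset_image[OF \<F>(1,2)] by metis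
  obtain ks where ks: "set ks = L" using finite_list[OF L(1)] by blast
  define cs where "cs = map (\<lambda>k. (2 / \<phi> x0, k \<otimes> inv x0)) ks"
  have ksG: "set ks \<subseteq> carrier G" using ks L(2) KG by blast
  have "weights cs" using ksG x0 unfolding cs_def by (auto simp: weights_def)
  moreover have "1 \<le> comb \<phi> cs x" if x: "x \<in> K" for x
  proof -
    obtain k where k: "k \<in> set ks" "x \<in> V k" using x \<F>(3) L(3) ks by blast
    have xG: "x \<in> carrier G" using x KG by blast
    have "1 \<le> comb \<phi> (map (\<lambda>k. (2 / \<phi> x0, k \<otimes> inv x0)) ks) x" using k(1) ksG
    proof (induction ks)
      case (Cons a ks)
      let ?m = "map (\<lambda>k. (2 / \<phi> x0, k \<otimes> inv x0)) ks"
      have w: "weights ?m" using Cons.prems(2) x0 by (auto simp: weights_def)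
      have t: "0 \<le> \<phi> (inv (a \<otimes> inv x0) \<otimes> x)" using Cons.prems(2) x0 xG by (intro Cc_posD(2)[OF \<phi>C]) auto
      show ?case
      proof (cases "k = a")
        case True
        then have "1 \<le> 2 / \<phi> x0 * \<phi> (inv (a \<otimes> inv x0) \<otimes> x)" using k(2) x0 by (simp add: V_def field_simps)
        then show ?thesis using comb_nonneg[OF w \<phi>C xG] by simp
      next
        case False
        then have "1 \<le> comb \<phi> ?m x" using Cons by auto
        moreover have "0 \<le> 2 / \<phi> x0 * \<phi> (inv (a \<otimes> inv x0) \<otimes> x)" using t x0 by simp
        ultimately show ?thesis by simp
      qed
    qed simp
    then show ?thesis by (simp add: cs_def)
  qed
  ultimately show ?thesis by blast
qed

lemma covers_exists:
  assumes f: "f \<in> Cc_pos" and \<phi>: "\<phi> \<in> bumps"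
  shows "\<exists>cs. covers \<phi> f cs"
proof -
  obtain K where K: "compactin (topo G) K" "\<forall>x\<in>carrier G - K. f x = 0" using Cc_posD(3)[OF f] by blast
  obtain cs where cs: "weights cs" "\<forall>x\<in>K. 1 \<le> comb \<phi> cs x" using cover_compact[OF K(1) \<phi>] by blast
  obtain M where M: "M > 0" "\<forall>x\<in>carrier G. f x \<le> M" using Cc_pos_bounded[OF f] by blast
  have "f x \<le> M * comb \<phi> cs x" if x: "x \<in> carrier G" for x
  proof (cases "x \<in> K")
    case True
    then have "M * 1 \<le> M * comb \<phi> cs x" using cs(2) M(1) by (intro mult_left_mono) auto
    then show ?thesis using M(2) x by fastforce
  next
    case False
    then show ?thesis using K(2) x comb_nonneg[OF cs(1) bumpsD[OF \<phi>] x] M(1) by simp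
  qed
  then have "covers \<phi> f (map (\<lambda>p. (M * fst p, snd p)) cs)"
    using cs(1) M(1) by (auto simp: covers_def weights_scale comb_scale)
  then show ?thesis by blast
qed

lemma ratio_le: "covers \<phi> f cs \<Longrightarrow> ratio \<phi> f \<le> cost cs"
  unfolding ratio_def by (rule cInf_lower) (auto intro!: bdd_belowI[of _ 0] simp: covers_def cost_nonneg)

lemma ratio_greatest:
  assumes "f \<in> Cc_pos" "\<phi> \<in> bumps" "\<And>cs. covers \<phi> f cs \<Longrightarrow> a \<le> cost cs"
  shows "a \<le> ratio \<phi> f"
  unfolding ratio_def using covers_exists[OF assms(1,2)] assms(3) by (intro cInf_greatest) auto

lemma ratio_nonneg: "\<lbrakk>f \<in> Cc_pos; \<phi> \<in> bumps\<rbrakk> \<Longrightarrow> 0 \<le> ratio \<phi> f"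
  by (rule ratio_greatest) (auto simp: covers_def cost_nonneg)

text \<open>Appending a cover of \<open>g\<close> to a cover of \<open>f\<close> covers the sum; the
  two infima are taken one after the other.\<close>

lemma ratio_add:
  assumes f: "f \<in> Cc_pos" and g: "g \<in> Cc_pos" and \<phi>: "\<phi> \<in> bumps"
  shows "ratio \<phi> (\<lambda>x. f x + g x) \<le> ratio \<phi> f + ratio \<phi> g"
proof -
  have "ratio \<phi> (\<lambda>x. f x + g x) - ratio \<phi> g \<le> ratio \<phi> f"
  proof (rule ratio_greatest[OF f \<phi>])
    fix cs assume cs: "covers \<phi> f cs"
    have "ratio \<phi> (\<lambda>x. f x + g x) - cost cs \<le> ratio \<phi> g"
    proof (rule ratio_greatest[OF g \<phi>])
      fix ds assume "covers \<phi> g ds"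
      then have "covers \<phi> (\<lambda>x. f x + g x) (cs @ ds)"
        using cs by (auto simp: covers_def intro: add_mono)
      from ratio_le[OF this] show "ratio \<phi> (\<lambda>x. f x + g x) - cost cs \<le> cost ds" by simp
    qed
    then show "ratio \<phi> (\<lambda>x. f x + g x) - ratio \<phi> g \<le> cost cs" by simp
  qed
  then show ?thesis by simp
qed

lemma ratio_mono:
  assumes "f \<in> Cc_pos" "g \<in> Cc_pos" "\<phi> \<in> bumps" "\<And>x. x \<in> carrier G \<Longrightarrow> f x \<le> g x"
  shows "ratio \<phi> f \<le> ratio \<phi> g"
  using assms(4) by (intro ratio_greatest[OF assms(2,3)] ratio_le) (fastforce simp: covers_def)

lemma ratio_scale_le:
  assumes f: "f \<in> Cc_pos" and \<phi>: "\<phi> \<in> bumps" and c: "0 < c"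
  shows "ratio \<phi> (\<lambda>x. c * f x) \<le> c * ratio \<phi> f"
proof -
  have "ratio \<phi> (\<lambda>x. c * f x) / c \<le> ratio \<phi> f"
  proof (rule ratio_greatest[OF f \<phi>])
    fix cs assume "covers \<phi> f cs"
    then have "covers \<phi> (\<lambda>x. c * f x) (map (\<lambda>p. (c * fst p, snd p)) cs)"
      using c by (auto simp: covers_def weights_scale comb_scale)
    from ratio_le[OF this] show "ratio \<phi> (\<lambda>x. c * f x) / c \<le> cost cs"
      using c by (simp add: cost_scale field_simps)
  qed
  then show ?thesis using c by (simp add: field_simps)
qed

lemma ratio_scale:
  assumes f: "f \<in> Cc_pos" and \<phi>: "\<phi> \<in> bumps" and c: "0 < c"
  shows "ratio \<phi> (\<lambda>x. c * f x) = c * ratio \<phi> f"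
proof (rule antisym)
  have "ratio \<phi> (\<lambda>x. (1 / c) * (c * f x)) \<le> (1 / c) * ratio \<phi> (\<lambda>x. c * f x)"
    using c by (intro ratio_scale_le Cc_pos_scale f \<phi>) auto
  then show "c * ratio \<phi> f \<le> ratio \<phi> (\<lambda>x. c * f x)" using c by (simp add: field_simps)
qed (rule ratio_scale_le[OF assms])

lemma ratio_shift_le:
  assumes f: "f \<in> Cc_pos" and \<phi>: "\<phi> \<in> bumps" and s: "s \<in> carrier G"
  shows "ratio \<phi> (shift s f) \<le> ratio \<phi> f"
proof (rule ratio_greatest[OF f \<phi>])
  fix cs assume "covers \<phi> f cs"
  then have "covers \<phi> (shift s f) (map (\<lambda>p. (fst p, s \<otimes> snd p)) cs)"
    using s by (auto simp: covers_def weights_translate comb_translate shift_def)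
  from ratio_le[OF this] show "ratio \<phi> (shift s f) \<le> cost cs" by (simp add: cost_translate)
qed

lemma ratio_shift:
  assumes f: "f \<in> Cc_pos" and \<phi>: "\<phi> \<in> bumps" and s: "s \<in> carrier G"
  shows "ratio \<phi> (shift s f) = ratio \<phi> f"
proof (rule antisym)
  have "ratio \<phi> f \<le> ratio \<phi> (shift (inv s) (shift s f))"
    using s by (intro ratio_mono f \<phi> Cc_pos_shift) (auto simp: shift_def simp flip: m_assoc)
  also have "\<dots> \<le> ratio \<phi> (shift s f)"
    using s by (intro ratio_shift_le f \<phi> Cc_pos_shift) auto
  finally show "ratio \<phi> f \<le> ratio \<phi> (shift s f)" .
qed (rule ratio_shift_le[OF assms])

text \<open>A combination never exceeds its cost times a bound \<open>M\<close> of
  \<open>\<phi>\<close>, so one positive value \<open>f x\<close> forces the cost of every cover to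
  be at least \<open>f x / M\<close>.\<close>

lemma ratio_pos:
  assumes f: "f \<in> bumps" and \<phi>: "\<phi> \<in> bumps"
  shows "0 < ratio \<phi> f"
proof -
  obtain x where x: "x \<in> carrier G" "0 < f x" using f by (auto simp: bumps_def)
  obtain M where M: "M > 0" "\<forall>x\<in>carrier G. \<phi> x \<le> M" using Cc_pos_bounded[OF bumpsD[OF \<phi>]] by blast
  have "f x / M \<le> ratio \<phi> f"
  proof (rule ratio_greatest[OF bumpsD[OF f] \<phi>])
    fix cs assume "covers \<phi> f cs"
    then have "f x \<le> cost cs * M" using comb_le_cost[of cs \<phi> M x] M x by (fastforce simp: covers_def)
    then show "f x / M \<le> cost cs" using M(1) by (simp add: field_simps)
  qed
  then show ?thesis using x M by (meson divide_pos_pos less_le_trans)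
qed

text \<open>A cover of \<open>\<phi>\<close> by translates of \<open>\<psi>\<close> is substituted
  into a cover of \<open>f\<close> by translates of \<open>\<phi>\<close>: weights multiply and
  translations compose. The inequality confines the normalized ratios to bounded intervals that do
  not depend on the covering function.\<close>

lemma ratio_trans:
  assumes f: "f \<in> Cc_pos" and \<phi>: "\<phi> \<in> bumps" and \<psi>: "\<psi> \<in> bumps"
  shows "ratio \<psi> f \<le> ratio \<phi> f * ratio \<psi> \<phi>"
proof -
  have *: "ratio \<psi> f \<le> cost cs * cost ds" if cs: "covers \<phi> f cs" and ds: "covers \<psi> \<phi> ds" for cs ds
  proof -
    define es where "es = concat (map (\<lambda>p. map (\<lambda>q. (fst p * fst q, snd p \<otimes> snd q)) ds) cs)"
    have w: "weights cs" "weights ds" using cs ds by (auto simp: covers_def)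
    have ds': "comb \<psi> (map (\<lambda>q. (c * fst q, s \<otimes> snd q)) ds) x = c * comb \<psi> ds (inv s \<otimes> x)
      \<and> cost (map (\<lambda>q. (c * fst q, s \<otimes> snd q)) ds) = c * cost ds"
      if "s \<in> carrier G" "x \<in> carrier G" for c s x
      using w(2) that by (induction ds) (auto simp: inv_mult_group m_assoc algebra_simps)
    have es: "comb \<psi> es x = (\<Sum>p\<leftarrow>cs. fst p * comb \<psi> ds (inv (snd p) \<otimes> x)) \<and> cost es = cost cs * cost ds"
      if "x \<in> carrier G" for x
      unfolding es_def using w(1) that by (induction cs) (auto simp: ds' algebra_simps)
    have "weights es" using w unfolding es_def weights_def by auto
    moreover have "f x \<le> comb \<psi> es x" if x: "x \<in> carrier G" for x
    proof -
      have "f x \<le> comb \<phi> cs x" using cs x by (simp add: covers_def)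
      also have "\<dots> \<le> (\<Sum>p\<leftarrow>cs. fst p * comb \<psi> ds (inv (snd p) \<otimes> x))"
        unfolding comb_def[of \<phi>] using w(1) ds x
        by (intro sum_list_mono mult_left_mono) (auto simp: weights_def covers_def)
      finally show ?thesis using es[OF x] by simp
    qed
    ultimately have "covers \<psi> f es" by (simp add: covers_def)
    then show ?thesis using ratio_le es[OF one_closed] by fastforce
  qed
  have pos: "0 < ratio \<psi> \<phi>" by (rule ratio_pos[OF \<phi> \<psi>])
  have "ratio \<psi> f / ratio \<psi> \<phi> \<le> ratio \<phi> f"
  proof (rule ratio_greatest[OF f \<phi>])
    fix cs assume cs: "covers \<phi> f cs"
    then have c0: "0 \<le> cost cs" by (simp add: covers_def cost_nonneg)
    have "ratio \<psi> f \<le> cost cs * ratio \<psi> \<phi>"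
    \<comment> \<open>The second infimum is reached by dividing by the cost of \<open>cs\<close>, so
      a cover of cost zero is treated separately.\<close>
    proof (cases "cost cs = 0")
      case True
      obtain ds where "covers \<psi> \<phi> ds" using covers_exists[OF bumpsD[OF \<phi>] \<psi>] by blast
      then show ?thesis using *[OF cs] True by fastforce
    next
      case False
      have "ratio \<psi> f / cost cs \<le> ratio \<psi> \<phi>"
        by (rule ratio_greatest[OF bumpsD[OF \<phi>] \<psi>]) (use *[OF cs] False c0 in \<open>simp add: field_simps\<close>)
      then show ?thesis using False c0 by (simp add: field_simps)
    qed
    then show "ratio \<psi> f / ratio \<psi> \<phi> \<le> cost cs" using pos by (simp add: field_simps)
  qed
  then show ?thesis using pos by (simp add: field_simps)
qed

text \<open>A translate by \<open>r\<close> contributes at \<open>x\<close> only if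
  \<open>inv r \<otimes> x\<close> lies in \<open>U\<close>; since \<open>x\<close> is
  \<open>r\<close> times this element, \<open>h x\<close> is then at most
  \<open>h r + \<delta>\<close>. The varying factor \<open>h x\<close> can thus be absorbed into the
  constant weights.\<close>

lemma weighted_covers:
  assumes w: "weights cs" and \<phi>: "\<phi> \<in> Cc_pos" and x: "x \<in> carrier G" and U: "U \<subseteq> carrier G"
    and supp: "\<And>y. y \<in> carrier G \<Longrightarrow> y \<notin> U \<Longrightarrow> \<phi> y = 0"
    and h: "\<And>y n. y \<in> carrier G \<Longrightarrow> n \<in> U \<Longrightarrow> h (y \<otimes> n) \<le> h y + \<delta>"
  shows "comb \<phi> cs x * h x \<le> comb \<phi> (map (\<lambda>p. (fst p * (h (snd p) + \<delta>), snd p)) cs) x"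
  using w
proof (induction cs)
  case (Cons p cs)
  let ?n = "inv (snd p) \<otimes> x"
  have n: "?n \<in> carrier G" and s: "snd p \<in> carrier G" "0 \<le> fst p" using Cons.prems x by auto
  have "fst p * \<phi> ?n * h x \<le> fst p * (h (snd p) + \<delta>) * \<phi> ?n"
  proof (cases "?n \<in> U")
    case True
    have "snd p \<otimes> ?n = x" using s x by (simp flip: m_assoc)
    then have "h x \<le> h (snd p) + \<delta>" using h[OF s(1) True] by simp
    then have "(fst p * \<phi> ?n) * h x \<le> (fst p * \<phi> ?n) * (h (snd p) + \<delta>)"
      using s Cc_posD(2)[OF \<phi> n] by (intro mult_left_mono) auto
    then show ?thesis by (simp add: ac_simps)
  qed (simp add: supp[OF n])
  then show ?case using Cons by (simp add: distrib_right)
qed simp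

text \<open>With \<open>h = f1 + f2 + \<delta> g\<close>, where \<open>g \<ge> 1\<close> on the supports, and \<open>h\<^sub>i = f\<^sub>i / (f1 + f2 + \<delta>)\<close> one has
  \<open>f\<^sub>i \<le> h h\<^sub>i\<close> and \<open>h\<^sub>1 + h\<^sub>2 \<le> 1\<close>; multiplying the weights of a cover of \<open>h\<close> by the values of \<open>h\<^sub>i\<close>
  gives covers of both summands.\<close>

lemma ratio_superadditive:
  assumes f1: "f1 \<in> Cc_pos" and f2: "f2 \<in> Cc_pos" and f0: "f0 \<in> bumps" and e: "e > 0"
  shows "\<exists>U. openin (topo G) U \<and> \<one> \<in> U \<and> (\<forall>\<phi>\<in>bumps. (\<forall>x\<in>carrier G - U. \<phi> x = 0) \<longrightarrow>
    ratio \<phi> f1 / ratio \<phi> f0 + ratio \<phi> f2 / ratio \<phi> f0 \<le> ratio \<phi> (\<lambda>x. f1 x + f2 x) / ratio \<phi> f0 + e)"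
proof -
  let ?f = "\<lambda>x. f1 x + f2 x"
  have f: "?f \<in> Cc_pos" by (rule Cc_pos_add[OF f1 f2])
  obtain K where K: "compactin (topo G) K" "\<forall>x\<in>carrier G - K. ?f x = 0" using Cc_posD(3)[OF f] by blast
  obtain cs0 where cs0: "weights cs0" "\<forall>x\<in>K. 1 \<le> comb f0 cs0 x" using cover_compact[OF K(1) f0] by blast
  \<comment> \<open>A fixed member of the cone, at least 1 where \<open>f1 + f2\<close> is nonzero,
    so that adding \<open>\<delta> * g\<close> perturbs the sum by an amount controlled by the
    constant \<open>C\<close> below.\<close>
  define g where "g = comb f0 cs0"
  have g: "g \<in> Cc_pos"
    unfolding g_def using cs0(1)
  proof (induction cs0)
    case Nil
    have "(\<lambda>x. 0 * f1 x) \<in> Cc_pos" by (rule Cc_pos_scale[OF f1]) simp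
    moreover have "comb f0 [] = (\<lambda>x. 0)" by (rule ext) simp
    ultimately show ?case by simp
  next
    case (Cons p cs)
    have "(\<lambda>x. fst p * shift (snd p) f0 x + comb f0 cs x) \<in> Cc_pos"
      using Cons bumpsD[OF f0] by (intro Cc_pos_add Cc_pos_scale Cc_pos_shift) auto
    moreover have "comb f0 (p # cs) = (\<lambda>x. fst p * shift (snd p) f0 x + comb f0 cs x)"
      by (rule ext) (simp add: shift_def)
    ultimately show ?case by simp
  qed
  have g1: "1 \<le> g x" if "x \<in> K" for x using cs0(2) that by (simp add: g_def)
  define B C where "B = ratio f0 ?f" and "C = ratio f0 g"
  have BC: "0 \<le> B" "0 \<le> C" unfolding B_def C_def by (auto intro: ratio_nonneg f g f0)
  \<comment> \<open>The error at the end is \<open>\<delta> * (2 * F + D + 2 * \<delta> * D)\<close>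
    with \<open>F \<le> B\<close> and \<open>D \<le> C\<close>. As \<open>\<delta> \<le> 1\<close>,
    it is at most \<open>\<delta> * (2 * B + 3 * C)\<close>; the summand 1 keeps the denominator
    positive.\<close>
  define \<delta> where "\<delta> = min 1 (e / (2 * B + 3 * C + 1))"
  have \<delta>: "0 < \<delta>" "\<delta> \<le> 1" using e BC by (auto simp: \<delta>_def)
  have \<delta>e: "\<delta> * (2 * B + 3 * C) \<le> e"
  proof -
    have "\<delta> * (2 * B + 3 * C) \<le> \<delta> * (2 * B + 3 * C + 1)" using \<delta> by simp
    also have "\<dots> \<le> e / (2 * B + 3 * C + 1) * (2 * B + 3 * C + 1)"
      using BC by (intro mult_right_mono) (auto simp: \<delta>_def)
    also have "\<dots> = e" using BC by (simp add: add_nonneg_eq_0_iff)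
    finally show ?thesis .
  qed
  define h where "h = (\<lambda>x. ?f x + \<delta> * g x)"
  have h: "h \<in> Cc_pos" unfolding h_def using \<delta> by (intro Cc_pos_add[OF f] Cc_pos_scale g) auto
  have den: "?f x + \<delta> > 0" if "x \<in> carrier G" for x
    using Cc_posD(2)[OF f that] \<delta> by linarith
  have quot: "(\<lambda>x. fi x * (1 / (?f x + \<delta>))) \<in> Cc_pos" if "fi \<in> Cc_pos" for fi
  proof (rule Cc_pos_mult_bounded[OF that])
    show "continuous_map (topo G) euclideanreal (\<lambda>x. 1 / (?f x + \<delta>))"
      using den Cc_posD(1)[OF f] 
      by (intro continuous_map_real_divide continuous_map_add[of _ ?f]) (force simp: topspace_topo)+
    show "0 \<le> 1 / (?f x + \<delta>)" if "x \<in> carrier G" for x using den[OF that] by simp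
  qed
  define h1 h2 where "h1 = (\<lambda>x. f1 x * (1 / (?f x + \<delta>)))" and "h2 = (\<lambda>x. f2 x * (1 / (?f x + \<delta>)))"
  have h12: "h1 \<in> Cc_pos" "h2 \<in> Cc_pos" unfolding h1_def h2_def by (rule quot f1 f2)+
  have h_sum: "h1 x + h2 x \<le> 1" if "x \<in> carrier G" for x
  proof -
    have "h1 x + h2 x = ?f x / (?f x + \<delta>)" by (simp add: h1_def h2_def add_divide_distrib)
    then show ?thesis using den[OF that] \<delta> by simp
  qed
  have hle: "f1 x \<le> h x * h1 x \<and> f2 x \<le> h x * h2 x" if x: "x \<in> carrier G" for x
  proof (cases "x \<in> K")
    case True
    then have "?f x + \<delta> \<le> h x" using g1[of x] \<delta> by (simp add: h_def)
    then have "(?f x + \<delta>) * h1 x \<le> h x * h1 x" "(?f x + \<delta>) * h2 x \<le> h x * h2 x"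
      using h12 Cc_posD(2) x by (auto intro!: mult_right_mono)
    then show ?thesis using den[OF x] by (simp add: h1_def h2_def)
  next
    case False
    then have "f1 x + f2 x = 0" using K(2) x by simp
    then have "f1 x = 0 \<and> f2 x = 0" using Cc_posD(2)[OF f1 x] Cc_posD(2)[OF f2 x] by linarith
    then show ?thesis by (simp add: h1_def h2_def)
  qed
  \<comment> \<open>Right translations are needed here, because \<open>weighted_covers\<close>
    compares the value at \<open>y \<otimes> n\<close> with the value at \<open>y\<close>.\<close>
  have right: "continuous_map (prod_topology (topo G) (topo G)) (topo G) (\<lambda>(n, y). y \<otimes> n)"
    unfolding case_prod_unfold by (intro continuous_intros)
  have unif: "\<exists>U. openin (topo G) U \<and> \<one> \<in> U \<and> (\<forall>n\<in>U. \<forall>y\<in>carrier G. \<bar>hi (y \<otimes> n) - hi y\<bar> < \<delta>)"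
    if "hi \<in> Cc_pos" for hi
    using uniformly_continuous[OF right _ _ that \<delta>(1)] by (auto simp: m_assoc)
  obtain U1 where U1: "openin (topo G) U1" "\<one> \<in> U1" "\<forall>n\<in>U1. \<forall>y\<in>carrier G. \<bar>h1 (y \<otimes> n) - h1 y\<bar> < \<delta>"
    using unif[OF h12(1)] by blast
  obtain U2 where U2: "openin (topo G) U2" "\<one> \<in> U2" "\<forall>n\<in>U2. \<forall>y\<in>carrier G. \<bar>h2 (y \<otimes> n) - h2 y\<bar> < \<delta>"
    using unif[OF h12(2)] by blast
  define U where "U = U1 \<inter> U2"
  have U: "openin (topo G) U" "\<one> \<in> U" using U1 U2 by (auto simp: U_def)
  have UG: "U \<subseteq> carrier G" using openin_subset[OF U(1)] by (simp add: topspace_topo)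
  have hU: "h1 (y \<otimes> n) \<le> h1 y + \<delta>" "h2 (y \<otimes> n) \<le> h2 y + \<delta>" if "y \<in> carrier G" "n \<in> U" for y n
    using U1(3) U2(3) that unfolding U_def by (smt (verit, best) Int_iff)+
  have "ratio \<phi> f1 / ratio \<phi> f0 + ratio \<phi> f2 / ratio \<phi> f0 \<le> ratio \<phi> ?f / ratio \<phi> f0 + e"
    if \<phi>: "\<phi> \<in> bumps" and supp: "\<forall>x\<in>carrier G - U. \<phi> x = 0" for \<phi>
  proof -
    have \<phi>C: "\<phi> \<in> Cc_pos" by (rule bumpsD[OF \<phi>])
    have supp': "\<phi> y = 0" if "y \<in> carrier G" "y \<notin> U" for y using supp that by blast
    have key: "(ratio \<phi> f1 + ratio \<phi> f2) / (1 + 2 * \<delta>) \<le> ratio \<phi> h"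
    proof (rule ratio_greatest[OF h \<phi>])
      fix cs assume cs: "covers \<phi> h cs"
      then have w: "weights cs" by (simp add: covers_def)
      let ?m = "\<lambda>hi cs. map (\<lambda>p. (fst p * (hi (snd p) + \<delta>), snd p)) cs"
      have cov: "covers \<phi> fi (?m hi cs)"
        if hi: "hi \<in> Cc_pos" "\<And>x. x \<in> carrier G \<Longrightarrow> fi x \<le> h x * hi x"
          "\<And>y n. y \<in> carrier G \<Longrightarrow> n \<in> U \<Longrightarrow> hi (y \<otimes> n) \<le> hi y + \<delta>" for fi hi
      proof -
        have "fi x \<le> comb \<phi> (?m hi cs) x" if x: "x \<in> carrier G" for x
        proof -
          have "fi x \<le> h x * hi x" by (rule hi(2)[OF x])
          also have "\<dots> \<le> comb \<phi> cs x * hi x"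
            using cs x Cc_posD(2)[OF hi(1) x] by (intro mult_right_mono) (auto simp: covers_def)
          also have "\<dots> \<le> comb \<phi> (?m hi cs) x"
            by (rule weighted_covers[OF w \<phi>C x UG supp' hi(3)])
          finally show ?thesis .
        qed
        moreover have "weights (?m hi cs)"
          using w \<delta> Cc_posD(2)[OF hi(1)] by (auto simp: weights_def intro!: mult_nonneg_nonneg add_nonneg_nonneg)
        ultimately show ?thesis by (simp add: covers_def)
      qed
      have "ratio \<phi> f1 + ratio \<phi> f2 \<le> cost (?m h1 cs) + cost (?m h2 cs)"
        using hle by (intro add_mono ratio_le cov h12 hU) auto
      \<comment> \<open>Each weight is counted with the factor \<open>h1 + h2 + 2 * \<delta>\<close>
        at its translating element, and \<open>h1 + h2 \<le> 1\<close>.\<close>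
      also have "\<dots> \<le> cost cs * (1 + 2 * \<delta>)"
        using w
      proof (induction cs)
        case (Cons p cs)
        have "fst p * (h1 (snd p) + h2 (snd p) + 2 * \<delta>) \<le> fst p * (1 + 2 * \<delta>)"
          using Cons.prems h_sum[of "snd p"] by (intro mult_left_mono) auto
        then show ?case using Cons by (simp add: algebra_simps)
      qed simp
      finally show "(ratio \<phi> f1 + ratio \<phi> f2) / (1 + 2 * \<delta>) \<le> cost cs" using \<delta> by (simp add: field_simps)
    qed
    have r0: "0 < ratio \<phi> f0" by (rule ratio_pos[OF f0 \<phi>])
    define F where "F = ratio \<phi> ?f / ratio \<phi> f0"
    define D where "D = ratio \<phi> g / ratio \<phi> f0"
    \<comment> \<open>These bounds do not depend on \<open>\<phi>\<close>, so
      \<open>\<delta>\<close> and \<open>U\<close> could be fixed before \<open>\<phi>\<close> was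
      chosen.\<close>
    have FB: "F \<le> B" "D \<le> C"
      using ratio_trans[OF f f0 \<phi>] ratio_trans[OF g f0 \<phi>] r0 by (auto simp: F_def D_def B_def C_def field_simps)
    have D0: "0 \<le> D" using ratio_nonneg[OF g \<phi>] r0 by (simp add: D_def)
    have "ratio \<phi> h \<le> ratio \<phi> ?f + \<delta> * ratio \<phi> g"
      unfolding h_def using ratio_add[OF f Cc_pos_scale[OF g, of \<delta>] \<phi>] ratio_scale[OF g \<phi> \<delta>(1)] \<delta> by simp
    then have "ratio \<phi> f1 + ratio \<phi> f2 \<le> (1 + 2 * \<delta>) * (ratio \<phi> ?f + \<delta> * ratio \<phi> g)"
      using key \<delta> by (smt (verit, best) mult_left_mono pos_divide_le_eq mult.commute)
    then have "(ratio \<phi> f1 + ratio \<phi> f2) / ratio \<phi> f0 \<le> (1 + 2 * \<delta>) * (ratio \<phi> ?f + \<delta> * ratio \<phi> g) / ratio \<phi> f0"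
      using r0 by (intro divide_right_mono) auto
    also have "\<dots> = (1 + 2 * \<delta>) * (F + \<delta> * D)" 
      by (simp add: F_def D_def add_divide_distrib times_divide_eq_right[symmetric] del: times_divide_eq_right)
    also have "\<dots> = F + \<delta> * (2 * F + D + 2 * \<delta> * D)" by (simp add: algebra_simps)
    also have "\<dots> \<le> F + \<delta> * (2 * B + 3 * C)"
    proof -
      have "\<delta> * D \<le> 1 * D" using \<delta> D0 by (intro mult_right_mono) auto
      then have "2 * F + D + 2 * \<delta> * D \<le> 2 * B + 3 * C" using FB by linarith
      then show ?thesis using \<delta> by (intro add_left_mono mult_left_mono) auto
    qed
    also have "\<dots> \<le> F + e" using \<delta>e by simp
    finally show ?thesis by (simp add: F_def add_divide_distrib)
  qed
  then show ?thesis using U by blast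
qed

text \<open>A limit point of the normalized ratios as the support of \<open>\<phi>\<close> shrinks to the identity.\<close>

lemma invariant_functional_approx:
  assumes f0: "f0 \<in> bumps"
  shows "\<exists>I. \<forall>\<Phi> U e. finite \<Phi> \<and> \<Phi> \<subseteq> Cc_pos \<and> openin (topo G) U \<and> \<one> \<in> U \<and> 0 < (e::real) \<longrightarrow>
    (\<exists>\<phi>\<in>bumps. (\<forall>x\<in>carrier G - U. \<phi> x = 0) \<and> (\<forall>f\<in>\<Phi>. \<bar>ratio \<phi> f / ratio \<phi> f0 - I f\<bar> < e))"
proof -
  \<comment> \<open>By \<open>ratio_trans\<close> the normalized ratio of \<open>f\<close> lies in
    this interval for every covering bump, so Tychonoff's theorem applies to the product.\<close>
  define Y where "Y f = top_of_set {0..ratio f0 f}" for f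
  define X where "X = product_topology Y Cc_pos"
  define J where "J \<phi> = (\<lambda>f\<in>Cc_pos. ratio \<phi> f / ratio \<phi> f0)" for \<phi>
  define A where "A U = J ` {\<phi> \<in> bumps. \<forall>x\<in>carrier G - U. \<phi> x = 0}" for U
  have top: "topspace X = (\<Pi>\<^sub>E f\<in>Cc_pos. {0..ratio f0 f})" by (simp add: X_def Y_def)
  have "compact_space X"
    unfolding X_def Y_def by (subst compact_space_product_topology) (simp add: compact_space_subtopology)
  moreover have JX: "J \<phi> \<in> topspace X" if \<phi>: "\<phi> \<in> bumps" for \<phi>
    using ratio_trans[OF _ f0 \<phi>] ratio_nonneg[OF _ \<phi>] ratio_pos[OF f0 \<phi>]
    by (auto simp: top J_def field_simps)
  let ?\<U> = "{X closure_of A U | U. openin (topo G) U \<and> \<one> \<in> U}"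
  \<comment> \<open>A bump supported in the intersection of finitely many neighbourhoods of the
    identity gives a point common to all the corresponding sets.\<close>
  have fip: "\<Inter>\<F> \<noteq> {}" if \<F>: "finite \<F>" "\<F> \<subseteq> ?\<U>" for \<F>
  proof -
    have "\<F> \<subseteq> (\<lambda>U. X closure_of A U) ` {U. openin (topo G) U \<and> \<one> \<in> U}" using \<F>(2) by blast
    from finite_subset_image[OF \<F>(1) this]
    obtain \<W> where \<W>: "finite \<W>" "\<W> \<subseteq> {U. openin (topo G) U \<and> \<one> \<in> U}" "\<F> = (\<lambda>U. X closure_of A U) ` \<W>"
      by (elim exE conjE)
    define W where "W = topspace (topo G) \<inter> \<Inter>\<W>"
    have "openin (topo G) W"
      unfolding W_def by (rule openin_Int_Inter[OF \<W>(1) openin_topspace]) (use \<W>(2) in blast)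
    moreover have "\<one> \<in> W" using \<W>(2) by (auto simp: W_def topspace_topo)
    ultimately have "\<exists>f\<in>Cc_pos. 0 < f \<one> \<and> (\<forall>y\<in>carrier G - W. f y = 0)"
      by (rule bump_in_neighbourhood)
    then obtain \<phi> where \<phi>: "\<phi> \<in> Cc_pos" "0 < \<phi> \<one>" "\<forall>y\<in>carrier G - W. \<phi> y = 0"
      by (elim bexE conjE)
    then have b: "\<phi> \<in> bumps" by (auto simp: bumps_def)
    have "J \<phi> \<in> X closure_of A U" if "U \<in> \<W>" for U
    proof -
      have "J \<phi> \<in> A U" using b \<phi>(3) that by (auto simp: A_def W_def)
      then show ?thesis using JX[OF b] by (auto simp: in_closure_of)
    qed
    then show ?thesis using \<W>(3) by blast
  qed
  ultimately have "\<Inter>?\<U> \<noteq> {}"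
    unfolding compact_space_fip by (elim allE[of _ ?\<U>] impE) auto
  then obtain I where I: "I \<in> \<Inter>?\<U>" by blast
  show ?thesis
  proof (intro exI[of _ I] allI impI, elim conjE)
    fix \<Phi> U and e :: real
    assume \<Phi>: "finite \<Phi>" "\<Phi> \<subseteq> Cc_pos" and U: "openin (topo G) U" "\<one> \<in> U" and e: "0 < e"
    have IU: "I \<in> X closure_of A U" using I U by blast
    \<comment> \<open>The sum turns closeness at the finitely many functions of
      \<open>\<Phi>\<close> into a single open condition.\<close>
    define S where "S = {K \<in> topspace X. (\<Sum>f\<in>\<Phi>. \<bar>K f - I f\<bar>) \<in> {..<e}}"
    have proj: "continuous_map X euclideanreal (\<lambda>K. K f)" if "f \<in> Cc_pos" for f
      using continuous_map_product_projection[OF that, of Y] unfolding X_def Y_def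
      by (rule continuous_map_into_fulltopology)
    have "continuous_map X euclideanreal (\<lambda>K. \<Sum>f\<in>\<Phi>. \<bar>K f - I f\<bar>)"
      using \<Phi> by (intro continuous_map_sum continuous_map_real_abs continuous_map_diff proj) auto
    then have "openin X S"
      unfolding S_def by (rule openin_continuous_map_preimage) simp
    moreover have "I \<in> S" using IU e by (auto simp: S_def in_closure_of)
    ultimately obtain K where K: "K \<in> A U" "K \<in> S" using IU unfolding in_closure_of by blast
    then obtain \<phi> where \<phi>: "\<phi> \<in> bumps" "\<forall>x\<in>carrier G - U. \<phi> x = 0" "K = J \<phi>" by (auto simp: A_def)
    have "\<bar>ratio \<phi> f / ratio \<phi> f0 - I f\<bar> < e" if f: "f \<in> \<Phi>" for f
    proof -
      have "\<bar>K f - I f\<bar> \<le> (\<Sum>f\<in>\<Phi>. \<bar>K f - I f\<bar>)" using \<Phi>(1) f by (intro member_le_sum) auto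
      also have "\<dots> < e" using K(2) by (simp add: S_def)
      finally show ?thesis using f \<Phi>(2) by (auto simp: \<phi>(3) J_def)
    qed
    then show "\<exists>\<phi>\<in>bumps. (\<forall>x\<in>carrier G - U. \<phi> x = 0) \<and> (\<forall>f\<in>\<Phi>. \<bar>ratio \<phi> f / ratio \<phi> f0 - I f\<bar> < e)"
      using \<phi> by blast
  qed
qed

text \<open>Each property involves the values at finitely many functions, and some normalized ratio
  is close to \<open>I\<close> at all of them; the corresponding property of ratios then passes
  over. For superadditivity \<open>\<phi>\<close> is moreover taken with support in the
  neighbourhood from \<open>ratio_superadditive\<close>.\<close>

lemma invariant_functional:
  assumes f0: "f0 \<in> bumps"
  obtains I :: "('a \<Rightarrow> real) \<Rightarrow> real"
  where "I f0 = 1"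
    and "\<And>f g. \<lbrakk>f \<in> Cc_pos; g \<in> Cc_pos\<rbrakk> \<Longrightarrow> I (\<lambda>x. f x + g x) = I f + I g"
    and "\<And>f c. \<lbrakk>f \<in> Cc_pos; 0 < c\<rbrakk> \<Longrightarrow> I (\<lambda>x. c * f x) = c * I f"
    and "\<And>f g. \<lbrakk>f \<in> Cc_pos; g \<in> Cc_pos; \<And>x. x \<in> carrier G \<Longrightarrow> f x \<le> g x\<rbrakk> \<Longrightarrow> I f \<le> I g"
    and "\<And>f s. \<lbrakk>f \<in> Cc_pos; s \<in> carrier G\<rbrakk> \<Longrightarrow> I (shift s f) = I f"
proof -
  obtain I where "\<forall>\<Phi> U e. finite \<Phi> \<and> \<Phi> \<subseteq> Cc_pos \<and> openin (topo G) U \<and> \<one> \<in> U \<and> 0 < (e::real) \<longrightarrow>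
    (\<exists>\<phi>\<in>bumps. (\<forall>x\<in>carrier G - U. \<phi> x = 0) \<and> (\<forall>f\<in>\<Phi>. \<bar>ratio \<phi> f / ratio \<phi> f0 - I f\<bar> < e))"
    using invariant_functional_approx[OF f0] by (elim exE)
  then have I: "\<exists>\<phi>\<in>bumps. (\<forall>x\<in>carrier G - U. \<phi> x = 0) \<and> (\<forall>f\<in>\<Phi>. \<bar>ratio \<phi> f / ratio \<phi> f0 - I f\<bar> < e)"
    if "finite \<Phi>" "\<Phi> \<subseteq> Cc_pos" "openin (topo G) U" "\<one> \<in> U" "0 < (e::real)" for \<Phi> U e
    using that by (elim allE impE) (intro conjI, assumption+)
  have approx: "\<exists>\<phi>\<in>bumps. \<forall>f\<in>\<Phi>. \<bar>ratio \<phi> f / ratio \<phi> f0 - I f\<bar> < e"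
    if "finite \<Phi>" "\<Phi> \<subseteq> Cc_pos" "0 < e" for \<Phi> and e :: real
    using I[OF that(1,2) openin_topspace _ that(3)] by (auto simp: topspace_topo)
  have r0: "0 < ratio \<phi> f0" if "\<phi> \<in> bumps" for \<phi> by (rule ratio_pos[OF f0 that])
  show thesis
  proof (rule that[of I])
    show "I f0 = 1"
    proof (rule ccontr)
      assume "I f0 \<noteq> 1"
      then obtain \<phi> where "\<phi> \<in> bumps" "\<bar>ratio \<phi> f0 / ratio \<phi> f0 - I f0\<bar> < \<bar>1 - I f0\<bar>"
        using approx[of "{f0}" "\<bar>1 - I f0\<bar>"] bumpsD[OF f0] by auto
      then show False using r0[of \<phi>] by simp
    qed
    fix f assume f: "f \<in> Cc_pos"
    show "I (\<lambda>x. f x + g x) = I f + I g" if g: "g \<in> Cc_pos" for g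
    proof (rule antisym)
      note fg = Cc_pos_add[OF f g]
      show "I (\<lambda>x. f x + g x) \<le> I f + I g"
      proof (rule field_le_epsilon)
        fix e :: real assume e: "0 < e"
        obtain \<phi> where \<phi>: "\<phi> \<in> bumps" and
          *: "\<forall>k\<in>{f, g, \<lambda>x. f x + g x}. \<bar>ratio \<phi> k / ratio \<phi> f0 - I k\<bar> < e/3"
          using approx[of "{f, g, \<lambda>x. f x + g x}" "e/3"] e f g fg by auto
        have "ratio \<phi> (\<lambda>x. f x + g x) / ratio \<phi> f0 \<le> ratio \<phi> f / ratio \<phi> f0 + ratio \<phi> g / ratio \<phi> f0"
          using ratio_add[OF f g \<phi>] r0[OF \<phi>] by (simp add: divide_right_mono flip: add_divide_distrib)
        moreover have "\<bar>ratio \<phi> f / ratio \<phi> f0 - I f\<bar> < e/3" "\<bar>ratio \<phi> g / ratio \<phi> f0 - I g\<bar> < e/3"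
          "\<bar>ratio \<phi> (\<lambda>x. f x + g x) / ratio \<phi> f0 - I (\<lambda>x. f x + g x)\<bar> < e/3" using * by blast+
        ultimately show "I (\<lambda>x. f x + g x) \<le> I f + I g + e" by linarith
      qed
      show "I f + I g \<le> I (\<lambda>x. f x + g x)"
      proof (rule field_le_epsilon)
        fix e :: real assume e: "0 < e"
        then have e4: "0 < e/4" by simp
        from ratio_superadditive[OF f g f0 e4]
        obtain U where U: "openin (topo G) U" "\<one> \<in> U" and sup: "\<forall>\<phi>\<in>bumps. (\<forall>x\<in>carrier G - U. \<phi> x = 0) \<longrightarrow>
          ratio \<phi> f / ratio \<phi> f0 + ratio \<phi> g / ratio \<phi> f0 \<le> ratio \<phi> (\<lambda>x. f x + g x) / ratio \<phi> f0 + e/4"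
          by (elim exE conjE)
        obtain \<phi> where \<phi>: "\<phi> \<in> bumps" "\<forall>x\<in>carrier G - U. \<phi> x = 0" and
          *: "\<forall>k\<in>{f, g, \<lambda>x. f x + g x}. \<bar>ratio \<phi> k / ratio \<phi> f0 - I k\<bar> < e/4"
          using I[of "{f, g, \<lambda>x. f x + g x}" U "e/4"] e f g fg U by auto
        have "ratio \<phi> f / ratio \<phi> f0 + ratio \<phi> g / ratio \<phi> f0 \<le> ratio \<phi> (\<lambda>x. f x + g x) / ratio \<phi> f0 + e/4"
          using sup \<phi> by blast
        moreover have "\<bar>ratio \<phi> f / ratio \<phi> f0 - I f\<bar> < e/4" "\<bar>ratio \<phi> g / ratio \<phi> f0 - I g\<bar> < e/4"
          "\<bar>ratio \<phi> (\<lambda>x. f x + g x) / ratio \<phi> f0 - I (\<lambda>x. f x + g x)\<bar> < e/4" using * by blast+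
        ultimately show "I f + I g \<le> I (\<lambda>x. f x + g x) + e" by linarith
      qed
    qed
    show "I f \<le> I g" if g: "g \<in> Cc_pos" and le: "\<And>x. x \<in> carrier G \<Longrightarrow> f x \<le> g x" for g
    proof (rule field_le_epsilon)
      fix e :: real assume e: "0 < e"
      obtain \<phi> where \<phi>: "\<phi> \<in> bumps" and *: "\<forall>k\<in>{f, g}. \<bar>ratio \<phi> k / ratio \<phi> f0 - I k\<bar> < e/2"
        using approx[of "{f, g}" "e/2"] e f g by auto
      have "ratio \<phi> f / ratio \<phi> f0 \<le> ratio \<phi> g / ratio \<phi> f0"
        using ratio_mono[OF f g \<phi> le] r0[OF \<phi>] by (simp add: divide_right_mono)
      moreover have "\<bar>ratio \<phi> f / ratio \<phi> f0 - I f\<bar> < e/2" "\<bar>ratio \<phi> g / ratio \<phi> f0 - I g\<bar> < e/2"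
        using * by blast+
      ultimately show "I f \<le> I g + e" by linarith
    qed
    show "I (shift s f) = I f" if s: "s \<in> carrier G" for s
    proof (rule ccontr)
      assume ne: "I (shift s f) \<noteq> I f"
      define e where "e = \<bar>I (shift s f) - I f\<bar>"
      obtain \<phi> where \<phi>: "\<phi> \<in> bumps" and *: "\<forall>k\<in>{f, shift s f}. \<bar>ratio \<phi> k / ratio \<phi> f0 - I k\<bar> < e/2"
        using approx[of "{f, shift s f}" "e/2"] ne f Cc_pos_shift[OF s f] by (auto simp: e_def)
      then have "\<bar>ratio \<phi> f / ratio \<phi> f0 - I f\<bar> < e/2" "\<bar>ratio \<phi> f / ratio \<phi> f0 - I (shift s f)\<bar> < e/2"
        using ratio_shift[OF f \<phi> s] by auto
      then have "\<bar>I (shift s f) - I f\<bar> < e" by linarith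
      then show False by (simp add: e_def)
    qed
    show "I (\<lambda>x. c * f x) = c * I f" if c: "0 < c" for c
    proof (rule ccontr)
      assume ne: "I (\<lambda>x. c * f x) \<noteq> c * I f"
      \<comment> \<open>The errors at the two functions add up to \<open>e + c * e\<close>, hence
        the division by \<open>c + 1\<close>.\<close>
      define e where "e = \<bar>I (\<lambda>x. c * f x) - c * I f\<bar> / (c + 1)"
      have e: "0 < e" using ne c by (simp add: e_def)
      obtain \<phi> where \<phi>: "\<phi> \<in> bumps" and *: "\<forall>k\<in>{f, \<lambda>x. c * f x}. \<bar>ratio \<phi> k / ratio \<phi> f0 - I k\<bar> < e"
        using approx[of "{f, \<lambda>x. c * f x}" e] e f Cc_pos_scale[OF f, of c] c by auto
      have "\<bar>I (\<lambda>x. c * f x) - c * I f\<bar> \<le> \<bar>c * (ratio \<phi> f / ratio \<phi> f0) - I (\<lambda>x. c * f x)\<bar> + \<bar>c * (ratio \<phi> f / ratio \<phi> f0 - I f)\<bar>"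
        by (simp add: right_diff_distrib)
      also have "\<dots> = \<bar>c * (ratio \<phi> f / ratio \<phi> f0) - I (\<lambda>x. c * f x)\<bar> + c * \<bar>ratio \<phi> f / ratio \<phi> f0 - I f\<bar>"
        using c by (simp only: abs_mult abs_of_pos)
      also have "\<dots> < e + c * e"
        using * c ratio_scale[OF f \<phi> c] by (intro add_strict_mono mult_strict_left_mono) auto
      also have "\<dots> = (c + 1) * e" by (simp add: algebra_simps)
      also have "\<dots> = \<bar>I (\<lambda>x. c * f x) - c * I f\<bar>" using c by (simp add: e_def)
      finally show False by simp
    qed
  qed
qed

section \<open>Positive definite functions with small support\<close>

text \<open>By invariance the value of I (h L_s h) at b^-1 a is I (L_b h L_a h), a Gram matrix;
  hence positive definiteness. If it is nonzero at \<open>t\<close>, the supports of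
  \<open>h\<close> and its translate meet, which places \<open>t\<close> in A A^-1.\<close>

lemma positive_definite_small_support:
  assumes U: "openin (topo G) U" "\<one> \<in> U"
  shows "\<exists>u\<in>normalized_positive_definite G. \<exists>K. compactin (topo G) K \<and> K \<subseteq> U \<and> (\<forall>t\<in>carrier G - K. u t = 0)"
proof -
  obtain N A K where N: "openin (topo G) N" "\<one> \<in> N" "N \<subseteq> A" and A: "compactin (topo G) A"
    and K: "compactin (topo G) K" "K \<subseteq> U" and AK: "\<forall>x\<in>A. \<forall>y\<in>A. \<one> \<otimes> x \<otimes> inv y \<in> K"
    using compact_quotient_neighbourhood[OF U] by blast
  obtain h where h: "h \<in> Cc_pos" "0 < h \<one>" "\<forall>y\<in>carrier G - N. h y = 0"
    using bump_in_neighbourhood[OF N(1,2)] by blast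
  \<comment> \<open>Normalizing \<open>I\<close> at the square of \<open>h\<close> gives the value 1
    at the identity.\<close>
  define f0 where "f0 = (\<lambda>x. h x * h x)"
  have f0: "f0 \<in> bumps" unfolding bumps_def f0_def using h by (auto intro!: Cc_pos_mult bexI[of _ \<one>])
  obtain I where I1: "I f0 = 1"
    and Iadd: "\<And>f g. \<lbrakk>f \<in> Cc_pos; g \<in> Cc_pos\<rbrakk> \<Longrightarrow> I (\<lambda>x. f x + g x) = I f + I g"
    and Iscale: "\<And>f c. \<lbrakk>f \<in> Cc_pos; 0 < c\<rbrakk> \<Longrightarrow> I (\<lambda>x. c * f x) = c * I f"
    and Imono: "\<And>f g. \<lbrakk>f \<in> Cc_pos; g \<in> Cc_pos; \<And>x. x \<in> carrier G \<Longrightarrow> f x \<le> g x\<rbrakk> \<Longrightarrow> I f \<le> I g"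
    and Ishift: "\<And>f s. \<lbrakk>f \<in> Cc_pos; s \<in> carrier G\<rbrakk> \<Longrightarrow> I (shift s f) = I f"
    using invariant_functional[OF f0] by blast
  have Icong: "I f = I g" if "f \<in> Cc_pos" "g \<in> Cc_pos" "\<And>x. x \<in> carrier G \<Longrightarrow> f x = g x" for f g
    using that by (intro antisym Imono) auto
  have zero: "(\<lambda>x. 0) \<in> Cc_pos" using Cc_pos_scale[OF h(1), of 0] by simp
  have I0: "I (\<lambda>x. 0) = 0" using Iadd[OF zero zero] by simp
  have Inn: "0 \<le> I f" if "f \<in> Cc_pos" for f using Imono[OF zero that] Cc_posD(2)[OF that] I0 by simp
  have Iscale0: "I (\<lambda>x. c * f x) = c * I f" if "f \<in> Cc_pos" "0 \<le> c" for c f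
    using Iscale[OF that(1)] that(2) I0 by (cases "c = 0") auto
  have Isum: "(\<lambda>x. \<Sum>i\<in>B. f i x) \<in> Cc_pos \<and> I (\<lambda>x. \<Sum>i\<in>B. f i x) = (\<Sum>i\<in>B. I (f i))"
    if "finite B" "\<And>i. i \<in> B \<Longrightarrow> f i \<in> Cc_pos" for B :: "(nat \<times> nat) set" and f
    using that by (induction B) (auto simp: zero I0 Iadd Cc_pos_add)
  define v where "v s = I (\<lambda>x. h x * shift s h x)" for s
  have hs: "(\<lambda>x. h x * shift s h x) \<in> Cc_pos" if "s \<in> carrier G" for s
    using that h(1) by (intro Cc_pos_mult Cc_pos_shift)
  have cont: "continuous_map (topo G) euclideanreal v"
    unfolding mtopology_is_euclidean[symmetric] Met_TC.continuous_map_to_metric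
  proof (intro ballI allI impI)
    fix s and e :: real assume s: "s \<in> topspace (topo G)" and e: "0 < e"
    have s: "s \<in> carrier G" using s by (simp add: topspace_topo)
    define d where "d = e / (I h + 1)"
    have d: "0 < d" using e Inn[OF h(1)] by (simp add: d_def add_nonneg_pos)
    have left: "continuous_map (prod_topology (topo G) (topo G)) (topo G) (\<lambda>(n, y). n \<otimes> y)"
      by (rule continuous_mult)
    obtain W where W: "openin (topo G) W" "\<one> \<in> W" "\<forall>n\<in>W. \<forall>y\<in>carrier G. \<bar>h (n \<otimes> y) - h y\<bar> < d"
      using uniformly_continuous[OF left _ _ h(1) d] by (auto simp flip: m_assoc)
    \<comment> \<open>For \<open>t\<close> in \<open>V\<close> the identity t^-1 x = (t^-1 s) (s^-1
      x) reduces the comparison of the translates of \<open>h\<close> by \<open>t\<close> and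
      \<open>s\<close> to the uniform estimate on \<open>W\<close>.\<close>
    define V where "V = {t \<in> topspace (topo G). inv t \<otimes> s \<in> W}"
    have "continuous_map (topo G) (topo G) (\<lambda>t. inv t \<otimes> s)"
      using s by (intro continuous_map_mult continuous_inv) (auto simp: topspace_topo)
    then have "openin (topo G) V" unfolding V_def using W(1) by (rule openin_continuous_map_preimage)
    moreover have "s \<in> V" using s W(2) by (simp add: V_def topspace_topo l_inv)
    moreover have "v t \<in> ball (v s) e" if t: "t \<in> V" for t
    proof -
      have tG: "t \<in> carrier G" and tW: "inv t \<otimes> s \<in> W" using t by (auto simp: V_def topspace_topo)
      have le: "\<bar>shift t h x - shift s h x\<bar> \<le> d" if x: "x \<in> carrier G" for x
      proof -
        have "\<bar>h ((inv t \<otimes> s) \<otimes> (inv s \<otimes> x)) - h (inv s \<otimes> x)\<bar> < d" using W(3) tW s x by simp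
        moreover have "(inv t \<otimes> s) \<otimes> (inv s \<otimes> x) = inv t \<otimes> x"
        proof -
          have "(inv t \<otimes> s) \<otimes> (inv s \<otimes> x) = inv t \<otimes> ((s \<otimes> inv s) \<otimes> x)"
            using s tG x by (simp only: m_assoc inv_closed m_closed)
          then show ?thesis using s tG x by (simp add: r_inv)
        qed
        ultimately show ?thesis by (simp add: shift_def)
      qed
      \<comment> \<open>Both integrands contain the factor \<open>h\<close>, so the uniform bound
        \<open>d\<close> enters as \<open>d * h\<close>, a member of the cone.\<close>
      have step: "v a \<le> v b + d * I h"
        if ab: "a \<in> carrier G" "b \<in> carrier G" "\<And>x. x \<in> carrier G \<Longrightarrow> \<bar>shift a h x - shift b h x\<bar> \<le> d" for a b
      proof -
        have "v a \<le> I (\<lambda>x. h x * shift b h x + d * h x)"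
          unfolding v_def
        proof (rule Imono)
          show "h x * shift a h x \<le> h x * shift b h x + d * h x" if x: "x \<in> carrier G" for x
          proof -
            have "h x * shift a h x \<le> h x * (shift b h x + d)"
              using ab(3)[OF x] Cc_posD(2)[OF h(1) x] by (intro mult_left_mono) auto
            then show ?thesis by (simp add: algebra_simps)
          qed
        qed (use ab d h(1) in \<open>auto intro!: hs Cc_pos_add Cc_pos_scale\<close>)
        also have "\<dots> = v b + d * I h"
          using Iadd[OF hs[OF ab(2)] Cc_pos_scale[OF h(1), of d]] Iscale[OF h(1) d] d by (simp add: v_def)
        finally show ?thesis .
      qed
      have "\<bar>v s - v t\<bar> \<le> d * I h"
        using step[OF s tG] step[OF tG s] le by (simp add: abs_minus_commute abs_le_iff)
      also have "\<dots> < d * (I h + 1)" using d by simp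
      also have "\<dots> = e" using Inn[OF h(1)] by (simp add: d_def add_nonneg_eq_0_iff)
      finally show ?thesis by (simp add: dist_real_def)
    qed
    ultimately show "\<exists>U. openin (topo G) U \<and> s \<in> U \<and> (\<forall>y\<in>U. v y \<in> Met_TC.mball (v s) e)"
      by auto
  qed
  have v_supp: "v t = 0" if t: "t \<in> carrier G - K" for t
  proof -
    have "h x * shift t h x = 0" if x: "x \<in> carrier G" for x
    proof (rule ccontr)
      assume "h x * shift t h x \<noteq> 0"
      then have "x \<in> N" "inv t \<otimes> x \<in> N" using h(3) t x by (auto simp: shift_def)
      then have "\<one> \<otimes> x \<otimes> inv (inv t \<otimes> x) \<in> K" using AK N(3) by blast
      moreover have "\<one> \<otimes> x \<otimes> inv (inv t \<otimes> x) = t"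
        using t x by (simp add: inv_mult_group) (simp flip: m_assoc)
      ultimately show False using t by simp
    qed
    then have "v t = I (\<lambda>x. 0)" unfolding v_def using t by (intro Icong hs zero) auto
    then show ?thesis using I0 by simp
  qed
  have v1: "v \<one> = 1"
  proof -
    have "v \<one> = I f0"
      unfolding v_def using f0 by (intro Icong hs bumpsD) (auto simp: f0_def shift_def)
    then show ?thesis using I1 by simp
  qed
  have v_ip: "v (inv b \<otimes> a) = I (\<lambda>x. shift b h x * shift a h x)" if a: "a \<in> carrier G" and b: "b \<in> carrier G" for a b
  proof -
    have "I (\<lambda>x. shift b h x * shift a h x) = I (shift b (\<lambda>x. h x * shift (inv b \<otimes> a) h x))"
    proof (rule Icong)
      show "shift b h x * shift a h x = shift b (\<lambda>x. h x * shift (inv b \<otimes> a) h x) x" if x: "x \<in> carrier G" for x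
      proof -
        have "b \<otimes> (inv b \<otimes> x) = x" using b x by (simp flip: m_assoc)
        then have "inv (inv b \<otimes> a) \<otimes> (inv b \<otimes> x) = inv a \<otimes> x"
          using a b x by (simp add: inv_mult_group m_assoc)
        then show ?thesis by (simp add: shift_def)
      qed
    qed (use a b h(1) in \<open>auto intro!: Cc_pos_shift Cc_pos_mult hs\<close>)
    then show ?thesis using a b by (simp add: Ishift hs v_def)
  qed
  \<comment> \<open>The terms are grouped by sign because \<open>I\<close> is only available on nonnegative functions.\<close>
  have psd: "0 \<le> (\<Sum>i<n. \<Sum>j<n. a i * a j * v (inv (s j) \<otimes> s i))"
    if s: "\<forall>i<n. s i \<in> carrier G" for n :: nat and a :: "nat \<Rightarrow> real" and s
  proof -
    define B where "B = {..<n} \<times> {..<n}"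
    define w where "w p = a (fst p) * a (snd p)" for p
    define F where "F p = (\<lambda>x. shift (s (snd p)) h x * shift (s (fst p)) h x)" for p
    define P M where "P = {p \<in> B. 0 \<le> w p}" and "M = {p \<in> B. w p < 0}"
    have FC: "F p \<in> Cc_pos" if "p \<in> B" for p
      using that s h(1) unfolding F_def B_def by (intro Cc_pos_mult Cc_pos_shift) auto
    have fin: "finite P" "finite M" "finite B" "P \<inter> M = {}" "B = P \<union> M" by (auto simp: P_def M_def B_def)
    have sP: "(\<lambda>x. \<Sum>p\<in>P. w p * F p x) \<in> Cc_pos \<and> I (\<lambda>x. \<Sum>p\<in>P. w p * F p x) = (\<Sum>p\<in>P. I (\<lambda>x. w p * F p x))"
      by (rule Isum[OF fin(1)]) (auto simp: P_def intro!: Cc_pos_scale FC)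
    have sM: "(\<lambda>x. \<Sum>p\<in>M. (- w p) * F p x) \<in> Cc_pos \<and> I (\<lambda>x. \<Sum>p\<in>M. (- w p) * F p x) = (\<Sum>p\<in>M. I (\<lambda>x. (- w p) * F p x))"
      by (rule Isum[OF fin(2)]) (rule Cc_pos_scale, auto simp: M_def intro!: FC)
    have "(\<Sum>p\<in>M. (- w p) * F p x) \<le> (\<Sum>p\<in>P. w p * F p x)" if "x \<in> carrier G" for x
    proof -
      \<comment> \<open>The square expands into all terms \<open>w p * F p x\<close>; moving those
        of negative weight to the other side leaves an inequality inside the cone.\<close>
      have "0 \<le> (\<Sum>i<n. a i * shift (s i) h x)\<^sup>2" by simp
      also have "\<dots> = (\<Sum>p\<in>B. w p * F p x)"
        unfolding power2_eq_square sum_product B_def sum.cartesian_product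
        by (intro sum.cong) (auto simp: w_def F_def)
      also have "\<dots> = (\<Sum>p\<in>P. w p * F p x) + (\<Sum>p\<in>M. w p * F p x)"
        unfolding fin(5) by (rule sum.union_disjoint[OF fin(1,2,4)])
      finally show ?thesis by (simp add: sum_negf)
    qed
    then have "I (\<lambda>x. \<Sum>p\<in>M. (- w p) * F p x) \<le> I (\<lambda>x. \<Sum>p\<in>P. w p * F p x)"
      using sP sM by (intro Imono) auto
    then have "(\<Sum>p\<in>M. I (\<lambda>x. (- w p) * F p x)) \<le> (\<Sum>p\<in>P. I (\<lambda>x. w p * F p x))" using sP sM by simp
    moreover have "(\<Sum>p\<in>M. I (\<lambda>x. (- w p) * F p x)) = (\<Sum>p\<in>M. (- w p) * I (F p))"
      by (intro sum.cong refl Iscale0 FC) (auto simp: M_def)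
    moreover have "(\<Sum>p\<in>P. I (\<lambda>x. w p * F p x)) = (\<Sum>p\<in>P. w p * I (F p))"
      by (intro sum.cong refl Iscale0 FC) (auto simp: P_def)
    ultimately have "0 \<le> (\<Sum>p\<in>P. w p * I (F p)) + (\<Sum>p\<in>M. w p * I (F p))" by (simp add: sum_negf)
    also have "\<dots> = (\<Sum>p\<in>B. w p * I (F p))"
      unfolding fin(5) by (rule sum.union_disjoint[OF fin(1,2,4), symmetric])
    also have "\<dots> = (\<Sum>i<n. \<Sum>j<n. a i * a j * v (inv (s j) \<otimes> s i))"
      unfolding B_def sum.cartesian_product using s
      by (intro sum.cong) (auto simp: w_def F_def v_ip)
    finally show ?thesis .
  qed
  define u where "u = (\<lambda>s\<in>carrier G. complex_of_real (v s))"
  have "u \<in> normalized_positive_definite G"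
    unfolding normalized_positive_definite_def
  proof (intro CollectI conjI allI impI)
    show "continuous_map (topo G) euclidean u"
    proof (rule continuous_map_eq)
      show "continuous_map (topo G) euclidean (complex_of_real \<circ> v)"
        by (rule continuous_map_compose[OF cont]) (auto intro: continuous_intros)
    qed (simp add: u_def topspace_topo)
    show "u \<one> = 1" by (simp add: u_def v1)
    fix n :: nat and c :: "nat \<Rightarrow> complex" and s assume s: "\<forall>i<n. s i \<in> carrier G"
    define m where "m i j = v (inv (s j) \<otimes> s i)" for i j
    \<comment> \<open>For a real symmetric matrix the imaginary part of the form cancels and its
      real part is the sum of the forms at the real and the imaginary parts of
      \<open>c\<close>.\<close>
    have sym: "m i j = m j i" if "i < n" "j < n" for i j
      using that s by (simp add: m_def v_ip mult.commute)
    have "(\<Sum>i<n. \<Sum>j<n. c i * cnj (c j) * u (inv (s j) \<otimes> s i)) = (\<Sum>i<n. \<Sum>j<n. c i * cnj (c j) * of_real (m i j))"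
      using s by (intro sum.cong refl) (auto simp: u_def m_def)
    moreover have "Re (\<Sum>i<n. \<Sum>j<n. c i * cnj (c j) * of_real (m i j)) =
      (\<Sum>i<n. \<Sum>j<n. Re (c i) * Re (c j) * m i j) + (\<Sum>i<n. \<Sum>j<n. Im (c i) * Im (c j) * m i j)"
      by (simp add: sum.distrib[symmetric] distrib_right)
    moreover have "Im (\<Sum>i<n. \<Sum>j<n. c i * cnj (c j) * of_real (m i j)) = 0"
    proof -
      have "Im (\<Sum>i<n. \<Sum>j<n. c i * cnj (c j) * of_real (m i j)) =
        (\<Sum>i<n. \<Sum>j<n. Im (c i) * Re (c j) * m i j) - (\<Sum>i<n. \<Sum>j<n. Re (c i) * Im (c j) * m i j)"
        by (simp add: sum_subtractf[symmetric] left_diff_distrib[symmetric])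
      also have "(\<Sum>i<n. \<Sum>j<n. Re (c i) * Im (c j) * m i j) = (\<Sum>j<n. \<Sum>i<n. Re (c i) * Im (c j) * m i j)"
        by (rule sum.swap)
      also have "\<dots> = (\<Sum>i<n. \<Sum>j<n. Im (c i) * Re (c j) * m i j)"
        by (intro sum.cong refl) (auto simp: sym)
      finally show ?thesis by simp
    qed
    ultimately show "(\<Sum>i<n. \<Sum>j<n. c i * cnj (c j) * u (inv (s j) \<otimes> s i)) \<in> \<real>\<^sub>\<ge>\<^sub>0"
      using psd[OF s, of "\<lambda>i. Re (c i)"] psd[OF s, of "\<lambda>i. Im (c i)"]
      by (simp add: complex_nonneg_Reals_iff m_def)
  qed (simp add: u_def)
  moreover have "\<forall>t\<in>carrier G - K. u t = 0" using v_supp by (simp add: u_def)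
  ultimately show ?thesis using K by blast
qed

end

section \<open>The universal representation\<close>

context locally_compact_group
begin

text \<open>Finite sets larger than the supports are allowed, so that several functions can be
  summed over a common set.\<close>

lemma group_algebra_ip:
  assumes "finite A" "{s. f s \<noteq> 0} \<subseteq> A" "finite B" "{s. g s \<noteq> 0} \<subseteq> B"
  shows "ip (group_algebra_space G u) f g = (\<Sum>s\<in>A. \<Sum>t\<in>B. f s * cnj (g t) * u (inv t \<otimes> s))"
proof -
  have "ip (group_algebra_space G u) f g =
      (\<Sum>s\<in>{s. f s \<noteq> 0}. \<Sum>t\<in>{t. g t \<noteq> 0}. f s * cnj (g t) * u (inv t \<otimes> s))"
    by (simp add: group_algebra_space_def)
  also have "\<dots> = (\<Sum>s\<in>{s. f s \<noteq> 0}. \<Sum>t\<in>B. f s * cnj (g t) * u (inv t \<otimes> s))"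
    using assms by (intro sum.cong refl sum.mono_neutral_left) auto
  also have "\<dots> = (\<Sum>s\<in>A. \<Sum>t\<in>B. f s * cnj (g t) * u (inv t \<otimes> s))"
    using assms by (intro sum.mono_neutral_left) auto
  finally show ?thesis .
qed

lemma group_algebra_carrier:
  "f \<in> carrier (group_algebra_space G u) \<longleftrightarrow> finite {s. f s \<noteq> 0} \<and> {s. f s \<noteq> 0} \<subseteq> carrier G"
  by (simp add: group_algebra_space_def)

lemma semi_ip_group_algebra:
  assumes u: "u \<in> normalized_positive_definite G"
  shows "semi_ip_space (group_algebra_space G u)"
proof -
  let ?A = "group_algebra_space G u"
  have add: "f \<oplus>\<^bsub>?A\<^esub> g = (\<lambda>s. f s + g s)" for f g by (simp add: group_algebra_space_def)
  have smult: "c \<odot>\<^bsub>?A\<^esub> f = (\<lambda>s. c * f s)" for c f by (simp add: group_algebra_space_def)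
  have zero: "\<zero>\<^bsub>?A\<^esub> = (\<lambda>s. 0)" by (simp add: group_algebra_space_def)
  note c = group_algebra_carrier
  have add_closed: "(\<lambda>s. f s + g s) \<in> carrier ?A" if "f \<in> carrier ?A" "g \<in> carrier ?A" for f g
  proof -
    have sub: "{s. f s + g s \<noteq> 0} \<subseteq> {s. f s \<noteq> 0} \<union> {s. g s \<noteq> 0}" by auto
    have "finite ({s. f s \<noteq> 0} \<union> {s. g s \<noteq> 0})" using that by (simp add: c)
    then have "finite {s. f s + g s \<noteq> 0}" by (rule finite_subset[OF sub])
    then show ?thesis using that sub unfolding c by blast
  qed
  have smult_closed: "(\<lambda>s. a * f s) \<in> carrier ?A" if "f \<in> carrier ?A" for a f
  proof -
    have sub: "{s. a * f s \<noteq> 0} \<subseteq> {s. f s \<noteq> 0}" by auto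
    show ?thesis using that sub finite_subset[OF sub] unfolding c by blast
  qed
  have ip_add: "ip ?A (\<lambda>s. f s + g s) h = ip ?A f h + ip ?A g h" "ip ?A h (\<lambda>s. f s + g s) = ip ?A h f + ip ?A h g"
    if "f \<in> carrier ?A" "g \<in> carrier ?A" "h \<in> carrier ?A" for f g h
  proof -
    let ?F = "{s. f s \<noteq> 0} \<union> {s. g s \<noteq> 0}" and ?H = "{s. h s \<noteq> 0}"
    have fin: "finite ?F" "finite ?H" using that by (auto simp: c)
    have sub: "{s. f s \<noteq> 0} \<subseteq> ?F" "{s. g s \<noteq> 0} \<subseteq> ?F" "{s. f s + g s \<noteq> 0} \<subseteq> ?F" "?H \<subseteq> ?H" by auto
    show "ip ?A (\<lambda>s. f s + g s) h = ip ?A f h + ip ?A g h"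
      unfolding group_algebra_ip[OF fin(1) sub(1) fin(2) sub(4)] group_algebra_ip[OF fin(1) sub(2) fin(2) sub(4)]
        group_algebra_ip[OF fin(1) sub(3) fin(2) sub(4)]
      by (simp add: sum.distrib distrib_right)
    show "ip ?A h (\<lambda>s. f s + g s) = ip ?A h f + ip ?A h g"
      unfolding group_algebra_ip[OF fin(2) sub(4) fin(1) sub(1)] group_algebra_ip[OF fin(2) sub(4) fin(1) sub(2)]
        group_algebra_ip[OF fin(2) sub(4) fin(1) sub(3)]
      by (simp add: sum.distrib distrib_right distrib_left)
  qed
  have ip_smult: "ip ?A (\<lambda>s. a * f s) h = a * ip ?A f h" "ip ?A h (\<lambda>s. a * f s) = cnj a * ip ?A h f"
    if "f \<in> carrier ?A" "h \<in> carrier ?A" for a f h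
  proof -
    let ?F = "{s. f s \<noteq> 0}" and ?H = "{s. h s \<noteq> 0}"
    have fin: "finite ?F" "finite ?H" using that by (auto simp: c)
    have sub: "?F \<subseteq> ?F" "{s. a * f s \<noteq> 0} \<subseteq> ?F" "?H \<subseteq> ?H" by auto
    show "ip ?A (\<lambda>s. a * f s) h = a * ip ?A f h"
      unfolding group_algebra_ip[OF fin(1) sub(1) fin(2) sub(3)] group_algebra_ip[OF fin(1) sub(2) fin(2) sub(3)]
      by (simp add: sum_distrib_left mult.assoc)
    show "ip ?A h (\<lambda>s. a * f s) = cnj a * ip ?A h f"
      unfolding group_algebra_ip[OF fin(2) sub(3) fin(1) sub(1)] group_algebra_ip[OF fin(2) sub(3) fin(1) sub(2)]
      by (simp add: sum_distrib_left mult_ac)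
  qed
  have nonneg: "ip ?A f f \<in> \<real>\<^sub>\<ge>\<^sub>0" if f: "f \<in> carrier ?A" for f
  proof -
    let ?F = "{s. f s \<noteq> 0}"
    have fin: "finite ?F" and sub: "?F \<subseteq> carrier G" using f by (auto simp: c)
    \<comment> \<open>Positive definiteness is phrased for families indexed by numbers, so the
      support is enumerated.\<close>
    obtain n e where e: "bij_betw e {..<n::nat} ?F"
      using ex_bij_betw_nat_finite[OF fin] by (metis atLeast0LessThan)
    then have eG: "\<forall>i<n. e i \<in> carrier G" using sub bij_betwE by fastforce
    have "ip ?A f f = (\<Sum>s\<in>?F. \<Sum>t\<in>?F. f s * cnj (f t) * u (inv t \<otimes> s))"
      by (rule group_algebra_ip[OF fin subset_refl fin subset_refl])
    also have "\<dots> = (\<Sum>i<n. \<Sum>j<n. f (e i) * cnj (f (e j)) * u (inv (e j) \<otimes> e i))"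
      by (simp only: sum.reindex_bij_betw[OF e, symmetric])
    also have "\<dots> \<in> \<real>\<^sub>\<ge>\<^sub>0"
    proof -
      have "\<forall>(n :: nat) c s. (\<forall>i<n. s i \<in> carrier G) \<longrightarrow>
          (\<Sum>i<n. \<Sum>j<n. c i * cnj (c j) * u (inv s j \<otimes> s i)) \<in> \<real>\<^sub>\<ge>\<^sub>0"
        using u by (simp add: normalized_positive_definite_def)
      from this[THEN spec, THEN spec, THEN spec, THEN mp, OF eG] show ?thesis .
    qed
    finally show ?thesis .
  qed
  \<comment> \<open>Hermitian symmetry comes from positivity: the form is real at
    \<open>f + g\<close> and at \<open>\<i> * f + g\<close>, which gives the imaginary and the real
    parts.\<close>
  have commute: "ip ?A g f = cnj (ip ?A f g)" if f: "f \<in> carrier ?A" and g: "g \<in> carrier ?A" for f g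
  proof -
    have im: "Im (ip ?A h h) = 0" if "h \<in> carrier ?A" for h
      using nonneg[OF that] by (auto simp: complex_nonneg_Reals_iff)
    have "Im (ip ?A f g + ip ?A g f) = 0" if f: "f \<in> carrier ?A" for f
      using im[OF add_closed[OF f g]] im[OF f] im[OF g] ip_add[OF f g add_closed[OF f g]] ip_add[OF f g f] ip_add[OF f g g]
      by simp
    from this[OF f] this[OF smult_closed[OF f, of \<i>]] show ?thesis
      by (simp add: ip_smult[OF f g] complex_eq_iff)
  qed
  show ?thesis
    by (rule semi_ip_spaceI)
      (auto simp: add smult zero add_closed smult_closed ip_add ip_smult nonneg algebra_simps
         intro: commute simp: group_algebra_carrier[of "\<lambda>s. 0"])
qed

lemma support_left_translate:
  assumes s: "s \<in> carrier G" and f: "{t. f t \<noteq> 0} \<subseteq> carrier G"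
  shows "{t. left_translate G s f t \<noteq> 0} = (\<lambda>t. s \<otimes> t) ` {t. f t \<noteq> 0}"
proof
  show "(\<lambda>t. s \<otimes> t) ` {t. f t \<noteq> 0} \<subseteq> {t. left_translate G s f t \<noteq> 0}"
  proof clarify
    fix t assume t: "f t \<noteq> 0" "left_translate G s f (s \<otimes> t) = 0"
    then have "t \<in> carrier G" using f by blast
    then show False using s t by (simp add: left_translate_def flip: m_assoc)
  qed
  show "{t. left_translate G s f t \<noteq> 0} \<subseteq> (\<lambda>t. s \<otimes> t) ` {t. f t \<noteq> 0}"
  proof clarify
    fix t assume "left_translate G s f t \<noteq> 0"
    then have t: "t \<in> carrier G" "f (inv s \<otimes> t) \<noteq> 0" by (auto simp: left_translate_def split: if_splits)
    have "t = s \<otimes> (inv s \<otimes> t)" using s t by (simp flip: m_assoc)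
    then show "t \<in> (\<lambda>t. s \<otimes> t) ` {t. f t \<noteq> 0}" using t(2) by blast
  qed
qed

lemma group_algebra_ip_left_translate:
  assumes s: "s \<in> carrier G" and f: "f \<in> carrier (group_algebra_space G u)"
    and g: "finite B" "{s. g s \<noteq> 0} \<subseteq> B"
  shows "ip (group_algebra_space G u) (left_translate G s f) g =
    (\<Sum>a\<in>{t. f t \<noteq> 0}. \<Sum>b\<in>B. f a * cnj (g b) * u (inv b \<otimes> (s \<otimes> a)))"
proof -
  have F: "finite {t. f t \<noteq> 0}" "{t. f t \<noteq> 0} \<subseteq> carrier G" using f by (auto simp: group_algebra_carrier)
  have inj: "inj_on (\<lambda>t. s \<otimes> t) {t. f t \<noteq> 0}"
    using F(2) s by (intro inj_onI) (auto simp: subset_iff)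
  have "ip (group_algebra_space G u) (left_translate G s f) g =
     (\<Sum>a\<in>(\<lambda>t. s \<otimes> t) ` {t. f t \<noteq> 0}. \<Sum>b\<in>B. left_translate G s f a * cnj (g b) * u (inv b \<otimes> a))"
    by (rule group_algebra_ip[OF _ _ g]) (use F s in \<open>auto simp: support_left_translate\<close>)
  also have "\<dots> = (\<Sum>a\<in>{t. f t \<noteq> 0}. \<Sum>b\<in>B. left_translate G s f (s \<otimes> a) * cnj (g b) * u (inv b \<otimes> (s \<otimes> a)))"
    by (simp add: sum.reindex[OF inj])
  also have "\<dots> = (\<Sum>a\<in>{t. f t \<noteq> 0}. \<Sum>b\<in>B. f a * cnj (g b) * u (inv b \<otimes> (s \<otimes> a)))"
  proof (intro sum.cong refl)
    fix a b assume "a \<in> {t. f t \<noteq> 0}"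
    then have "a \<in> carrier G" using F(2) by blast
    then have "left_translate G s f (s \<otimes> a) = f a" using s by (simp add: left_translate_def flip: m_assoc)
    then show "left_translate G s f (s \<otimes> a) * cnj (g b) * u (inv b \<otimes> (s \<otimes> a)) = f a * cnj (g b) * u (inv b \<otimes> (s \<otimes> a))"
      by simp
  qed
  finally show ?thesis .
qed

text \<open>Isometry is (s b)^-1 (s a) = b^-1 a. Coefficients are finite combinations of two-sided
  translates of \<open>u\<close>, hence continuous.\<close>

lemma isometric_action_group_algebra:
  assumes u: "u \<in> normalized_positive_definite G"
  shows "isometric_action G (group_algebra_space G u) (left_translate G)"
proof -
  let ?A = "group_algebra_space G u"
  interpret A: semi_ip_space ?A by (rule semi_ip_group_algebra[OF u])
  note c = group_algebra_carrier
  have closed: "left_translate G s f \<in> carrier ?A" if "s \<in> carrier G" "f \<in> carrier ?A" for s f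
    using that by (auto simp: c support_left_translate)
  show ?thesis
  proof
    fix f g assume f: "f \<in> carrier ?A" and g: "g \<in> carrier ?A"
    have F: "finite {t. f t \<noteq> 0}" "{t. f t \<noteq> 0} \<subseteq> carrier G" using f by (auto simp: c)
    have Gs: "finite {t. g t \<noteq> 0}" "{t. g t \<noteq> 0} \<subseteq> carrier G" using g by (auto simp: c)
    show "left_translate G \<one> f = f"
      using F(2) by (auto simp: left_translate_def fun_eq_iff)
    show "left_translate G (s \<otimes> t) f = left_translate G s (left_translate G t f)"
      if "s \<in> carrier G" "t \<in> carrier G" for s t
      using that by (auto simp: left_translate_def fun_eq_iff inv_mult_group m_assoc)
    show "ip ?A (left_translate G s f) (left_translate G s g) = ip ?A f g" if s: "s \<in> carrier G" for s
    proof -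
      have inj: "inj_on (\<lambda>t. s \<otimes> t) {t. g t \<noteq> 0}"
        using Gs(2) s by (intro inj_onI) (auto simp: subset_iff)
      have "ip ?A (left_translate G s f) (left_translate G s g) =
        (\<Sum>a\<in>{t. f t \<noteq> 0}. \<Sum>b\<in>(\<lambda>t. s \<otimes> t) ` {t. g t \<noteq> 0}. f a * cnj (left_translate G s g b) * u (inv b \<otimes> (s \<otimes> a)))"
        by (rule group_algebra_ip_left_translate[OF s f]) (use Gs s in \<open>auto simp: support_left_translate\<close>)
      also have "\<dots> = (\<Sum>a\<in>{t. f t \<noteq> 0}. \<Sum>b\<in>{t. g t \<noteq> 0}. f a * cnj (left_translate G s g (s \<otimes> b)) * u (inv (s \<otimes> b) \<otimes> (s \<otimes> a)))"
        by (simp add: sum.reindex[OF inj])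
      also have "\<dots> = (\<Sum>a\<in>{t. f t \<noteq> 0}. \<Sum>b\<in>{t. g t \<noteq> 0}. f a * cnj (g b) * u (inv b \<otimes> a))"
      proof (intro sum.cong refl)
        fix a b assume "a \<in> {t. f t \<noteq> 0}" "b \<in> {t. g t \<noteq> 0}"
        then have ab: "a \<in> carrier G" "b \<in> carrier G" using F(2) Gs(2) by blast+
        have "left_translate G s g (s \<otimes> b) = g b" using s ab by (simp add: left_translate_def flip: m_assoc)
        moreover have "inv (s \<otimes> b) \<otimes> (s \<otimes> a) = inv b \<otimes> a"
        proof -
          have "inv s \<otimes> (s \<otimes> a) = a" using s ab by (simp flip: m_assoc)
          then show ?thesis using s ab by (simp add: inv_mult_group m_assoc)
        qed
        ultimately show "f a * cnj (left_translate G s g (s \<otimes> b)) * u (inv (s \<otimes> b) \<otimes> (s \<otimes> a)) = f a * cnj (g b) * u (inv b \<otimes> a)"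
          by simp
      qed
      also have "\<dots> = ip ?A f g" by (rule group_algebra_ip[OF F(1) subset_refl Gs(1) subset_refl, symmetric])
      finally show ?thesis .
    qed
    have uc: "continuous_map (topo G) euclidean u" using u by (simp add: normalized_positive_definite_def)
    have "continuous_map (topo G) euclidean (\<lambda>s. \<Sum>a\<in>{t. f t \<noteq> 0}. \<Sum>b\<in>{t. g t \<noteq> 0}. f a * cnj (g b) * u (inv b \<otimes> (s \<otimes> a)))"
    proof (intro continuous_map_sum continuous_map_complex_mult F Gs)
      fix a b assume "a \<in> {t. f t \<noteq> 0}" "b \<in> {t. g t \<noteq> 0}"
      then have ab: "a \<in> carrier G" "b \<in> carrier G" using F(2) Gs(2) by blast+
      have "continuous_map (topo G) (topo G) (\<lambda>s. inv b \<otimes> (s \<otimes> a))"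
        using ab by (intro continuous_map_mult) (auto simp: topspace_topo)
      from continuous_map_compose[OF this uc]
      show "continuous_map (topo G) euclidean (\<lambda>s. u (inv b \<otimes> (s \<otimes> a)))" by (simp add: o_def)
    qed auto
    then show "continuous_map (topo G) euclidean (\<lambda>s. ip ?A (left_translate G s f) g)"
      by (rule continuous_map_eq) (simp add: group_algebra_ip_left_translate[OF _ f Gs(1) subset_refl] topspace_topo)
  qed (auto simp: closed topspace_topo)
qed

lemma isometric_action_gns:
  assumes u: "u \<in> normalized_positive_definite G"
  shows "isometric_action G (gns_space G u) (gns_rep G u)"
  unfolding gns_space_def gns_rep_def
  by (intro isometric_action.isometric_action_separation isometric_action.isometric_action_cauchy_space
    isometric_action_group_algebra u)

lemma definite_gns:
  "u \<in> normalized_positive_definite G \<Longrightarrow> definite_ip_space (gns_space G u)"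
  unfolding gns_space_def
  by (intro semi_ip_space.definite_separation semi_ip_space.semi_ip_cauchy_space semi_ip_group_algebra)

lemma family_gns: "isometric_action_family G (normalized_positive_definite G) (gns_space G) (gns_rep G)"
  by (intro isometric_action_family.intro isometric_action_gns definite_gns topspace_topo is_group)

section \<open>The universal representation as a unitary action that separates\<close>

lemma universal_rep_eq:
  "universal_rep G = isometric_action_family.sum_action (normalized_positive_definite G) (gns_space G) (gns_rep G)"
  by (rule ext) (simp add: universal_rep_def isometric_action_family.sum_action_def[OF family_gns] universal_space_def)

lemma unitary_action_universal: "unitary_action G (universal_space G) (universal_rep G)"
proof -
  interpret F: isometric_action_family G "normalized_positive_definite G" "gns_space G" "gns_rep G"
    by (rule family_gns)
  have "isometric_action G (universal_space G) (universal_rep G)"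
    using F.isometric_action_direct_sum by (simp add: universal_rep_eq universal_space_def)
  moreover have "definite_ip_space (universal_space G)"
    using F.definite_direct_sum by (simp add: universal_space_def)
  moreover have "universal_rep G s \<in> extensional (carrier (universal_space G))" for s
    by (simp add: universal_rep_def)
  ultimately show ?thesis
    by (intro unitary_action.intro unitary_action_axioms.intro) auto
qed

text \<open>The vector is the class of the constant Cauchy sequence at the unit mass of the
  identity; translation moves this mass to \<open>s\<close>, where the form with the original mass
  is \<open>u s\<close>.\<close>

lemma gns_cyclic_vector:
  assumes u: "u \<in> normalized_positive_definite G"
  shows "\<exists>x\<in>carrier (gns_space G u). \<forall>s\<in>carrier G. ip (gns_space G u) (gns_rep G u s x) x = u s"
proof -
  let ?A = "group_algebra_space G u"
  define d :: "'a \<Rightarrow> complex" where "d = (\<lambda>s. if s = \<one> then 1 else 0)"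
  have supp: "{s. d s \<noteq> 0} = {\<one>}" by (auto simp: d_def)
  have d: "d \<in> carrier ?A" by (simp add: group_algebra_carrier supp)
  interpret A: isometric_action G ?A "left_translate G" by (rule isometric_action_group_algebra[OF u])
  interpret C: isometric_action G "cauchy_space ?A" "\<lambda>s X n. left_translate G s (X n)"
    by (rule A.isometric_action_cauchy_space)
  have const: "(\<lambda>n. f) \<in> carrier (cauchy_space ?A)" if "f \<in> carrier ?A" for f
    by (rule A.V.cauchy_spaceI) (use that in \<open>auto simp: A.V.ip_norm_minus\<close>)
  let ?x = "null_class (cauchy_space ?A) (\<lambda>n. d)"
  have "ip (gns_space G u) (gns_rep G u s ?x) ?x = u s" if s: "s \<in> carrier G" for s
  proof -
    have L: "left_translate G s d \<in> carrier ?A" using s d by (rule A.closed)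
    have "ip (gns_space G u) (gns_rep G u s ?x) ?x = ip (cauchy_space ?A) (\<lambda>n. left_translate G s d) (\<lambda>n. d)"
      unfolding gns_space_def gns_rep_def
      using C.separation_map_null_class[OF s const[OF d]] C.V.ip_separation[OF const[OF L] const[OF d]] by simp
    also have "\<dots> = ip ?A (left_translate G s d) d" by (simp add: cauchy_space_def)
    also have "\<dots> = u s"
      using s group_algebra_ip_left_translate[OF s d, of "{\<one>}" d] by (simp add: supp) (simp add: d_def)
    finally show ?thesis .
  qed
  moreover have "?x \<in> carrier (gns_space G u)"
    using const[OF d] by (simp add: gns_space_def C.V.carrier_separation)
  ultimately show ?thesis by blast
qed

end

text \<open>Extension by zero makes coefficients of a summand available as coefficients of the
  direct sum.\<close>

lemma (in ip_space_family) direct_sum_single: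
  assumes i: "i \<in> I" and x: "x \<in> carrier (V i)"
  shows "\<exists>\<xi>\<in>carrier D. \<xi> i = x \<and> (\<forall>\<eta>\<in>carrier D. ip D \<eta> \<xi> = ip (V i) (\<eta> i) x)"
proof -
  define \<xi> where "\<xi> = (\<lambda>j\<in>I. if j = i then x else \<zero>\<^bsub>V j\<^esub>)"
  have n: "ip_norm (V j) (\<xi> j) = 0" if "j \<in> I" "j \<noteq> i" for j
    using semi_ip_space.ip_norm_zero[OF fam_semi[OF that(1)]] that by (simp add: \<xi>_def)
  have c: "\<xi> j \<in> carrier (V j)" if "j \<in> I" for j
  proof -
    interpret semi_ip_space "V j" by (rule fam_semi[OF that])
    show ?thesis using x that by (auto simp: \<xi>_def)
  qed
  have "(\<lambda>j. (ip_norm (V j) (\<xi> j))\<^sup>2) summable_on I \<longleftrightarrow> (\<lambda>j. (ip_norm (V j) (\<xi> j))\<^sup>2) summable_on {i}"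
    by (rule summable_on_cong_neutral) (use i n in auto)
  then have "\<xi> \<in> carrier D" using c by (auto simp: carrier_direct_sum_iff \<xi>_def)
  moreover have "ip D \<eta> \<xi> = ip (V i) (\<eta> i) x" if \<eta>: "\<eta> \<in> carrier D" for \<eta>
  proof -
    have "ip (V j) (\<eta> j) (\<xi> j) = 0" if "j \<in> I" "j \<noteq> i" for j
    proof -
      interpret semi_ip_space "V j" by (rule fam_semi[OF that(1)])
      show ?thesis using \<eta> that by (simp add: \<xi>_def carrier_direct_sum_iff)
    qed
    then have "(\<Sum>\<^sub>\<infinity>j\<in>I. ip (V j) (\<eta> j) (\<xi> j)) = (\<Sum>\<^sub>\<infinity>j\<in>{i}. ip (V j) (\<eta> j) (\<xi> j))"
      using i by (intro infsum_cong_neutral) auto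
    then show ?thesis using i by (simp add: ip_direct_sum \<xi>_def)
  qed
  moreover have "\<xi> i = x" using i by (simp add: \<xi>_def)
  ultimately show ?thesis by blast
qed

context locally_compact_group
begin

text \<open>A positive definite function supported in the translate of \<open>U\<close> to the
  identity is shifted back to \<open>s\<close>: it becomes the coefficient of a vector \<xi> of the
  corresponding summand and its translate by \<open>s\<close>.\<close>

lemma separating_universal: "separating G (universal_space G) (universal_rep G)"
  unfolding separating_def
proof (intro allI impI, elim conjE)
  fix s U assume U: "openin (topo G) U" and sU: "s \<in> U"
  have UG: "U \<subseteq> carrier G" using openin_subset[OF U] by (simp add: topspace_topo)
  have s: "s \<in> carrier G" using sU UG by blast
  have "\<one> \<in> inv s <# U" using sU s UG by (simp add: l_coset_eq)
  from positive_definite_small_support[OF openin_l_coset[OF inv_closed[OF s] U] this]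
  obtain u K where u: "u \<in> normalized_positive_definite G" and K: "compactin (topo G) K" "K \<subseteq> inv s <# U"
    and uK: "\<forall>t\<in>carrier G - K. u t = 0" by (elim bexE exE conjE)
  interpret F: isometric_action_family G "normalized_positive_definite G" "gns_space G" "gns_rep G"
    by (rule family_gns)
  interpret A: unitary_action G "universal_space G" "universal_rep G" by (rule unitary_action_universal)
  obtain x where x: "x \<in> carrier (gns_space G u)" "\<forall>t\<in>carrier G. ip (gns_space G u) (gns_rep G u t x) x = u t"
    using gns_cyclic_vector[OF u] by (elim bexE)
  obtain \<xi> where \<xi>: "\<xi> \<in> carrier (universal_space G)" "\<xi> u = x"
    and ip\<xi>: "\<forall>\<eta>\<in>carrier (universal_space G). ip (universal_space G) \<eta> \<xi> = ip (gns_space G u) (\<eta> u) x"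
    using F.direct_sum_single[OF u x(1)] unfolding universal_space_def by (elim bexE conjE)
  have coeff: "ip (universal_space G) (universal_rep G t \<xi>) \<xi> = u t" if t: "t \<in> carrier G" for t
    using ip\<xi> A.closed[OF t \<xi>(1)] x(2) t u \<xi> by (simp add: universal_rep_def)
  define f where "f = (\<lambda>t\<in>carrier G. ip (universal_space G) (universal_rep G t \<xi>) (universal_rep G s \<xi>))"
  have f: "f t = u (inv s \<otimes> t)" if t: "t \<in> carrier G" for t
  proof -
    have ts: "universal_rep G t \<xi> = universal_rep G s (universal_rep G (inv s \<otimes> t) \<xi>)"
      using s t \<xi>(1) by (simp add: A.mult A.closed)
    have "f t = ip (universal_space G) (universal_rep G t \<xi>) (universal_rep G s \<xi>)"
      using t by (simp add: f_def)
    also have "\<dots> = ip (universal_space G) (universal_rep G (inv s \<otimes> t) \<xi>) \<xi>"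
      unfolding ts using t s \<xi>(1) by (intro A.isometry A.closed) auto
    finally show ?thesis using coeff s t by simp
  qed
  have "f \<in> eberlein_algebra G (universal_space G) (universal_rep G)"
    unfolding f_def using \<xi>(1) s by (intro coefficient_in_eberlein single_coefficient A.closed)
  moreover have "f s \<noteq> 0"
    using f[OF s] u s by (simp add: normalized_positive_definite_def)
  moreover have "compactin (topo G) ((\<lambda>t. s \<otimes> t) ` K)"
    by (rule image_compactin[OF K(1) continuous_map_translate[OF s]])
  moreover have "(\<lambda>t. s \<otimes> t) ` K \<subseteq> U"
    using K(2) s UG by (auto simp: l_coset_eq subset_iff)
  moreover have "f t = 0" if t: "t \<in> carrier G - (\<lambda>t. s \<otimes> t) ` K" for t
  proof -
    have "t = s \<otimes> (inv s \<otimes> t)" using s t by (simp flip: m_assoc)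
    then have "inv s \<otimes> t \<notin> K" using t by blast
    then show ?thesis using uK f[of t] s t by simp
  qed
  ultimately show "\<exists>f\<in>eberlein_algebra G (universal_space G) (universal_rep G). f s \<noteq> 0 \<and>
      (\<exists>K. compactin (topo G) K \<and> K \<subseteq> U \<and> (\<forall>t\<in>carrier G - K. f t = 0))" by blast
qed

end
section \<open>Intertwining isometries\<close>

text \<open>Surjectivity and preservation of the form stand in for unitarity, so that the
  semidefinite stages of the construction are included; on definite spaces linearity
  follows.\<close>

definition intertwines ::
    "'a set \<Rightarrow> ('v, 'm) ip_space_scheme \<Rightarrow> ('a \<Rightarrow> 'v \<Rightarrow> 'v) \<Rightarrow>
      ('w, 'n) ip_space_scheme \<Rightarrow> ('b \<Rightarrow> 'w \<Rightarrow> 'w) \<Rightarrow> ('a \<Rightarrow> 'b) \<Rightarrow> ('v \<Rightarrow> 'w) \<Rightarrow> bool"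
  where "intertwines S V T W R \<phi> \<tau> \<longleftrightarrow> \<tau> ` carrier V = carrier W \<and>
    (\<forall>x\<in>carrier V. \<forall>y\<in>carrier V. ip W (\<tau> x) (\<tau> y) = ip V x y) \<and>
    (\<forall>s\<in>S. \<forall>x\<in>carrier V. \<tau> (T s x) = R (\<phi> s) (\<tau> x))"

lemma intertwinesD:
  assumes "intertwines S V T W R \<phi> \<tau>"
  shows "\<tau> ` carrier V = carrier W"
    and "x \<in> carrier V \<Longrightarrow> \<tau> x \<in> carrier W"
    and "\<lbrakk>x \<in> carrier V; y \<in> carrier V\<rbrakk> \<Longrightarrow> ip W (\<tau> x) (\<tau> y) = ip V x y"
    and "\<lbrakk>s \<in> S; x \<in> carrier V\<rbrakk> \<Longrightarrow> \<tau> (T s x) = R (\<phi> s) (\<tau> x)"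
  using assms unfolding intertwines_def by auto

lemma intertwines_cauchy_space:
  assumes "semi_ip_space V" "semi_ip_space W" and \<tau>: "intertwines S V T W R \<phi> \<tau>"
  shows "intertwines S (cauchy_space V) (\<lambda>s X n. T s (X n)) (cauchy_space W) (\<lambda>s X n. R s (X n)) \<phi> (\<lambda>X n. \<tau> (X n))"
proof -
  interpret V: semi_ip_space V by fact
  interpret W: semi_ip_space W by fact
  note c = V.cauchy_space_closed and d = intertwinesD[OF \<tau>]
  note iso = cauchy_space_isometry[OF assms(1,2) d(2,3)]
  have "Y \<in> (\<lambda>X n. \<tau> (X n)) ` carrier (cauchy_space V)" if Y: "Y \<in> carrier (cauchy_space W)" for Y
  proof -
    have "\<forall>n. \<exists>x. x \<in> carrier V \<and> \<tau> x = Y n"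
      using W.cauchy_space_closed[OF Y] d(1) by (metis imageE)
    then obtain X where X: "\<And>n. X n \<in> carrier V \<and> \<tau> (X n) = Y n" by metis
    then have "X \<in> carrier (cauchy_space V)" using Y iso[of X] by simp
    moreover have "Y = (\<lambda>n. \<tau> (X n))" using X by auto
    ultimately show ?thesis by blast
  qed
  moreover have "(\<lambda>n. \<tau> (X n)) \<in> carrier (cauchy_space W)" if "X \<in> carrier (cauchy_space V)" for X
    using iso[of X] c[OF that] that by simp
  ultimately have "(\<lambda>X n. \<tau> (X n)) ` carrier (cauchy_space V) = carrier (cauchy_space W)"
    by (intro subset_antisym subsetI) (erule imageE, simp)
  moreover have "ip (cauchy_space W) (\<lambda>n. \<tau> (X n)) (\<lambda>n. \<tau> (Y n)) = ip (cauchy_space V) X Y"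
    if "X \<in> carrier (cauchy_space V)" "Y \<in> carrier (cauchy_space V)" for X Y
    using c[OF that(1)] c[OF that(2)] by (simp add: cauchy_space_def d(3))
  moreover have "(\<lambda>n. \<tau> (T s (X n))) = (\<lambda>n. R (\<phi> s) (\<tau> (X n)))"
    if "s \<in> S" "X \<in> carrier (cauchy_space V)" for s X
    using c[OF that(2)] that(1) by (simp add: d(4))
  ultimately show ?thesis unfolding intertwines_def by (intro conjI ballI) assumption+
qed

text \<open>Isometries respect null classes, so the induced map on classes does not depend on the
  representatives.\<close>

lemma intertwines_separation:
  fixes G :: "('a, 'g) top_monoid_scheme" and H :: "('b, 'h) top_monoid_scheme"
  assumes "isometric_action G V T" "isometric_action H W R" and \<phi>: "\<And>s. s \<in> carrier G \<Longrightarrow> \<phi> s \<in> carrier H"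
    and \<tau>: "intertwines (carrier G) V T W R \<phi> \<tau>"
  shows "\<exists>\<tau>'. intertwines (carrier G) (separation V) (\<lambda>s. separation_map V (T s))
    (separation W) (\<lambda>s. separation_map W (R s)) \<phi> \<tau>'"
proof -
  interpret A: isometric_action G V T by fact
  interpret B: isometric_action H W R by fact
  note d = intertwinesD[OF \<tau>]
  define \<tau>' where "\<tau>' = (\<lambda>A. null_class W (\<tau> (class_rep A)))"
  have t: "\<tau>' (null_class V x) = null_class W (\<tau> x)" if x: "x \<in> carrier V" for x
    unfolding \<tau>'_def
  proof (rule null_class_isometry[OF A.V.semi_ip_space_axioms B.V.semi_ip_space_axioms d(2,3)])
    show "null_class V (class_rep (null_class V x)) = null_class V x"
      by (rule A.V.null_class_class_rep) (simp add: A.V.carrier_separation x)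
  qed (simp_all add: x A.V.class_rep_closed)
  have rep: "\<exists>x\<in>carrier V. A = null_class V x" if "A \<in> carrier (separation V)" for A
    using that by (auto simp: A.V.carrier_separation)
  have "\<tau>' ` carrier (separation V) = (\<lambda>x. null_class W (\<tau> x)) ` carrier V"
    unfolding A.V.carrier_separation image_image by (rule image_cong[OF refl t])
  also have "\<dots> = carrier (separation W)"
    by (simp only: B.V.carrier_separation d(1)[symmetric] image_image)
  finally have "\<tau>' ` carrier (separation V) = carrier (separation W)" .
  moreover have "ip (separation W) (\<tau>' A) (\<tau>' B) = ip (separation V) A B"
    if AB: "A \<in> carrier (separation V)" "B \<in> carrier (separation V)" for A B
  proof -
    obtain x y where xy: "x \<in> carrier V" "y \<in> carrier V" and [simp]: "A = null_class V x" "B = null_class V y"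
      using rep[OF AB(1)] rep[OF AB(2)] by (elim bexE)
    show ?thesis using xy by (simp add: t A.V.ip_separation B.V.ip_separation d(2,3))
  qed
  moreover have "\<tau>' (separation_map V (T s) A) = separation_map W (R (\<phi> s)) (\<tau>' A)"
    if s: "s \<in> carrier G" and A: "A \<in> carrier (separation V)" for s A
  proof -
    obtain x where x: "x \<in> carrier V" and [simp]: "A = null_class V x"
      using rep[OF A] by (elim bexE)
    show ?thesis
      using s x by (simp add: t A.separation_map_null_class B.separation_map_null_class A.closed \<phi> d(2,4))
  qed
  ultimately show ?thesis unfolding intertwines_def by (intro exI[of _ \<tau>'] conjI ballI) assumption+
qed

text \<open>The bijection of index sets runs against \<open>\<phi>\<close>, since positive definite
  functions are pulled back.\<close>

lemma intertwines_direct_sum: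
  assumes "isometric_action_family G I V T" "isometric_action_family H J W R"
    and \<phi>: "\<And>s. s \<in> carrier G \<Longrightarrow> \<phi> s \<in> carrier H"
    and \<theta>: "bij_betw \<theta> J I"
    and \<tau>: "\<And>j. j \<in> J \<Longrightarrow> intertwines (carrier G) (V (\<theta> j)) (T (\<theta> j)) (W j) (R j) \<phi> (\<tau> j)"
  shows "intertwines (carrier G) (direct_sum I V) (isometric_action_family.sum_action I V T)
    (direct_sum J W) (isometric_action_family.sum_action J W R) \<phi> (\<lambda>\<xi>. \<lambda>j\<in>J. \<tau> j (\<xi> (\<theta> j)))"
proof -
  interpret A: isometric_action_family G I V T by fact
  interpret B: isometric_action_family H J W R by fact
  let ?\<tau> = "\<lambda>\<xi>. \<lambda>j\<in>J. \<tau> j (\<xi> (\<theta> j))"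
  note d = intertwinesD[OF \<tau>]
  have \<theta>I: "\<theta> j \<in> I" if "j \<in> J" for j using \<theta> that by (rule bij_betwE[rule_format])
  have n: "ip_norm (W j) (\<tau> j x) = ip_norm (V (\<theta> j)) x" if "j \<in> J" "x \<in> carrier (V (\<theta> j))" for j x
    using d(3)[OF that(1) that(2) that(2)] by (simp add: ip_norm_def)
  have closed: "?\<tau> \<xi> \<in> carrier B.D" if \<xi>: "\<xi> \<in> carrier A.D" for \<xi>
  proof -
    have "(\<lambda>j. (ip_norm (V (\<theta> j)) (\<xi> (\<theta> j)))\<^sup>2) summable_on J"
      using summable_on_reindex_bij_betw[OF \<theta>, of "\<lambda>i. (ip_norm (V i) (\<xi> i))\<^sup>2"] \<xi> by (simp add: A.carrier_direct_sum_iff)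
    then show ?thesis
      using \<xi> \<theta>I d(2) n by (simp add: A.carrier_direct_sum_iff B.carrier_direct_sum_iff cong: summable_on_cong)
  qed
  have "\<eta> \<in> ?\<tau> ` carrier A.D" if \<eta>: "\<eta> \<in> carrier B.D" for \<eta>
  proof -
    have "\<forall>j\<in>J. \<exists>x. x \<in> carrier (V (\<theta> j)) \<and> \<tau> j x = \<eta> j"
    proof
      fix j assume j: "j \<in> J"
      then have "\<eta> j \<in> \<tau> j ` carrier (V (\<theta> j))" using \<eta> d(1)[OF j] by (simp add: B.carrier_direct_sum_iff)
      then show "\<exists>x. x \<in> carrier (V (\<theta> j)) \<and> \<tau> j x = \<eta> j" by (elim imageE) auto
    qed
    then obtain x where "\<forall>j\<in>J. x j \<in> carrier (V (\<theta> j)) \<and> \<tau> j (x j) = \<eta> j" unfolding bchoice_iff ..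
    then have x: "x j \<in> carrier (V (\<theta> j)) \<and> \<tau> j (x j) = \<eta> j" if "j \<in> J" for j using that by blast
    \<comment> \<open>The chosen preimages are indexed by \<open>J\<close> and are reindexed through
      the inverse of \<open>\<theta>\<close>.\<close>
    define \<xi> where "\<xi> = (\<lambda>i\<in>I. x (inv_into J \<theta> i))"
    have x\<xi>: "\<xi> (\<theta> j) = x j" if "j \<in> J" for j
      using that \<theta>I \<theta> by (simp add: \<xi>_def bij_betw_inv_into_left)
    have "\<xi> i \<in> carrier (V i)" if "i \<in> I" for i
    proof -
      have "inv_into J \<theta> i \<in> J" "\<theta> (inv_into J \<theta> i) = i"
        using that \<theta> by (auto simp: bij_betw_inv_into_right bij_betw_def intro: inv_into_into)
      then show ?thesis using x[of "inv_into J \<theta> i"] that by (simp add: \<xi>_def)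
    qed
    moreover have "(\<lambda>i. (ip_norm (V i) (\<xi> i))\<^sup>2) summable_on I"
    proof -
      have "(\<lambda>j. (ip_norm (V (\<theta> j)) (\<xi> (\<theta> j)))\<^sup>2) summable_on J \<longleftrightarrow> (\<lambda>j. (ip_norm (W j) (\<eta> j))\<^sup>2) summable_on J"
      proof (rule summable_on_cong)
        fix j assume j: "j \<in> J"
        show "(ip_norm (V (\<theta> j)) (\<xi> (\<theta> j)))\<^sup>2 = (ip_norm (W j) (\<eta> j))\<^sup>2"
          using n[OF j, of "x j"] x[OF j] by (simp add: x\<xi>[OF j])
      qed
      then show ?thesis
        using summable_on_reindex_bij_betw[OF \<theta>, of "\<lambda>i. (ip_norm (V i) (\<xi> i))\<^sup>2"] \<eta> by (simp add: B.carrier_direct_sum_iff)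
    qed
    ultimately have "\<xi> \<in> carrier A.D" by (simp add: A.carrier_direct_sum_iff \<xi>_def)
    moreover have "\<eta> = ?\<tau> \<xi>"
      using \<eta> x x\<xi> by (intro extensionalityI[of _ J]) (auto simp: B.carrier_direct_sum_iff)
    ultimately show ?thesis by blast
  qed
  then have "?\<tau> ` carrier A.D = carrier B.D" using closed by blast
  moreover have "ip B.D (?\<tau> \<xi>) (?\<tau> \<eta>) = ip A.D \<xi> \<eta>" if "\<xi> \<in> carrier A.D" "\<eta> \<in> carrier A.D" for \<xi> \<eta>
  proof -
    have "ip B.D (?\<tau> \<xi>) (?\<tau> \<eta>) = (\<Sum>\<^sub>\<infinity>j\<in>J. ip (V (\<theta> j)) (\<xi> (\<theta> j)) (\<eta> (\<theta> j)))"
      unfolding B.ip_direct_sum using that \<theta>I by (intro infsum_cong) (simp add: d(3) A.carrier_direct_sum_iff)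
    then show ?thesis
      using infsum_reindex_bij_betw[OF \<theta>, of "\<lambda>i. ip (V i) (\<xi> i) (\<eta> i)"] by (simp add: A.ip_direct_sum)
  qed
  moreover have "?\<tau> (A.sum_action s \<xi>) = B.sum_action (\<phi> s) (?\<tau> \<xi>)" if "s \<in> carrier G" "\<xi> \<in> carrier A.D" for s \<xi>
    using that closed[OF that(2)] \<theta>I
    by (auto simp: A.sum_action_def B.sum_action_def A.carrier_direct_sum_iff d(4) intro!: restrict_ext)
  ultimately show ?thesis unfolding intertwines_def by blast
qed

text \<open>Linearity of \<open>\<tau>\<close> is read off from inner products with images of
  vectors, and definiteness makes \<open>\<tau>\<close> injective, which carries linearity over to
  \<open>\<rho>\<close>.\<close>

lemma conjugate_bounded:
  assumes "definite_ip_space V" "definite_ip_space W"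
    and surj: "\<tau> ` carrier V = carrier W"
    and iso: "\<And>x y. \<lbrakk>x \<in> carrier V; y \<in> carrier V\<rbrakk> \<Longrightarrow> ip W (\<tau> x) (\<tau> y) = ip V x y"
    and \<rho>: "\<And>y. y \<in> carrier W \<Longrightarrow> \<rho> y \<in> carrier V \<and> \<tau> (\<rho> y) = y"
    and S: "S \<in> bounded_operators V"
  shows "(\<lambda>y\<in>carrier W. \<tau> (S (\<rho> y))) \<in> bounded_operators W"
proof -
  interpret V: definite_ip_space V by fact
  interpret W: definite_ip_space W by fact
  have \<tau>c: "\<tau> x \<in> carrier W" if "x \<in> carrier V" for x using surj that by blast
  have add: "\<tau> (x \<oplus>\<^bsub>V\<^esub> y) = \<tau> x \<oplus>\<^bsub>W\<^esub> \<tau> y" if xy: "x \<in> carrier V" "y \<in> carrier V" for x y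
  proof -
    have "ip W (\<tau> (x \<oplus>\<^bsub>V\<^esub> y)) z = ip W (\<tau> x \<oplus>\<^bsub>W\<^esub> \<tau> y) z" if z: "z \<in> carrier W" for z
    proof -
      have "z = \<tau> (\<rho> z)" "\<rho> z \<in> carrier V" using \<rho>[OF z] by auto
      then show ?thesis using xy \<tau>c iso[of _ "\<rho> z"] z by (simp add: V.ip_add_left W.ip_add_left)
    qed
    then show ?thesis using xy \<tau>c by (subst W.eq_iff_ip) auto
  qed
  have smult: "\<tau> (c \<odot>\<^bsub>V\<^esub> x) = c \<odot>\<^bsub>W\<^esub> \<tau> x" if x: "x \<in> carrier V" for c x
  proof -
    have "ip W (\<tau> (c \<odot>\<^bsub>V\<^esub> x)) z = ip W (c \<odot>\<^bsub>W\<^esub> \<tau> x) z" if z: "z \<in> carrier W" for z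
    proof -
      have "z = \<tau> (\<rho> z)" "\<rho> z \<in> carrier V" using \<rho>[OF z] by auto
      then show ?thesis using x \<tau>c iso[of _ "\<rho> z"] z by (simp add: V.ip_smult_left W.ip_smult_left)
    qed
    then show ?thesis using x \<tau>c by (subst W.eq_iff_ip) auto
  qed
  have n: "ip_norm W (\<tau> x) = ip_norm V x" if "x \<in> carrier V" for x using iso[OF that that] by (simp add: ip_norm_def)
  have inj: "x = y" if "x \<in> carrier V" "y \<in> carrier V" "\<tau> x = \<tau> y" for x y
    using that iso by (subst V.eq_iff_ip) (auto simp flip: iso)
  have \<rho>add: "\<rho> (x \<oplus>\<^bsub>W\<^esub> y) = \<rho> x \<oplus>\<^bsub>V\<^esub> \<rho> y" if "x \<in> carrier W" "y \<in> carrier W" for x y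
    using that \<rho>[of x] \<rho>[of y] \<rho>[of "x \<oplus>\<^bsub>W\<^esub> y"] by (intro inj) (auto simp: add)
  have \<rho>smult: "\<rho> (c \<odot>\<^bsub>W\<^esub> x) = c \<odot>\<^bsub>V\<^esub> \<rho> x" if "x \<in> carrier W" for c x
    using that \<rho>[of x] \<rho>[of "c \<odot>\<^bsub>W\<^esub> x"] by (intro inj) (auto simp: smult)
  have Sc: "S x \<in> carrier V" if "x \<in> carrier V" for x by (rule V.bounded_operators_closed[OF S that])
  have Sadd: "S (x \<oplus>\<^bsub>V\<^esub> y) = S x \<oplus>\<^bsub>V\<^esub> S y" if "x \<in> carrier V" "y \<in> carrier V" for x y
    using S that by (auto simp: bounded_operators_def)
  have Ssmult: "S (c \<odot>\<^bsub>V\<^esub> x) = c \<odot>\<^bsub>V\<^esub> S x" if "x \<in> carrier V" for x c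
    using S that by (auto simp: bounded_operators_def)
  obtain C where C: "\<forall>x\<in>carrier V. ip_norm V (S x) \<le> C * ip_norm V x"
    using S unfolding bounded_operators_def mem_Collect_eq by (elim conjE exE)
  have "ip_norm W (\<tau> (S (\<rho> y))) \<le> C * ip_norm W y" if y: "y \<in> carrier W" for y
  proof -
    have "ip_norm W y = ip_norm V (\<rho> y)" using n[of "\<rho> y"] \<rho>[OF y] by simp
    then show ?thesis using C \<rho>[OF y] Sc by (simp add: n)
  qed
  then show ?thesis
    unfolding bounded_operators_def using \<rho> Sc \<tau>c
    by (auto simp: \<rho>add \<rho>smult add smult Sadd Ssmult intro!: exI[of _ C])
qed

text \<open>Conjugation by \<open>\<tau>\<close> is a weak* homeomorphism between all bounded
  operators and carries \<open>T s\<close> to \<open>R (\<phi> s)\<close>; it therefore maps one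
  closure onto the other.\<close>

lemma top_isomorphic_compactifications:
  fixes G :: "('a, 'g) top_monoid_scheme" and H :: "('b, 'h) top_monoid_scheme"
  assumes "unitary_action G V T" "unitary_action H W R"
    and \<phi>: "\<phi> ` carrier G = carrier H" and \<tau>: "intertwines (carrier G) V T W R \<phi> \<tau>"
  shows "top_isomorphic (rep_compactification G V T) (rep_compactification H W R)"
proof -
  interpret A: unitary_action G V T by fact
  interpret B: unitary_action H W R by fact
  note d = intertwinesD[OF \<tau>]
  have inj: "x = y" if "x \<in> carrier V" "y \<in> carrier V" "\<tau> x = \<tau> y" for x y
    using that d(3) by (subst A.V.eq_iff_ip) (auto simp flip: d(3))
  define \<rho> where "\<rho> = inv_into (carrier V) \<tau>"
  have \<rho>: "\<rho> y \<in> carrier V" "\<tau> (\<rho> y) = y" if "y \<in> carrier W" for y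
    using that d(1) by (auto simp: \<rho>_def intro: inv_into_into f_inv_into_f)
  have \<rho>\<tau>: "\<rho> (\<tau> x) = x" if "x \<in> carrier V" for x
    using that by (intro inj \<rho> d(2)) (simp_all add: \<rho> d(2))
  have \<rho>iso: "ip V (\<rho> x) (\<rho> y) = ip W x y" if "x \<in> carrier W" "y \<in> carrier W" for x y
    using d(3)[of "\<rho> x" "\<rho> y"] that by (simp add: \<rho>)
  have \<rho>surj: "\<rho> ` carrier W = carrier V"
  proof
    show "carrier V \<subseteq> \<rho> ` carrier W"
    proof
      fix x assume "x \<in> carrier V"
      then show "x \<in> \<rho> ` carrier W" using \<rho>\<tau>[of x] d(2)[of x] by (metis imageI)
    qed
  qed (use \<rho>(1) in blast)
  define c where "c S = (\<lambda>y\<in>carrier W. \<tau> (S (\<rho> y)))" for S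
  define c' where "c' S = (\<lambda>x\<in>carrier V. \<rho> (S (\<tau> x)))" for S
  have c_bdd: "c S \<in> bounded_operators W" if "S \<in> bounded_operators V" for S
    unfolding c_def using that \<rho> d(1,3)
    by (intro conjugate_bounded[OF A.V.definite_ip_space_axioms B.V.definite_ip_space_axioms]) auto
  have c'_bdd: "c' S \<in> bounded_operators V" if "S \<in> bounded_operators W" for S
    unfolding c'_def using that \<rho>\<tau> \<rho>surj \<rho>iso d(2)
    by (intro conjugate_bounded[OF B.V.definite_ip_space_axioms A.V.definite_ip_space_axioms]) auto
  have cc': "c (c' S) = S" if "S \<in> bounded_operators W" for S
    using that B.V.bounded_operators_closed[OF that]
    by (intro extensionalityI[of _ "carrier W"]) (auto simp: c_def c'_def \<rho> bounded_operators_def PiE_def)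
  have c'c: "c' (c S) = S" if "S \<in> bounded_operators V" for S
    using that A.V.bounded_operators_closed[OF that]
    by (intro extensionalityI[of _ "carrier V"]) (auto simp: c_def c'_def \<rho>\<tau> d(2) bounded_operators_def PiE_def)
  have norm\<rho>: "ip_norm V (\<rho> y) = ip_norm W y" if "y \<in> carrier W" for y using \<rho>iso[OF that that] by (simp add: ip_norm_def)
  have norm\<tau>: "ip_norm W (\<tau> y) = ip_norm V y" if "y \<in> carrier V" for y using d(3)[OF that that] by (simp add: ip_norm_def)
  have "continuous_map (weak_star_topology V) (weak_star_topology W) c"
  proof (rule continuous_map_weak_star_conjugation[where a = \<rho> and b = \<rho>])
    show "ip W (c S y) z = ip V (S (\<rho> y)) (\<rho> z)"
      if "S \<in> bounded_operators V" "y \<in> carrier W" "z \<in> carrier W" for S y z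
      using d(3)[of "S (\<rho> y)" "\<rho> z"] that A.V.bounded_operators_closed \<rho> by (simp add: c_def)
  qed (use A.V.semi_ip_space_axioms B.V.semi_ip_space_axioms c_bdd \<rho> norm\<rho> in auto)
  moreover have "continuous_map (weak_star_topology W) (weak_star_topology V) c'"
  proof (rule continuous_map_weak_star_conjugation[where a = \<tau> and b = \<tau>])
    show "ip V (c' S y) z = ip W (S (\<tau> y)) (\<tau> z)"
      if "S \<in> bounded_operators W" "y \<in> carrier V" "z \<in> carrier V" for S y z
      using \<rho>iso[of "S (\<tau> y)" "\<tau> z"] that B.V.bounded_operators_closed d(2) \<rho>\<tau> by (simp add: c'_def)
  qed (use A.V.semi_ip_space_axioms B.V.semi_ip_space_axioms c'_bdd d(2) norm\<tau> in auto)
  ultimately have "homeomorphic_maps (weak_star_topology V) (weak_star_topology W) c c'"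
    using cc' c'c by (simp add: homeomorphic_maps_def)
  then have homeo: "homeomorphic_map (weak_star_topology V) (weak_star_topology W) c"
    by (rule homeomorphic_maps_imp_map)
  have cT: "c (T s) = R (\<phi> s)" if s: "s \<in> carrier G" for s
  proof (rule extensionalityI[of _ "carrier W"])
    show "R (\<phi> s) \<in> extensional (carrier W)" using s \<phi> by (intro B.extensional) blast
    show "c (T s) y = R (\<phi> s) y" if "y \<in> carrier W" for y
      using d(4)[OF s, of "\<rho> y"] that by (simp add: c_def \<rho>)
  qed (simp add: c_def)
  have img: "c ` T ` carrier G = R ` carrier H"
    unfolding \<phi>[symmetric] image_image by (rule image_cong) (auto simp: cT)
  have cl: "c ` A.cpt = B.cpt"
    unfolding img[symmetric]
    by (rule homeomorphic_map_closure_of[OF homeo, symmetric]) (use A.action_bounded in auto)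
  have sub: "A.cpt \<subseteq> bounded_operators V" "B.cpt \<subseteq> bounded_operators W"
    using A.closure_bounded B.closure_bounded by blast+
  have "homeomorphic_map (subtopology (weak_star_topology V) A.cpt) (subtopology (weak_star_topology W) B.cpt) c"
    by (rule homeomorphic_map_subtopologies[OF homeo]) (use sub cl in \<open>simp add: Int_absorb1\<close>)
  moreover have "c \<in> iso (rep_compactification G V T) (rep_compactification H W R)"
  proof -
    have "c (compose (carrier V) S S') = compose (carrier W) (c S) (c S')" if "S \<in> A.cpt" "S' \<in> A.cpt" for S S'
      using A.V.bounded_operators_closed[OF A.closure_bounded[OF that(2)]]
      by (intro extensionalityI[of _ "carrier W"]) (auto simp: c_def compose_def d(2) \<rho> \<rho>\<tau>)
    moreover have "inj_on c A.cpt"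
      by (rule inj_on_inverseI[where g = c']) (use c'c sub(1) in blast)
    then have "bij_betw c A.cpt B.cpt" using cl by (simp add: bij_betw_def)
    moreover have "c S \<in> B.cpt" if "S \<in> A.cpt" for S using cl that by blast
    ultimately show ?thesis by (simp add: iso_def hom_def)
  qed
  ultimately show ?thesis
    unfolding top_isomorphic_def rep_compactification_simps by (rule bexI)
qed

section \<open>Transport of the universal representation\<close>

text \<open>Functions are moved along \<open>\<psi>\<close>, which inverts \<open>\<phi>\<close>.
  The forms agree because \<open>v\<close> composed with \<open>\<phi>\<close> is \<open>u\<close>,
  applied to the quotients b^-1 a.\<close>

lemma intertwines_group_algebra:
  assumes "locally_compact_group G" "locally_compact_group H"
    and \<phi>: "\<phi> \<in> iso G H" and \<psi>: "\<And>h. h \<in> carrier H \<Longrightarrow> \<psi> h \<in> carrier G \<and> \<phi> (\<psi> h) = h"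
    and uv: "\<And>s. s \<in> carrier G \<Longrightarrow> v (\<phi> s) = u s"
  shows "intertwines (carrier G) (group_algebra_space G u) (left_translate G)
    (group_algebra_space H v) (left_translate H) \<phi> (\<lambda>f h. if h \<in> carrier H then f (\<psi> h) else 0)"
proof -
  interpret G: locally_compact_group G by fact
  interpret H: locally_compact_group H by fact
  let ?\<tau> = "\<lambda>f h. if h \<in> carrier H then f (\<psi> h) else 0"
  have hom: "\<phi> \<in> hom G H" and bij: "bij_betw \<phi> (carrier G) (carrier H)" using \<phi> by (auto simp: iso_def)
  interpret h: group_hom G H \<phi> by unfold_locales (rule hom)
  have inj: "inj_on \<phi> (carrier G)" using bij by (simp add: bij_betw_def)
  have \<psi>\<phi>: "\<psi> (\<phi> s) = s" if "s \<in> carrier G" for s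
    using that \<psi>[of "\<phi> s"] inj by (auto dest: inj_onD)
  have supp: "{h. ?\<tau> f h \<noteq> 0} = \<phi> ` {s. f s \<noteq> 0}" if f: "f \<in> carrier (group_algebra_space G u)" for f
  proof -
    have "s \<in> carrier G" if "f s \<noteq> 0" for s using f that by (auto simp: G.group_algebra_carrier)
    then have sG: "{s. f s \<noteq> 0} \<subseteq> carrier G" by blast
    show ?thesis
    proof
      show "{h. ?\<tau> f h \<noteq> 0} \<subseteq> \<phi> ` {s. f s \<noteq> 0}"
      proof clarify
        fix h assume "?\<tau> f h \<noteq> 0"
        then have h: "h \<in> carrier H" "f (\<psi> h) \<noteq> 0" by (auto split: if_splits)
        then show "h \<in> \<phi> ` {s. f s \<noteq> 0}" using \<psi>[OF h(1)] by (intro image_eqI[of _ _ "\<psi> h"]) auto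
      qed
      show "\<phi> ` {s. f s \<noteq> 0} \<subseteq> {h. ?\<tau> f h \<noteq> 0}"
        using sG \<psi>\<phi> by (auto simp: subset_iff)
    qed
  qed
  have closed: "?\<tau> f \<in> carrier (group_algebra_space H v)" if f: "f \<in> carrier (group_algebra_space G u)" for f
    unfolding H.group_algebra_carrier supp[OF f] using f by (auto simp: G.group_algebra_carrier)
  have "g \<in> ?\<tau> ` carrier (group_algebra_space G u)" if g: "g \<in> carrier (group_algebra_space H v)" for g
  proof -
    have gc: "finite {h. g h \<noteq> 0}" "{h. g h \<noteq> 0} \<subseteq> carrier H" using g by (auto simp: H.group_algebra_carrier)
    define f where "f = (\<lambda>s. if s \<in> carrier G then g (\<phi> s) else 0)"
    have "{s. f s \<noteq> 0} \<subseteq> \<psi> ` {h. g h \<noteq> 0}"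
    proof clarify
      fix s assume "f s \<noteq> 0"
      then have "s \<in> carrier G" "g (\<phi> s) \<noteq> 0" by (auto simp: f_def split: if_splits)
      then show "s \<in> \<psi> ` {h. g h \<noteq> 0}" using \<psi>\<phi>[of s] by (intro image_eqI[of _ _ "\<phi> s"]) auto
    qed
    then have "finite {s. f s \<noteq> 0}" using gc(1) by (meson finite_imageI finite_subset)
    then have "f \<in> carrier (group_algebra_space G u)" by (auto simp: G.group_algebra_carrier f_def split: if_splits)
    moreover have "g = ?\<tau> f" using gc(2) \<psi> by (auto simp: f_def fun_eq_iff)
    ultimately show ?thesis by blast
  qed
  then have "?\<tau> ` carrier (group_algebra_space G u) = carrier (group_algebra_space H v)" using closed by blast
  moreover have "ip (group_algebra_space H v) (?\<tau> f) (?\<tau> g) = ip (group_algebra_space G u) f g"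
    if f: "f \<in> carrier (group_algebra_space G u)" and g: "g \<in> carrier (group_algebra_space G u)" for f g
  proof -
    have fg: "finite {s. f s \<noteq> 0}" "{s. f s \<noteq> 0} \<subseteq> carrier G" "finite {s. g s \<noteq> 0}" "{s. g s \<noteq> 0} \<subseteq> carrier G"
      using f g by (auto simp: G.group_algebra_carrier)
    have "ip (group_algebra_space H v) (?\<tau> f) (?\<tau> g) =
      (\<Sum>a\<in>\<phi> ` {s. f s \<noteq> 0}. \<Sum>b\<in>\<phi> ` {s. g s \<noteq> 0}. ?\<tau> f a * cnj (?\<tau> g b) * v (inv\<^bsub>H\<^esub> b \<otimes>\<^bsub>H\<^esub> a))"
      by (rule H.group_algebra_ip) (use fg in \<open>simp_all add: supp[OF f] supp[OF g]\<close>)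
    also have "\<dots> = (\<Sum>a\<in>{s. f s \<noteq> 0}. \<Sum>b\<in>{s. g s \<noteq> 0}. ?\<tau> f (\<phi> a) * cnj (?\<tau> g (\<phi> b)) * v (inv\<^bsub>H\<^esub> (\<phi> b) \<otimes>\<^bsub>H\<^esub> \<phi> a))"
      using inj_on_subset[OF inj fg(2)] inj_on_subset[OF inj fg(4)] by (simp add: sum.reindex)
    also have "\<dots> = (\<Sum>a\<in>{s. f s \<noteq> 0}. \<Sum>b\<in>{s. g s \<noteq> 0}. f a * cnj (g b) * u (inv\<^bsub>G\<^esub> b \<otimes>\<^bsub>G\<^esub> a))"
    proof (intro sum.cong refl)
      fix a b assume "a \<in> {s. f s \<noteq> 0}" "b \<in> {s. g s \<noteq> 0}"
      then have ab: "a \<in> carrier G" "b \<in> carrier G" using fg by blast+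
      then have "v (inv\<^bsub>H\<^esub> (\<phi> b) \<otimes>\<^bsub>H\<^esub> \<phi> a) = u (inv\<^bsub>G\<^esub> b \<otimes>\<^bsub>G\<^esub> a)"
        using uv[of "inv\<^bsub>G\<^esub> b \<otimes>\<^bsub>G\<^esub> a"] by simp
      then show "?\<tau> f (\<phi> a) * cnj (?\<tau> g (\<phi> b)) * v (inv\<^bsub>H\<^esub> (\<phi> b) \<otimes>\<^bsub>H\<^esub> \<phi> a) = f a * cnj (g b) * u (inv\<^bsub>G\<^esub> b \<otimes>\<^bsub>G\<^esub> a)"
        using ab by (simp add: \<psi>\<phi>)
    qed
    also have "\<dots> = ip (group_algebra_space G u) f g"
      by (rule G.group_algebra_ip[OF fg(1) subset_refl fg(3) subset_refl, symmetric])
    finally show ?thesis .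
  qed
  moreover have "?\<tau> (left_translate G s f) = left_translate H (\<phi> s) (?\<tau> f)" if s: "s \<in> carrier G" for s f
  proof
    fix h
    show "?\<tau> (left_translate G s f) h = left_translate H (\<phi> s) (?\<tau> f) h"
    proof (cases "h \<in> carrier H")
      case True
      then have "\<phi> (inv\<^bsub>G\<^esub> s \<otimes>\<^bsub>G\<^esub> \<psi> h) = inv\<^bsub>H\<^esub> (\<phi> s) \<otimes>\<^bsub>H\<^esub> h" using s \<psi> by simp
      then have "\<psi> (inv\<^bsub>H\<^esub> (\<phi> s) \<otimes>\<^bsub>H\<^esub> h) = inv\<^bsub>G\<^esub> s \<otimes>\<^bsub>G\<^esub> \<psi> h"
        using \<psi>\<phi>[of "inv\<^bsub>G\<^esub> s \<otimes>\<^bsub>G\<^esub> \<psi> h"] s \<psi>[OF True] by simp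
      then show ?thesis using True s \<psi> by (simp add: left_translate_def)
    qed (simp add: left_translate_def)
  qed
  ultimately show ?thesis unfolding intertwines_def by blast
qed

lemma normalized_positive_definite_pullback:
  fixes G :: "('a, 'g) top_monoid_scheme" and H :: "('b, 'h) top_monoid_scheme"
  assumes "group G" "group H" "topspace (topo G) = carrier G"
    and hom: "\<phi> \<in> hom G H" and cont: "continuous_map (topo G) (topo H) \<phi>"
    and v: "v \<in> normalized_positive_definite H"
  shows "(\<lambda>s\<in>carrier G. v (\<phi> s)) \<in> normalized_positive_definite G"
proof -
  interpret h: group_hom G H \<phi> using assms(1,2) hom by (intro group_hom.intro group_hom_axioms.intro)
  have vc: "continuous_map (topo H) euclidean v" and v1: "v \<one>\<^bsub>H\<^esub> = 1"
    and vp: "\<forall>(n :: nat) c s. (\<forall>i<n. s i \<in> carrier H) \<longrightarrow>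
      (\<Sum>i<n. \<Sum>j<n. c i * cnj (c j) * v (inv\<^bsub>H\<^esub> (s j) \<otimes>\<^bsub>H\<^esub> s i)) \<in> \<real>\<^sub>\<ge>\<^sub>0"
    using v by (simp_all add: normalized_positive_definite_def)
  show ?thesis
    unfolding normalized_positive_definite_def
  proof (intro CollectI conjI allI impI)
    show "continuous_map (topo G) euclidean (\<lambda>s\<in>carrier G. v (\<phi> s))"
      by (rule continuous_map_eq[OF continuous_map_compose[OF cont vc]]) (simp add: assms(3))
    fix n :: nat and c :: "nat \<Rightarrow> complex" and s assume s: "\<forall>i<n. s i \<in> carrier G"
    then have "\<forall>i<n. \<phi> (s i) \<in> carrier H" by simp
    from vp[THEN spec, THEN spec, THEN spec, THEN mp, OF this]
    have "(\<Sum>i<n. \<Sum>j<n. c i * cnj (c j) * v (inv\<^bsub>H\<^esub> (\<phi> (s j)) \<otimes>\<^bsub>H\<^esub> \<phi> (s i))) \<in> \<real>\<^sub>\<ge>\<^sub>0" .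
    also have "(\<Sum>i<n. \<Sum>j<n. c i * cnj (c j) * v (inv\<^bsub>H\<^esub> (\<phi> (s j)) \<otimes>\<^bsub>H\<^esub> \<phi> (s i))) =
      (\<Sum>i<n. \<Sum>j<n. c i * cnj (c j) * (\<lambda>s\<in>carrier G. v (\<phi> s)) (inv\<^bsub>G\<^esub> (s j) \<otimes>\<^bsub>G\<^esub> s i))"
      using s by (intro sum.cong refl) auto
    finally show "(\<Sum>i<n. \<Sum>j<n. c i * cnj (c j) * (\<lambda>s\<in>carrier G. v (\<phi> s)) (inv\<^bsub>G\<^esub> (s j) \<otimes>\<^bsub>G\<^esub> s i)) \<in> \<real>\<^sub>\<ge>\<^sub>0" .
  qed (simp_all add: v1)
qed

text \<open>Pullback along \<open>\<phi>\<close> is a bijection of the normalized positive definite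
  functions. For each of them the isometry of group algebras passes to Cauchy sequences and
  separations, and one choice for each index yields the isometry of the direct sums.\<close>

lemma eberlein_compactification_cong:
  fixes G :: "('a, 'g) top_monoid_scheme" and H :: "('b, 'h) top_monoid_scheme"
  assumes G: "locally_compact_group G" and H: "locally_compact_group H" and iso: "top_isomorphic G H"
  shows "top_isomorphic (eberlein_compactification G) (eberlein_compactification H)"
proof -
  interpret G: locally_compact_group G by fact
  interpret H: locally_compact_group H by fact
  obtain \<phi> where \<phi>: "\<phi> \<in> iso G H" and homeo: "homeomorphic_map (topo G) (topo H) \<phi>"
    using iso unfolding top_isomorphic_def by blast
  have hom: "\<phi> \<in> hom G H" and bij: "bij_betw \<phi> (carrier G) (carrier H)" using \<phi> by (auto simp: iso_def)
  have \<phi>c: "\<phi> s \<in> carrier H" if "s \<in> carrier G" for s using bij_betwE[OF bij] that by blast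
  obtain \<psi> where \<psi>: "homeomorphic_maps (topo G) (topo H) \<phi> \<psi>" using homeo homeomorphic_map_maps by blast
  have \<psi>1: "\<psi> h \<in> carrier G \<and> \<phi> (\<psi> h) = h" if "h \<in> carrier H" for h
    using \<psi> that continuous_map_funspace[of "topo H" "topo G" \<psi>]
    by (auto simp: homeomorphic_maps_def G.topspace_topo H.topspace_topo)
  have \<psi>2: "\<psi> (\<phi> s) = s" if "s \<in> carrier G" for s
    using \<psi> that by (simp add: homeomorphic_maps_def G.topspace_topo)
  have \<psi>_hom: "\<psi> \<in> hom H G"
  proof (rule homI)
    fix x y assume xy: "x \<in> carrier H" "y \<in> carrier H"
    have "\<phi> (\<psi> x \<otimes>\<^bsub>G\<^esub> \<psi> y) = x \<otimes>\<^bsub>H\<^esub> y" using \<psi>1 xy hom_mult[OF hom, of "\<psi> x" "\<psi> y"] by simp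
    then show "\<psi> (x \<otimes>\<^bsub>H\<^esub> y) = \<psi> x \<otimes>\<^bsub>G\<^esub> \<psi> y" using \<psi>2[of "\<psi> x \<otimes>\<^bsub>G\<^esub> \<psi> y"] \<psi>1 xy by simp
  qed (use \<psi>1 in blast)
  let ?P = "normalized_positive_definite G" and ?Q = "normalized_positive_definite H"
  define \<theta> where "\<theta> v = (\<lambda>s\<in>carrier G. v (\<phi> s))" for v :: "'b \<Rightarrow> complex"
  define \<theta>' where "\<theta>' u = (\<lambda>h\<in>carrier H. u (\<psi> h))" for u :: "'a \<Rightarrow> complex"
  have \<theta>P: "\<theta> v \<in> ?P" if "v \<in> ?Q" for v
    unfolding \<theta>_def by (rule normalized_positive_definite_pullback[OF G.is_group H.is_group G.topspace_topo hom
        homeomorphic_imp_continuous_map[OF homeo] that])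
  have \<theta>'Q: "\<theta>' u \<in> ?Q" if "u \<in> ?P" for u
    unfolding \<theta>'_def using \<psi>
    by (intro normalized_positive_definite_pullback[OF H.is_group G.is_group H.topspace_topo \<psi>_hom _ that])
      (simp add: homeomorphic_maps_def)
  have ext: "w \<in> ?P \<Longrightarrow> w \<in> extensional (carrier G)" "w' \<in> ?Q \<Longrightarrow> w' \<in> extensional (carrier H)" for w w'
    by (simp_all add: normalized_positive_definite_def)
  have \<theta>: "bij_betw \<theta> ?Q ?P"
  proof (rule bij_betwI[where g = \<theta>'])
    show "\<theta>' (\<theta> v) = v" if "v \<in> ?Q" for v
      using ext(2)[OF that] \<psi>1 by (intro extensionalityI[of _ "carrier H"]) (auto simp: \<theta>_def \<theta>'_def)
    show "\<theta> (\<theta>' u) = u" if "u \<in> ?P" for u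
      using ext(1)[OF that] \<psi>2 \<phi>c by (intro extensionalityI[of _ "carrier G"]) (auto simp: \<theta>_def \<theta>'_def)
  qed (use \<theta>P \<theta>'Q in auto)
  have "\<exists>\<tau>. intertwines (carrier G) (gns_space G (\<theta> v)) (gns_rep G (\<theta> v)) (gns_space H v) (gns_rep H v) \<phi> \<tau>"
    if v: "v \<in> ?Q" for v
  proof -
    have "intertwines (carrier G) (group_algebra_space G (\<theta> v)) (left_translate G)
      (group_algebra_space H v) (left_translate H) \<phi> (\<lambda>f h. if h \<in> carrier H then f (\<psi> h) else 0)"
      by (rule intertwines_group_algebra[OF G H \<phi> \<psi>1]) (simp_all add: \<theta>_def)
    note cauchy = intertwines_cauchy_space[OF G.semi_ip_group_algebra[OF \<theta>P[OF v]] H.semi_ip_group_algebra[OF v] this]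
    from intertwines_separation[OF
        isometric_action.isometric_action_cauchy_space[OF G.isometric_action_group_algebra[OF \<theta>P[OF v]]]
        isometric_action.isometric_action_cauchy_space[OF H.isometric_action_group_algebra[OF v]] \<phi>c cauchy]
    show ?thesis unfolding gns_space_def gns_rep_def .
  qed
  then have "\<forall>v\<in>?Q. \<exists>\<tau>. intertwines (carrier G) (gns_space G (\<theta> v)) (gns_rep G (\<theta> v)) (gns_space H v) (gns_rep H v) \<phi> \<tau>"
    by blast
  then obtain \<tau> where \<tau>: "\<forall>v\<in>?Q.
      intertwines (carrier G) (gns_space G (\<theta> v)) (gns_rep G (\<theta> v)) (gns_space H v) (gns_rep H v) \<phi> (\<tau> v)"
    unfolding bchoice_iff ..
  have "intertwines (carrier G) (universal_space G) (universal_rep G) (universal_space H) (universal_rep H) \<phi>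
    (\<lambda>\<xi>. \<lambda>v\<in>?Q. \<tau> v (\<xi> (\<theta> v)))"
    unfolding universal_space_def G.universal_rep_eq H.universal_rep_eq
    by (rule intertwines_direct_sum[OF G.family_gns H.family_gns _ \<theta>]) (simp_all add: \<phi>c \<tau>)
  then show ?thesis
    unfolding eberlein_compactification_def using bij
    by (intro top_isomorphic_compactifications G.unitary_action_universal H.unitary_action_universal)
      (auto simp: bij_betw_def)
qed

section \<open>Recovering the groups from their compactifications, and the converse for the
  universal ones\<close>

theorem corollary3p5:
  fixes G :: "'a top_monoid" and H :: "'b top_monoid"
    and \<mu> :: "'a measure" and \<nu> :: "'b measure"
    and V :: "'v ip_space" and \<pi> :: "'a \<Rightarrow> 'v \<Rightarrow> 'v"
    and W :: "'w ip_space" and \<sigma> :: "'b \<Rightarrow> 'w \<Rightarrow> 'w"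
  assumes "locally_compact_group G" and "locally_compact_group H"
  shows
    "(left_haar_measure G \<mu> \<and> left_haar_measure H \<nu> \<and>
      continuous_unitary_rep G V \<pi> \<and>
      eberlein_contained G (L2_space \<mu>) (left_regular_rep G \<mu>) V \<pi> \<and>
      continuous_unitary_rep H W \<sigma> \<and>
      eberlein_contained H (L2_space \<nu>) (left_regular_rep H \<nu>) W \<sigma> \<and>
      top_isomorphic (rep_compactification G V \<pi>) (rep_compactification H W \<sigma>)
        \<longrightarrow> top_isomorphic G H) \<and>
     (top_isomorphic (eberlein_compactification G) (eberlein_compactification H)
        \<longleftrightarrow> top_isomorphic G H)"
proof (intro conjI impI iffI)
  interpret G: locally_compact_group G by fact
  interpret H: locally_compact_group H by fact
  {
    assume *: "left_haar_measure G \<mu> \<and> left_haar_measure H \<nu> \<and>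
      continuous_unitary_rep G V \<pi> \<and>
      eberlein_contained G (L2_space \<mu>) (left_regular_rep G \<mu>) V \<pi> \<and>
      continuous_unitary_rep H W \<sigma> \<and>
      eberlein_contained H (L2_space \<nu>) (left_regular_rep H \<nu>) W \<sigma> \<and>
      top_isomorphic (rep_compactification G V \<pi>) (rep_compactification H W \<sigma>)"
    then have haar: "left_haar_measure G \<mu>" "left_haar_measure H \<nu>"
      and rep: "continuous_unitary_rep G V \<pi>" "continuous_unitary_rep H W \<sigma>"
      and contained: "eberlein_contained G (L2_space \<mu>) (left_regular_rep G \<mu>) V \<pi>"
        "eberlein_contained H (L2_space \<nu>) (left_regular_rep H \<nu>) W \<sigma>"
      and iso: "top_isomorphic (rep_compactification G V \<pi>) (rep_compactification H W \<sigma>)"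
      by simp_all
    interpret \<mu>: haar_measure G \<mu>
      by (intro haar_measure.intro haar_measure_axioms.intro assms haar)
    interpret \<nu>: haar_measure H \<nu>
      by (intro haar_measure.intro haar_measure_axioms.intro assms haar)
    show "top_isomorphic G H"
      by (rule top_isomorphic_of_compactifications[OF
          continuous_unitary_rep_unitary_action[OF G.is_group G.topspace_topo rep(1)] G.Hausdorff
          \<mu>.separating_of_eberlein_contained[OF contained(1)]
          continuous_unitary_rep_unitary_action[OF H.is_group H.topspace_topo rep(2)] assms(2)
          \<nu>.separating_of_eberlein_contained[OF contained(2)] iso])
  }
  show "top_isomorphic G H"
    if "top_isomorphic (eberlein_compactification G) (eberlein_compactification H)"
    using that unfolding eberlein_compactification_def
    by (intro top_isomorphic_of_compactifications[OF G.unitary_action_universal G.Hausdorff G.separating_universal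
        H.unitary_action_universal assms(2) H.separating_universal])
  show "top_isomorphic (eberlein_compactification G) (eberlein_compactification H)" if "top_isomorphic G H"
    by (rule eberlein_compactification_cong[OF assms that])
qed

end
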